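(* Let $n\in\mathbb{N}$. The random vector $\{W^k_{(a,b)}\}_{(a,b,k)\in I_n\cup I_{n+1}}$ has a probability density $f$ with respect to Lebesgue measure on $\mathbb{R}^{I_n\cup I_{n+1}}$, given as follows. For non-negative $\{p^k_{(a,b)}\}_{(a,b,k)\in I_n\cup I_{n+1}}$ satisfying the interlacing condition — $p^k_{(a,b)}\le p^k_{(a+1,b)}$, $p^k_{(a,b)}\le p^k_{(a,b+1)}$, $p^k_{(a,b)}\ge p^{k+1}_{(a+1,b)}$ and $p^k_{(a,b)}\ge p^{k+1}_{(a,b+1)}$ for every $(a,b,k)\in I_n$ (whenever the indices involved lie in $I_{n+1}$) — \[f\big(\{p^k_{(a,b)}\}\big)=\frac1Z\exp\Big(-\sum_{(a,b,k)\in I_{n+1}}p^k_{(a,b)}+\sum_{(a,b,k)\in I_n}p^k_{(a,b)}\Big),\] where $Z$ is a normalizing constant; and $f=0$ at configurations not satisfying the interlacing condition.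
   Context: $\{\xi(v)\}_{v\in\mathbb{Z}^2}$ are i.i.d. exponential of mean $1$; $u\preceq v$ means coordinatewise $\le$; $T(\gamma)=\sum_{z\in\gamma}\xi(z)$ for an up-right lattice path. For $k\in\mathbb{N}$ and $u\preceq v$, $L^k_{u,v}=\max\sum_{i=1}^kT(\gamma_i)$ over all $k$-tuples of (possibly empty) mutually disjoint up-right paths $\gamma_1,\dots,\gamma_k$ contained in $\{z\in\mathbb{Z}^2:u\preceq z\preceq v\}$; $L^0_{u,v}=0$, $W^k_{u,v}=L^k_{u,v}-L^{k-1}_{u,v}$, and $W^k_v=W^k_{(0,0),v}$. For $n\in\mathbb{N}$, $I_n=\{(a,b,k):a,b\in\mathbb{Z}_{\ge0},\ a+b=n,\ k\in\{1,\dots,1+\min(a,b)\}\}$. *)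

theory Defs
  imports "HOL-Probability.Probability"
begin

definition up_right_path :: "(int \<times> int) list \<Rightarrow> bool" where
  "up_right_path \<gamma> \<longleftrightarrow>
     (\<forall>i. Suc i < length \<gamma> \<longrightarrow>
        (fst (\<gamma> ! Suc i) = fst (\<gamma> ! i) + 1 \<and> snd (\<gamma> ! Suc i) = snd (\<gamma> ! i)) \<or>
        (fst (\<gamma> ! Suc i) = fst (\<gamma> ! i) \<and> snd (\<gamma> ! Suc i) = snd (\<gamma> ! i) + 1))"

definition rect :: "int \<times> int \<Rightarrow> int \<times> int \<Rightarrow> (int \<times> int) set" where
  "rect u v = {z. fst u \<le> fst z \<and> snd u \<le> snd z \<and> fst z \<le> fst v \<and> snd z \<le> snd v}"

definition passage_time :: "(int \<times> int \<Rightarrow> real) \<Rightarrow> (int \<times> int) list \<Rightarrow> real" where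
  "passage_time w \<gamma> = sum_list (map w \<gamma>)"

text \<open>L^k_{u,v}: maximum over k-tuples of mutually disjoint (possibly empty) up-right paths
  in the rectangle of the total passage time (for k = 0 this is the empty sum, i.e. 0).\<close>
definition LPP :: "nat \<Rightarrow> (int \<times> int \<Rightarrow> real) \<Rightarrow> int \<times> int \<Rightarrow> int \<times> int \<Rightarrow> real" where
  "LPP k w u v = Max {(\<Sum>i<k. passage_time w (\<gamma>s i)) | \<gamma>s.
      (\<forall>i<k. up_right_path (\<gamma>s i) \<and> set (\<gamma>s i) \<subseteq> rect u v) \<and>
      (\<forall>i<k. \<forall>j<k. i \<noteq> j \<longrightarrow> set (\<gamma>s i) \<inter> set (\<gamma>s j) = {})}"

definition Wuv :: "nat \<Rightarrow> (int \<times> int \<Rightarrow> real) \<Rightarrow> int \<times> int \<Rightarrow> int \<times> int \<Rightarrow> real" where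
  "Wuv k w u v = LPP k w u v - LPP (k - 1) w u v"

definition W :: "nat \<Rightarrow> (int \<times> int \<Rightarrow> real) \<Rightarrow> int \<times> int \<Rightarrow> real" where
  "W k w v = Wuv k w (0, 0) v"

definition Iset :: "nat \<Rightarrow> (nat \<times> nat \<times> nat) set" where
  "Iset n = {(a, b, k). a + b = n \<and> 1 \<le> k \<and> k \<le> 1 + min a b}"

definition interlacing :: "nat \<Rightarrow> (nat \<times> nat \<times> nat \<Rightarrow> real) \<Rightarrow> bool" where
  "interlacing n p \<longleftrightarrow>
     (\<forall>j \<in> Iset n \<union> Iset (Suc n). 0 \<le> p j) \<and>
     (\<forall>a b k. (a, b, k) \<in> Iset n \<longrightarrow>
        ((a + 1, b, k) \<in> Iset (Suc n) \<longrightarrow> p (a, b, k) \<le> p (a + 1, b, k)) \<and>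
        ((a, b + 1, k) \<in> Iset (Suc n) \<longrightarrow> p (a, b, k) \<le> p (a, b + 1, k)) \<and>
        ((a + 1, b, k + 1) \<in> Iset (Suc n) \<longrightarrow> p (a + 1, b, k + 1) \<le> p (a, b, k)) \<and>
        ((a, b + 1, k + 1) \<in> Iset (Suc n) \<longrightarrow> p (a, b + 1, k + 1) \<le> p (a, b, k)))"

end

theory Submission
  imports Defs "Jordan_Normal_Form.Determinant"
begin

text \<open>The numbers \<open>W k\<close> satisfy the local (growth diagram) rule of the
  Robinson--Schensted--Knuth correspondence: given the values \<open>\<lambda>\<close>, \<open>\<mu>\<close>, \<open>\<nu>\<close> at
  \<open>(a, b)\<close>, \<open>(a, b + 1)\<close>, \<open>(a + 1, b)\<close> and the weight \<open>x\<close> at \<open>(a + 1, b + 1)\<close>, the values there are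
  \<open>x + max \<mu>\<^sub>1 \<nu>\<^sub>1\<close> and \<open>max \<mu>\<^sub>k\<^sub>+\<^sub>1 \<nu>\<^sub>k\<^sub>+\<^sub>1 + min \<mu>\<^sub>k \<nu>\<^sub>k - \<lambda>\<^sub>k\<close>. For fixed \<open>\<mu>\<close> and \<open>\<nu>\<close> this is a translation in
  \<open>x\<close> and a reflection in each \<open>\<lambda>\<^sub>k\<close>, so it preserves volume; it turns the constraint \<open>x \<ge> 0\<close> and the
  interlacing of one pair of antidiagonals into the interlacing of the next pair, and it transports the
  exponent. The density follows by induction on the antidiagonal, with \<open>Z = 1\<close>.

  The local rule amounts to an identity between last passage values. At positive temperature,
  the partition function of \<open>k\<close> disjoint paths with packed endpoints is a determinant (adding vertices
  one antidiagonal at a time, both sides obey the same recursion), and the identity is an instance of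
  the Desnanot--Jacobi identity; then the temperature tends to zero. Disjoint paths with free endpoints
  can be rerouted to have packed endpoints without losing a vertex: the new paths are the level
  lines of the function measuring the longest antichain to the upper left of a point.\<close>

text \<open>A pair of antidiagonals carries a density because of a count:
  \<open>level (Suc m)\<close> has one entry for each weight on the new antidiagonal and one for
  each entry of \<open>level (m - 1)\<close>, so two successive levels have together as many entries
  as there are weights so far. The energy of the pair is the sum of all these weights, whence the
  joint exponential density of the weights becomes the claimed one with no constant left over.
  Positive temperature is used because a determinant has signs, while max-plus algebra has no
  subtraction: the identity is proved over the reals, and each product of partition functions is
  then compared with the exponential of its largest term. Packed endpoints make the determinants
  minors of one array with consecutive rows, which is what Desnanot-Jacobi requires. The free
  endpoints in \<open>LPP\<close> are the obstacle, and a constructive form of Dilworth's theorem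
  removes it: a set whose antichains have at most k points is covered by k level lines.\<close>

section \<open>Determinants\<close>

definition fdet :: "nat \<Rightarrow> (nat \<Rightarrow> nat \<Rightarrow> real) \<Rightarrow> real" where
  "fdet k v = det (mat k k (\<lambda>(i, j). v i j))"

text \<open>The increasing enumeration of the naturals other than \<open>a\<close>; composing rows
  and columns with it yields the minors of a Laplace expansion.\<close>

abbreviation skip :: "nat \<Rightarrow> nat \<Rightarrow> nat" where
  "skip a i \<equiv> (if i < a then i else Suc i)"

lemma fdet_cong:
  assumes "\<And>i j. i < k \<Longrightarrow> j < k \<Longrightarrow> v i j = v' i j"
  shows "fdet k v = fdet k v'"
  unfolding fdet_def by (rule arg_cong[where f = det], rule eq_matI) (auto simp: assms)

lemma fdet_0 [simp]: "fdet 0 v = 1"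
  by (simp add: fdet_def)

lemma fdet_laplace_row:
  assumes "i < Suc n"
  shows "fdet (Suc n) v =
    (\<Sum>j<Suc n. v i j * ((-1) ^ (i + j) * fdet n (\<lambda>i' j'. v (skip i i') (skip j j'))))"
proof -
  let ?A = "mat (Suc n) (Suc n) (\<lambda>(i, j). v i j)"
  have "det ?A = (\<Sum>j<Suc n. ?A $$ (i, j) * cofactor ?A i j)"
    using assms by (intro laplace_expansion_row) auto
  also have "\<dots> = (\<Sum>j<Suc n. v i j * ((-1) ^ (i + j) * fdet n (\<lambda>i' j'. v (skip i i') (skip j j'))))"
  proof (rule sum.cong[OF refl])
    fix j assume "j \<in> {..<Suc n}"
    moreover have "mat_delete ?A i j = mat n n (\<lambda>(i', j'). v (skip i i') (skip j j'))"
      by (rule eq_matI) (auto simp: mat_delete_def)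
    ultimately show "?A $$ (i, j) * cofactor ?A i j =
        v i j * ((-1) ^ (i + j) * fdet n (\<lambda>i' j'. v (skip i i') (skip j j')))"
      using assms by (simp add: cofactor_def fdet_def)
  qed
  finally show ?thesis by (simp add: fdet_def)
qed

lemma fdet_laplace_column:
  assumes "j < Suc n"
  shows "fdet (Suc n) v =
    (\<Sum>i<Suc n. v i j * ((-1) ^ (i + j) * fdet n (\<lambda>i' j'. v (skip i i') (skip j j'))))"
proof -
  let ?A = "mat (Suc n) (Suc n) (\<lambda>(i, j). v i j)"
  have "det ?A = (\<Sum>i<Suc n. ?A $$ (i, j) * cofactor ?A i j)"
    using assms by (intro laplace_expansion_column) auto
  also have "\<dots> = (\<Sum>i<Suc n. v i j * ((-1) ^ (i + j) * fdet n (\<lambda>i' j'. v (skip i i') (skip j j'))))"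
  proof (rule sum.cong[OF refl])
    fix i assume "i \<in> {..<Suc n}"
    moreover have "mat_delete ?A i j = mat n n (\<lambda>(i', j'). v (skip i i') (skip j j'))"
      by (rule eq_matI) (auto simp: mat_delete_def)
    ultimately show "?A $$ (i, j) * cofactor ?A i j =
        v i j * ((-1) ^ (i + j) * fdet n (\<lambda>i' j'. v (skip i i') (skip j j')))"
      using assms by (simp add: cofactor_def fdet_def)
  qed
  finally show ?thesis by (simp add: fdet_def)
qed

lemma fdet_equal_rows:
  assumes "a < k" "b < k" "a \<noteq> b" "\<And>j. j < k \<Longrightarrow> v a j = v b j"
  shows "fdet k v = 0"
  unfolding fdet_def using assms
  by (intro det_identical_rows[of _ k a b]) (auto intro!: eq_vecI)

lemma fdet_equal_columns:
  assumes "a < k" "b < k" "a \<noteq> b" "\<And>i. i < k \<Longrightarrow> v i a = v i b"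
  shows "fdet k v = 0"
  unfolding fdet_def using assms
  by (intro det_identical_columns[of _ k a b]) (auto intro!: eq_vecI)

lemma fdet_zero_row:
  assumes "a < k" "\<And>j. j < k \<Longrightarrow> v a j = 0"
  shows "fdet k v = 0"
proof -
  obtain n where k: "k = Suc n" using assms(1) by (cases k) auto
  show ?thesis unfolding k
    by (subst fdet_laplace_row[of a]) (use assms k in auto)
qed

lemma fdet_diagonal:
  "fdet k (\<lambda>i j. if i = j then d i else 0) = (\<Prod>i<k. d i)"
proof (induction k)
  case (Suc k)
  have "fdet (Suc k) (\<lambda>i j. if i = j then d i else 0) =
      (\<Sum>j<Suc k. if j = k then d k * fdet k (\<lambda>i j. if i = j then d i else 0) else 0)"
    by (subst fdet_laplace_row[of k], simp, rule sum.cong[OF refl])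
       (auto simp flip: mult_2 intro!: fdet_cong)
  then show ?case by (simp add: Suc)
qed simp

text \<open>Multilinearity in all rows at once. In the walker recursion \<open>S\<close> is the set
  of walkers that keep their abscissa in the last step, and \<open>y i\<close> is the weight of the
  site reached.\<close>

lemma fdet_rows_add:
  "fdet k (\<lambda>i j. y i * (u i j + v i j)) =
    (\<Prod>i<k. y i) * (\<Sum>S\<in>Pow {..<k}. fdet k (\<lambda>i j. if i \<in> S then u i j else v i j))"
proof -
  let ?P = "{p. p permutes {0..<k}}"
  have leib: "fdet k a = (\<Sum>p\<in>?P. signof p * (\<Prod>i<k. a i (p i)))" for a
  proof -
    have "det (mat k k (\<lambda>(i, j). a i j)) =
        (\<Sum>p\<in>?P. signof p * (\<Prod>i = 0..<k. mat k k (\<lambda>(i, j). a i j) $$ (i, p i)))"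
      by (rule det_def') simp
    also have "\<dots> = (\<Sum>p\<in>?P. signof p * (\<Prod>i<k. a i (p i)))"
      by (intro sum.cong refl arg_cong2[where f = "(*)"] prod.cong)
         (auto simp: lessThan_atLeast0 permutes_in_image)
    finally show ?thesis by (simp add: fdet_def)
  qed
  have split: "(\<Prod>i<k. if i \<in> S then u i (p i) else v i (p i)) =
      (\<Prod>i\<in>S. u i (p i)) * (\<Prod>i\<in>{..<k} - S. v i (p i))"
    if "S \<in> Pow {..<k}" for S and p :: "nat \<Rightarrow> nat"
  proof -
    have "(\<Prod>i<k. if i \<in> S then u i (p i) else v i (p i)) =
        (\<Prod>i\<in>{..<k} \<inter> {i. i \<in> S}. u i (p i)) * (\<Prod>i\<in>{..<k} \<inter> - {i. i \<in> S}. v i (p i))"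
      by (rule prod.If_cases) simp
    moreover have "{..<k} \<inter> {i. i \<in> S} = S" "{..<k} \<inter> - {i. i \<in> S} = {..<k} - S"
      using that by auto
    ultimately show ?thesis by simp
  qed
  have "fdet k (\<lambda>i j. y i * (u i j + v i j)) =
      (\<Sum>p\<in>?P. signof p * ((\<Prod>i<k. y i) *
        (\<Sum>S\<in>Pow {..<k}. \<Prod>i<k. if i \<in> S then u i (p i) else v i (p i))))"
    unfolding leib prod.distrib by (subst prod_add) (simp_all add: split)
  also have "\<dots> = (\<Prod>i<k. y i) * (\<Sum>p\<in>?P. \<Sum>S\<in>Pow {..<k}.
        signof p * (\<Prod>i<k. if i \<in> S then u i (p i) else v i (p i)))"
    by (simp add: sum_distrib_left mult_ac)
  also have "\<dots> = (\<Prod>i<k. y i) * (\<Sum>S\<in>Pow {..<k}. fdet k (\<lambda>i j. if i \<in> S then u i j else v i j))"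
    unfolding leib by (subst sum.swap) (rule refl)
  finally show ?thesis .
qed

text \<open>The pivots are the first and the last row and the last two columns. Take the cofactors
  \<open>C\<close> of the last column and the linear functional \<phi> that puts a row on top of the
  rows 1 to \<open>m\<close>, with column \<open>m\<close> deleted, and evaluates the determinant.
  The sum of \<open>C i * \<phi> (M i)\<close> is computed twice: summing over \<open>i\<close>
  first, only the last column survives and gives the product on the left; row by row, \<phi> kills
  the rows 1 to \<open>m\<close> and the two outer rows give the products on the right. No division
  occurs.\<close>

lemma desnanot_jacobi:
  fixes M :: "nat \<Rightarrow> nat \<Rightarrow> real"
  shows "fdet (Suc (Suc m)) M * fdet m (\<lambda>i j. M (Suc i) j) =
    fdet (Suc m) M * fdet (Suc m) (\<lambda>i j. M (Suc i) (skip m j)) -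
    fdet (Suc m) (\<lambda>i j. M (Suc i) j) * fdet (Suc m) (\<lambda>i j. M i (skip m j))"
proof -
  define C where "C i = (-1) ^ (i + Suc m) * fdet (Suc m) (\<lambda>i' j'. M (skip i i') j')" for i
  define c where "c j = fdet m (\<lambda>i' j'. M (Suc i') (skip m (skip j j')))" for j
  define \<phi> where "\<phi> r = (\<Sum>j<Suc m. r (skip m j) * ((-1) ^ j * c j))" for r :: "nat \<Rightarrow> real"
  have C: "(\<Sum>i<Suc (Suc m). M i l * C i) = (if l = Suc m then fdet (Suc (Suc m)) M else 0)"
    if l: "l < Suc (Suc m)" for l
  proof -
    \<comment> \<open>Replacing the last column by column \<open>l\<close> pairs that column with
      the cofactors \<open>C\<close>: either nothing changes or two columns agree.\<close>
    define N where "N i j = (if j = Suc m then M i l else M i j)" for i j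
    have "fdet (Suc (Suc m)) N = (\<Sum>i<Suc (Suc m). N i (Suc m) * ((-1) ^ (i + Suc m) *
        fdet (Suc m) (\<lambda>i' j'. N (skip i i') (skip (Suc m) j'))))"
      by (rule fdet_laplace_column) simp
    also have "\<dots> = (\<Sum>i<Suc (Suc m). M i l * C i)"
      unfolding C_def
      by (intro sum.cong refl arg_cong2[where f = "(*)"] fdet_cong) (auto simp: N_def)
    finally have *: "(\<Sum>i<Suc (Suc m). M i l * C i) = fdet (Suc (Suc m)) N" by simp
    show ?thesis
    proof (cases "l = Suc m")
      case True
      then have "N = M" by (intro ext) (simp add: N_def)
      with * True show ?thesis by simp
    next
      case False
      then have "fdet (Suc (Suc m)) N = 0"
        using l by (intro fdet_equal_columns[of l _ "Suc m"]) (auto simp: N_def)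
      with * False show ?thesis by simp
    qed
  qed
  have row0: "\<phi> r = fdet (Suc m) (\<lambda>i j. if i = 0 then r (skip m j) else M i (skip m j))" for r
    unfolding \<phi>_def c_def by (subst fdet_laplace_row[of 0]) (simp_all)
  have \<phi>0: "\<phi> (M 0) = fdet (Suc m) (\<lambda>i j. M i (skip m j))"
    unfolding row0 by (rule fdet_cong) auto
  have \<phi>i: "\<phi> (M i) = 0" if "0 < i" "i < Suc m" for i
    unfolding row0 using that by (intro fdet_equal_rows[of 0 _ i]) auto
  have \<phi>m: "\<phi> (M (Suc m)) = (-1) ^ m * fdet (Suc m) (\<lambda>i j. M (Suc i) (skip m j))"
  proof -
    have "fdet (Suc m) (\<lambda>i j. M (Suc i) (skip m j)) =
        (\<Sum>j<Suc m. M (Suc m) (skip m j) * ((-1) ^ (m + j) * c j))"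
    proof -
      have "fdet m (\<lambda>i' j'. M (Suc (skip m i')) (skip m (skip j j'))) = c j" for j
        unfolding c_def by (rule fdet_cong) simp
      then show ?thesis by (subst fdet_laplace_row[of m]) simp_all
    qed
    moreover have "(-1) ^ m * (-1) ^ (m + j) = (-1 :: real) ^ j" for j
      by (simp add: power_add flip: mult.assoc power_mult_distrib)
    then have "\<phi> (M (Suc m)) =
        (-1) ^ m * (\<Sum>j<Suc m. M (Suc m) (skip m j) * ((-1) ^ (m + j) * c j))"
      unfolding \<phi>_def sum_distrib_left by (intro sum.cong refl) (simp add: mult_ac flip: mult.assoc)
    ultimately show ?thesis by simp
  qed
  have "(\<Sum>i<Suc (Suc m). C i * \<phi> (M i)) =
      (\<Sum>j<Suc m. (-1) ^ j * c j * (\<Sum>i<Suc (Suc m). M i (skip m j) * C i))"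
    unfolding \<phi>_def sum_distrib_left by (subst sum.swap) (simp add: mult_ac)
  also have "\<dots> = (\<Sum>j<Suc m. if j = m then (-1) ^ m * c m * fdet (Suc (Suc m)) M else 0)"
    by (rule sum.cong[OF refl], subst C) auto
  also have "\<dots> = (-1) ^ m * c m * fdet (Suc (Suc m)) M"
    by simp
  also have "c m = fdet m (\<lambda>i j. M (Suc i) j)"
    unfolding c_def by (rule fdet_cong) auto
  finally have A: "(\<Sum>i<Suc (Suc m). C i * \<phi> (M i)) =
      (-1) ^ m * fdet m (\<lambda>i j. M (Suc i) j) * fdet (Suc (Suc m)) M" .
  have "(\<Sum>i<Suc (Suc m). C i * \<phi> (M i)) =
      C 0 * \<phi> (M 0) + (\<Sum>i<m. C (Suc i) * \<phi> (M (Suc i))) + C (Suc m) * \<phi> (M (Suc m))"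
    by (subst sum.lessThan_Suc_shift) (simp add: add.assoc)
  also have "(\<Sum>i<m. C (Suc i) * \<phi> (M (Suc i))) = 0"
    by (rule sum.neutral) (auto simp: \<phi>i)
  also have "C 0 = - ((-1) ^ m * fdet (Suc m) (\<lambda>i j. M (Suc i) j))"
    by (simp add: C_def)
  also have "C (Suc m) = fdet (Suc m) M"
    unfolding C_def by (simp add: power_add[symmetric]) (rule fdet_cong, auto)
  finally have B: "(\<Sum>i<Suc (Suc m). C i * \<phi> (M i)) =
      (-1) ^ m * (fdet (Suc m) M * fdet (Suc m) (\<lambda>i j. M (Suc i) (skip m j)) -
    fdet (Suc m) (\<lambda>i j. M (Suc i) j) * fdet (Suc m) (\<lambda>i j. M i (skip m j)))"
    unfolding \<phi>0 \<phi>m by (simp add: algebra_simps)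
  have "(-1 :: real) ^ m \<noteq> 0" by simp
  then show ?thesis using A B by (simp add: mult_ac)
qed

text \<open>Adding to each row its successor is multiplication by the unitriangular
  \<open>?U\<close>. It annihilates the alternating column except in the last row, along whose entry
  the determinant is then expanded.\<close>

lemma fdet_sign_column:
  "fdet (Suc k) (\<lambda>i j. if j < k then z i j else c * (-1) ^ i) =
    c * (-1) ^ k * fdet k (\<lambda>i j. z i j + z (Suc i) j)"
proof -
  let ?N = "\<lambda>i j. if j < k then z i j else c * (-1) ^ i"
  let ?U = "mat (Suc k) (Suc k) (\<lambda>(i, j). if j = i \<or> j = Suc i then 1 else 0 :: real)"
  let ?A = "mat (Suc k) (Suc k) (\<lambda>(i, j). ?N i j)"
  let ?R = "\<lambda>i j. if i < k then ?N i j + ?N (Suc i) j else ?N i j"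
  have "det ?U = prod_list (diag_mat ?U)"
    by (rule det_upper_triangular[where n = "Suc k"]) auto
  also have "\<dots> = 1"
  proof -
    have "diag_mat ?U = replicate (Suc k) 1"
      by (rule nth_equalityI) (auto simp: diag_mat_def simp del: replicate_Suc upt_Suc)
    then show ?thesis by simp
  qed
  finally have U: "det ?U = 1" .
  have UA: "?U * ?A = mat (Suc k) (Suc k) (\<lambda>(i, j). ?R i j)"
  proof (rule eq_matI)
    fix i j assume ij: "i < dim_row (mat (Suc k) (Suc k) (\<lambda>(i, j). ?R i j))"
      "j < dim_col (mat (Suc k) (Suc k) (\<lambda>(i, j). ?R i j))"
    then have "(?U * ?A) $$ (i, j) =
        (\<Sum>l<Suc k. (if l = i \<or> l = Suc i then 1 else 0) * ?N l j)"
      by (auto simp: times_mat_def scalar_prod_def lessThan_atLeast0 intro!: sum.cong)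
    also have "\<dots> = (\<Sum>l\<in>{..<Suc k} \<inter> {i, Suc i}. ?N l j)"
      by (rule sum.mono_neutral_cong_right) auto
    also have "{..<Suc k} \<inter> {i, Suc i} = (if i < k then {i, Suc i} else {i})"
      using ij by auto
    also have "(\<Sum>l\<in>\<dots>. ?N l j) = ?R i j"
      by (simp only: split: if_split) simp
    finally show "(?U * ?A) $$ (i, j) = mat (Suc k) (Suc k) (\<lambda>(i, j). ?R i j) $$ (i, j)"
      using ij by simp
  qed auto
  have "fdet (Suc k) ?N = det ?U * det ?A" by (simp add: U fdet_def)
  also have "\<dots> = fdet (Suc k) ?R"
    by (subst det_mult[symmetric, where n = "Suc k"]) (simp_all only: UA fdet_def mat_carrier)
  also have "\<dots> = (\<Sum>i<Suc k. ?R i k * ((-1) ^ (i + k) * fdet k (\<lambda>i' j'. ?R (skip i i') (skip k j'))))"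
    by (rule fdet_laplace_column) simp
  also have "\<dots> = (\<Sum>i<Suc k. if i = k then c * (-1) ^ k * fdet k (\<lambda>i j. z i j + z (Suc i) j) else 0)"
    by (rule sum.cong[OF refl]) (auto simp: power_add[symmetric] mult_2[symmetric] intro!: fdet_cong)
  finally show ?thesis by simp
qed

text \<open>Apply the Desnanot--Jacobi identity to the matrix with rows \<open>(z i, (-1) ^ i)\<close>.\<close>
lemma fdet_consecutive:
  fixes z :: "nat \<Rightarrow> nat \<Rightarrow> real"
  defines "u \<equiv> \<lambda>i j. z i j + z (Suc i) j"
  shows "fdet (Suc m) u * fdet m (\<lambda>i. z (Suc i)) =
    fdet (Suc m) z * fdet m (\<lambda>i. u (Suc i)) + fdet (Suc m) (\<lambda>i. z (Suc i)) * fdet m u"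
proof -
  define M where "M i j = (if j < Suc m then z i j else (-1) ^ i)" for i j
  have 1: "fdet (Suc (Suc m)) M = (-1) ^ Suc m * fdet (Suc m) u"
  proof -
    have "fdet (Suc (Suc m)) M =
        fdet (Suc (Suc m)) (\<lambda>i j. if j < Suc m then z i j else 1 * (-1) ^ i)"
      by (rule fdet_cong) (auto simp: M_def)
    then show ?thesis unfolding fdet_sign_column by (simp add: u_def)
  qed
  have 2: "fdet (Suc m) (\<lambda>i j. M i (skip m j)) = (-1) ^ m * fdet m u"
  proof -
    have "fdet (Suc m) (\<lambda>i j. M i (skip m j)) =
        fdet (Suc m) (\<lambda>i j. if j < m then z i j else 1 * (-1) ^ i)"
      by (rule fdet_cong) (auto simp: M_def)
    then show ?thesis unfolding fdet_sign_column by (simp add: u_def)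
  qed
  \<comment> \<open>Dropping row 0 starts the alternating column with the opposite sign, hence the
    constant \<open>- 1\<close>.\<close>
  have 3: "fdet (Suc m) (\<lambda>i j. M (Suc i) (skip m j)) = - ((-1) ^ m * fdet m (\<lambda>i. u (Suc i)))"
  proof -
    have "fdet (Suc m) (\<lambda>i j. M (Suc i) (skip m j)) =
        fdet (Suc m) (\<lambda>i j. if j < m then z (Suc i) j else - 1 * (-1) ^ i)"
      by (rule fdet_cong) (auto simp: M_def)
    then show ?thesis unfolding fdet_sign_column by (simp add: u_def)
  qed
  have 4: "fdet (Suc m) M = fdet (Suc m) z" "fdet m (\<lambda>i. M (Suc i)) = fdet m (\<lambda>i. z (Suc i))"
    "fdet (Suc m) (\<lambda>i. M (Suc i)) = fdet (Suc m) (\<lambda>i. z (Suc i))"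
    by (auto intro!: fdet_cong simp: M_def)
  have "(-1) ^ m * (fdet (Suc m) u * fdet m (\<lambda>i. z (Suc i))) =
    (-1) ^ m * (fdet (Suc m) z * fdet m (\<lambda>i. u (Suc i)) +
      fdet (Suc m) (\<lambda>i. z (Suc i)) * fdet m u)"
    using desnanot_jacobi[of m M] unfolding 1 2 3 4 by (simp add: algebra_simps)
  then show ?thesis by (simp del: distrib_left)
qed

section \<open>Non-colliding walkers\<close>

text \<open>A path is a walker: at time \<open>c = x + y\<close> it sits at abscissa \<open>x\<close>, which each step keeps or
  increases by one. Auxiliary sites with \<open>x < 0\<close> carry weight \<open>0\<close>, so that \<open>k\<close> walkers can start
  together at time \<open>0\<close> from \<open>0, -1, \<dots>, -(k - 1)\<close>, the walker number \<open>s\<close> from \<open>-s\<close>.\<close>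
definition site :: "(int \<times> int \<Rightarrow> real) \<Rightarrow> nat \<Rightarrow> int \<Rightarrow> real" where
  "site w c x = (if 0 \<le> x then w (x, int c - x) else 0)"

text \<open>The partition function of one walker: the sum, over all walks from
  \<open>- int s\<close> at time 0 to \<open>x\<close> at time \<open>c\<close>, of the product of
  \<open>y\<close> along the walk, both ends included.\<close>

fun walk_sum :: "(nat \<Rightarrow> int \<Rightarrow> real) \<Rightarrow> nat \<Rightarrow> int \<Rightarrow> nat \<Rightarrow> real" where
  "walk_sum y 0 x s = (if x = - int s then y 0 x else 0)"
| "walk_sum y (Suc c) x s = y (Suc c) x * (walk_sum y c x s + walk_sum y c (x - 1) s)"

text \<open>The Lindstrom-Gessel-Viennot (Karlin-McGregor) determinant. Its meaning as a weight of
  non-colliding families enters only through two inequalities, both obtained from the one-step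
  recursion.\<close>

definition walk_det :: "(nat \<Rightarrow> int \<Rightarrow> real) \<Rightarrow> nat \<Rightarrow> nat \<Rightarrow> (nat \<Rightarrow> int) \<Rightarrow> real" where
  "walk_det y k c x = fdet k (\<lambda>i. walk_sum y c (x i))"

definition decr :: "nat \<Rightarrow> (nat \<Rightarrow> int) \<Rightarrow> bool" where
  "decr k x \<longleftrightarrow> (\<forall>i. Suc i < k \<longrightarrow> x (Suc i) < x i)"

definition walkers :: "nat \<Rightarrow> nat \<Rightarrow> (nat \<Rightarrow> nat \<Rightarrow> int) \<Rightarrow> bool" where
  "walkers k C X \<longleftrightarrow> (\<forall>i<k. X 0 i = - int i) \<and> (\<forall>c\<le>C. decr k (X c)) \<and>
    (\<forall>c<C. \<forall>i<k. X (Suc c) i = X c i \<or> X (Suc c) i = X c i + 1)"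

definition walk_weight :: "(int \<times> int \<Rightarrow> real) \<Rightarrow> nat \<Rightarrow> nat \<Rightarrow> (nat \<Rightarrow> nat \<Rightarrow> int) \<Rightarrow> real" where
  "walk_weight w k C X = (\<Sum>c\<le>C. \<Sum>i<k. site w c (X c i))"

lemma decr_le:
  assumes "decr k x" "i \<le> j" "j < k"
  shows "x j + int (j - i) \<le> x i"
  using assms(2,3)
proof (induction j rule: dec_induct)
  case (step j)
  then have "x (Suc j) < x j" using assms(1) by (simp add: decr_def)
  with step show ?case by (simp add: Suc_diff_le)
qed simp

lemma walk_det_cong:
  "(\<And>i. i < k \<Longrightarrow> x i = x' i) \<Longrightarrow> walk_det y k c x = walk_det y k c x'"
  unfolding walk_det_def by (rule fdet_cong) simp

lemma walk_det_Suc: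
  "walk_det y k (Suc c) x = (\<Prod>i<k. y (Suc c) (x i)) *
    (\<Sum>S\<in>Pow {..<k}. walk_det y k c (\<lambda>i. if i \<in> S then x i else x i - 1))"
proof -
  have "(\<lambda>i j. if i \<in> S then walk_sum y c (x i) j else walk_sum y c (x i - 1) j) =
      (\<lambda>i. walk_sum y c (if i \<in> S then x i else x i - 1))" for S
    by auto
  then show ?thesis unfolding walk_det_def walk_sum.simps fdet_rows_add by simp
qed

text \<open>Undoing a step lowers each entry of a strictly decreasing integer tuple by at most one,
  so the order can fail only through a collision of neighbours, and then two rows agree. This takes
  the place of switching paths.\<close>

lemma walk_det_not_decr:
  assumes "decr k x" "\<not> decr k (\<lambda>i. if i \<in> S then x i else x i - 1)"
  shows "walk_det y k c (\<lambda>i. if i \<in> S then x i else x i - 1) = 0"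
proof -
  let ?x = "\<lambda>i. if i \<in> S then x i else x i - 1"
  obtain i where i: "Suc i < k" "?x i \<le> ?x (Suc i)"
    using assms(2) by (auto simp: decr_def not_less)
  moreover have "x (Suc i) < x i" using assms(1) i(1) by (simp add: decr_def)
  ultimately have "?x i = ?x (Suc i)" by (simp split: if_splits)
  then show ?thesis unfolding walk_det_def using i(1)
    by (intro fdet_equal_rows[of i _ "Suc i"]) simp_all
qed

lemma walk_det_0:
  assumes "decr k x"
  shows "walk_det y k 0 x = (if \<forall>i<k. x i = - int i then \<Prod>i<k. y 0 (x i) else 0)"
proof (cases "\<forall>i<k. x i = - int i")
  case True
  then have "walk_det y k 0 x = fdet k (\<lambda>i j. if i = j then y 0 (x i) else 0)"
    unfolding walk_det_def by (intro fdet_cong) auto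
  with True show ?thesis by (simp add: fdet_diagonal)
next
  case False
  \<comment> \<open>A strictly decreasing \<open>k\<close>-tuple with values among the
    \<open>k\<close> start points is forced to be packed; otherwise some walker sits at no start
    point and its row vanishes.\<close>
  have "\<exists>i<k. \<forall>j<k. x i \<noteq> - int j"
  proof (rule ccontr)
    assume "\<not> ?thesis"
    then have all: "\<forall>i<k. \<exists>j<k. x i = - int j" by blast
    have "x i = - int i" if i: "i < k" for i
    proof -
      have "x i + int i \<le> x 0" using decr_le[OF assms, of 0 i] i by simp
      moreover have "x (k - 1) + int (k - 1 - i) \<le> x i"
        using decr_le[OF assms, of i "k - 1"] i by simp
      moreover obtain j where "j < k" "x 0 = - int j" using all[rule_format, of 0] i by auto
      moreover obtain j' where "j' < k" "x (k - 1) = - int j'" using all[rule_format, of "k - 1"] i by auto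
      ultimately show ?thesis using i by auto
    qed
    with False show False by blast
  qed
  then obtain i where "i < k" "\<forall>j<k. x i \<noteq> - int j" by blast
  then have "walk_det y k 0 x = 0"
    unfolding walk_det_def by (intro fdet_zero_row[of i]) auto
  with False show ?thesis by auto
qed

lemma walk_det_nonneg:
  assumes "\<And>c x. 0 \<le> y c x" "decr k x"
  shows "0 \<le> walk_det y k c x"
  using assms(2)
proof (induction c arbitrary: x)
  case 0
  then show ?case by (simp add: walk_det_0 prod_nonneg assms(1))
next
  case (Suc c)
  have "0 \<le> walk_det y k c (\<lambda>i. if i \<in> S then x i else x i - 1)" for S
    using Suc.IH walk_det_not_decr[OF Suc.prems, of S y c]
    by (cases "decr k (\<lambda>i. if i \<in> S then x i else x i - 1)") auto
  then show ?case
    unfolding walk_det_Suc by (intro mult_nonneg_nonneg prod_nonneg sum_nonneg) (auto simp: assms(1))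
qed

text \<open>All terms of the recursion are nonnegative, so at each step it suffices to keep the
  single subset \<open>S\<close> prescribed by the family \<open>X\<close>.\<close>

lemma exp_walk_weight_le_walk_det:
  fixes w t
  defines "y \<equiv> \<lambda>c x. exp (t * site w c x)"
  assumes "walkers k C X"
  shows "exp (t * walk_weight w k C X) \<le> walk_det y k C (X C)"
  using assms(2)
proof (induction C)
  case 0
  then have "decr k (X 0)" by (simp add: walkers_def)
  with 0 show ?case
    by (simp add: walk_det_0 walkers_def walk_weight_def y_def exp_sum sum_distrib_left)
next
  case (Suc C)
  have X: "walkers k C X" and d: "decr k (X (Suc C))" using Suc.prems by (auto simp: walkers_def)
  define S where "S = {i. i < k \<and> X (Suc C) i = X C i}"
  let ?x = "\<lambda>S i. if i \<in> S then X (Suc C) i else X (Suc C) i - 1"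
  have "walk_det y k C (X C) = walk_det y k C (?x S)"
  proof (rule walk_det_cong)
    fix i assume "i < k"
    moreover from this have "X (Suc C) i = X C i \<or> X (Suc C) i = X C i + 1"
      using Suc.prems by (simp add: walkers_def)
    ultimately show "X C i = ?x S i" by (auto simp: S_def)
  qed
  also have "\<dots> \<le> (\<Sum>S\<in>Pow {..<k}. walk_det y k C (?x S))"
  proof (rule member_le_sum[of _ _ "\<lambda>S. walk_det y k C (?x S)"])
    fix T
    show "0 \<le> walk_det y k C (?x T)"
      using walk_det_nonneg[of y k "?x T" C] walk_det_not_decr[OF d, of T y C]
      by (cases "decr k (?x T)") (auto simp: y_def)
  qed (auto simp: S_def)
  finally have "exp (t * walk_weight w k C X) \<le> (\<Sum>S\<in>Pow {..<k}. walk_det y k C (?x S))"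
    using Suc.IH[OF X] by simp
  then have "(\<Prod>i<k. y (Suc C) (X (Suc C) i)) * exp (t * walk_weight w k C X) \<le>
      walk_det y k (Suc C) (X (Suc C))"
    unfolding walk_det_Suc by (intro mult_left_mono prod_nonneg) (auto simp: y_def)
  moreover have "(\<Prod>i<k. y (Suc C) (X (Suc C) i)) = exp (t * (\<Sum>i<k. site w (Suc C) (X (Suc C) i)))"
    by (simp add: y_def exp_sum sum_distrib_left)
  ultimately show ?case
    by (simp add: walk_weight_def mult_exp_exp algebra_simps)
qed

text \<open>Each of the \<open>C\<close> steps offers \<open>2 ^ k\<close> subsets, and every family
  composed of them contributes at most \<open>exp (t * B)\<close>. The crude count is harmless
  because it does not depend on \<open>t\<close>.\<close>

lemma walk_det_le_exp:
  fixes w t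
  defines "y \<equiv> \<lambda>c x. exp (t * site w c x)"
  assumes t: "0 \<le> t" and "decr k x"
    and "\<And>X. walkers k C X \<Longrightarrow> (\<And>i. i < k \<Longrightarrow> X C i = x i) \<Longrightarrow> walk_weight w k C X \<le> B"
  shows "walk_det y k C x \<le> (2 ^ k) ^ C * exp (t * B)"
  using assms(3,4)
proof (induction C arbitrary: x B)
  case 0
  show ?case
  proof (cases "\<forall>i<k. x i = - int i")
    case True
    then have "walk_weight w k 0 (\<lambda>_. x) \<le> B"
      using 0 by (intro 0(2)) (auto simp: walkers_def)
    then have "t * (\<Sum>i<k. site w 0 (x i)) \<le> t * B"
      using t by (intro mult_left_mono) (auto simp: walk_weight_def)
    with True show ?thesis
      using 0 by (simp add: walk_det_0 y_def sum_distrib_left flip: exp_sum)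
  qed (use 0 in \<open>auto simp: walk_det_0\<close>)
next
  case (Suc C)
  let ?s = "\<Sum>i<k. site w (Suc C) (x i)"
  let ?x = "\<lambda>S i. if i \<in> S then x i else x i - 1"
  have le: "walk_det y k C (?x S) \<le> (2 ^ k) ^ C * exp (t * (B - ?s))" for S
  proof (cases "decr k (?x S)")
    case True
    then show ?thesis
    proof (rule Suc.IH)
      fix X assume X: "walkers k C X" "\<And>i. i < k \<Longrightarrow> X C i = ?x S i"
      \<comment> \<open>Appending the final positions \<open>x\<close> gives a family up to time
        \<open>Suc C\<close>, so the bound for the shorter family is lower by the weight
        \<open>?s\<close> of the last sites.\<close>
      define X' where "X' c = (if c \<le> C then X c else x)" for c
      have "walkers k (Suc C) X'"
        unfolding walkers_def
      proof (intro conjI allI impI)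
        fix c i assume c: "c < Suc C" and i: "i < k"
        show "X' (Suc c) i = X' c i \<or> X' (Suc c) i = X' c i + 1"
        proof (cases "c < C")
          case True
          with X(1) i show ?thesis by (simp add: X'_def walkers_def)
        next
          case False
          then have "c = C" using c by simp
          then show ?thesis using X(2)[OF i] by (auto simp: X'_def split: if_splits)
        qed
      qed (use X(1) Suc.prems(1) in \<open>auto simp: X'_def walkers_def\<close>)
      then have "walk_weight w k (Suc C) X' \<le> B"
        by (rule Suc.prems(2)) (simp add: X'_def)
      moreover have "walk_weight w k (Suc C) X' = walk_weight w k C X + ?s"
        by (simp add: walk_weight_def X'_def)
      ultimately show "walk_weight w k C X \<le> B - ?s" by simp
    qed
  qed (simp add: walk_det_not_decr[OF Suc.prems(1)])
  have "(\<Sum>S\<in>Pow {..<k}. walk_det y k C (?x S)) \<le> of_nat (card (Pow {..<k})) * ((2 ^ k) ^ C * exp (t * (B - ?s)))"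
    by (rule sum_bounded_above) (rule le)
  also have "\<dots> = (2 ^ k) ^ Suc C * exp (t * (B - ?s))"
    by (simp add: card_Pow)
  finally have "walk_det y k (Suc C) x \<le> (\<Prod>i<k. y (Suc C) (x i)) * ((2 ^ k) ^ Suc C * exp (t * (B - ?s)))"
    unfolding walk_det_Suc by (intro mult_left_mono prod_nonneg) (auto simp: y_def)
  also have "(\<Prod>i<k. y (Suc C) (x i)) = exp (t * ?s)"
    by (simp add: y_def exp_sum sum_distrib_left)
  also have "exp (t * ?s) * ((2 ^ k) ^ Suc C * exp (t * (B - ?s))) = (2 ^ k) ^ Suc C * exp (t * B)"
    by (simp add: mult_exp_exp algebra_simps)
  finally show ?case .
qed

text \<open>For packed positions, lowering \<open>x\<close> by one raises the row index by one.
  Hence all six determinants are minors of the rows \<open>z\<close> or of their consecutive sums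
  \<open>u\<close>, and \<open>fdet_consecutive\<close> applies once the weights \<open>y\<close>
  are pulled out of the rows.\<close>

lemma walk_det_consecutive:
  fixes y :: "nat \<Rightarrow> int \<Rightarrow> real" and x :: int
  defines "p \<equiv> \<lambda>x i. x - int i"
  shows "walk_det y (Suc m) (Suc c) (p x) * walk_det y m c (p (x - 1)) =
    y (Suc c) x * walk_det y (Suc m) c (p x) * walk_det y m (Suc c) (p (x - 1)) +
    y (Suc c) (x - int m) * walk_det y (Suc m) c (p (x - 1)) * walk_det y m (Suc c) (p x)"
proof -
  define z where "z i = walk_sum y c (p x i)" for i
  define u where "u i j = z i j + z (Suc i) j" for i j
  have scale: "fdet k (\<lambda>i j. d i * v i j) = (\<Prod>i<k. d i) * fdet k v" for k d v
  proof -
    have "fdet k (\<lambda>i j. d i * (v i j + 0)) = (\<Prod>i<k. d i) * (\<Sum>S\<in>Pow {..<k}. fdet k (\<lambda>i j. if i \<in> S then v i j else 0))"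
      by (rule fdet_rows_add)
    also have "(\<Sum>S\<in>Pow {..<k}. fdet k (\<lambda>i j. if i \<in> S then v i j else 0)) =
        (\<Sum>S\<in>Pow {..<k}. if S = {..<k} then fdet k v else 0)"
    proof (rule sum.cong[OF refl])
      fix S assume S: "S \<in> Pow {..<k}"
      show "fdet k (\<lambda>i j. if i \<in> S then v i j else 0) = (if S = {..<k} then fdet k v else 0)"
      proof (cases "S = {..<k}")
        case False
        with S obtain i where "i < k" "i \<notin> S" by auto
        then show ?thesis using False by (simp add: fdet_zero_row[of i])
      qed (auto intro: fdet_cong)
    qed
    finally show ?thesis by simp
  qed
  have s: "p (x - 1) i = p x (Suc i)" "p x i - 1 = p x (Suc i)" for i by (simp_all add: p_def)
  have u: "walk_sum y (Suc c) (p x i) = (\<lambda>j. y (Suc c) (p x i) * u i j)" for i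
    by (rule ext) (simp add: u_def z_def s)
  have 1: "walk_det y k (Suc c) (p x) = (\<Prod>i<k. y (Suc c) (p x i)) * fdet k u" for k
    unfolding walk_det_def u scale ..
  have 2: "walk_det y k (Suc c) (p (x - 1)) = (\<Prod>i<k. y (Suc c) (p x (Suc i))) * fdet k (\<lambda>i. u (Suc i))" for k
    unfolding walk_det_def s u scale ..
  have 3: "walk_det y k c (p x) = fdet k z" "walk_det y k c (p (x - 1)) = fdet k (\<lambda>i. z (Suc i))" for k
    unfolding walk_det_def s z_def by simp_all
  \<comment> \<open>Splitting off the first or the last site of the common factor leaves the product
    belonging to \<open>p (x - 1)\<close> or to \<open>p x\<close>.\<close>
  have Y: "(\<Prod>i<Suc m. y (Suc c) (p x i)) = y (Suc c) x * (\<Prod>i<m. y (Suc c) (p x (Suc i)))"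
    "(\<Prod>i<Suc m. y (Suc c) (p x i)) = y (Suc c) (x - int m) * (\<Prod>i<m. y (Suc c) (p x i))"
    by (simp only: prod.lessThan_Suc_shift) (simp_all add: p_def)
  have "walk_det y (Suc m) (Suc c) (p x) * walk_det y m c (p (x - 1)) =
      (\<Prod>i<Suc m. y (Suc c) (p x i)) * (fdet (Suc m) u * fdet m (\<lambda>i. z (Suc i)))"
    unfolding 1 3 by simp
  also have "\<dots> = (\<Prod>i<Suc m. y (Suc c) (p x i)) * (fdet (Suc m) z * fdet m (\<lambda>i. u (Suc i))) +
      (\<Prod>i<Suc m. y (Suc c) (p x i)) * (fdet (Suc m) (\<lambda>i. z (Suc i)) * fdet m u)"
    unfolding u_def fdet_consecutive by (rule distrib_left)
  also have "\<dots> = y (Suc c) x * walk_det y (Suc m) c (p x) * walk_det y m (Suc c) (p (x - 1)) +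
      y (Suc c) (x - int m) * walk_det y (Suc m) c (p (x - 1)) * walk_det y m (Suc c) (p x)"
    unfolding 1 2 3 by (subst (1) Y(1), subst Y(2)) (simp add: mult_ac)
  finally show ?thesis .
qed

section \<open>Disjoint paths and walkers\<close>

definition feasible :: "nat \<Rightarrow> int \<times> int \<Rightarrow> int \<times> int \<Rightarrow> (nat \<Rightarrow> (int \<times> int) list) \<Rightarrow> bool" where
  "feasible k u v \<gamma>s \<longleftrightarrow>
     (\<forall>i<k. up_right_path (\<gamma>s i) \<and> set (\<gamma>s i) \<subseteq> rect u v) \<and>
     (\<forall>i<k. \<forall>j<k. i \<noteq> j \<longrightarrow> set (\<gamma>s i) \<inter> set (\<gamma>s j) = {})"

lemma up_right_path_nth:
  assumes "up_right_path \<gamma>" "i \<le> j" "j < length \<gamma>"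
  shows "fst (\<gamma> ! i) \<le> fst (\<gamma> ! j)" "snd (\<gamma> ! i) \<le> snd (\<gamma> ! j)"
    "fst (\<gamma> ! j) + snd (\<gamma> ! j) = fst (\<gamma> ! i) + snd (\<gamma> ! i) + int (j - i)"
proof -
  have "fst (\<gamma> ! i) \<le> fst (\<gamma> ! j) \<and> snd (\<gamma> ! i) \<le> snd (\<gamma> ! j) \<and>
      fst (\<gamma> ! j) + snd (\<gamma> ! j) = fst (\<gamma> ! i) + snd (\<gamma> ! i) + int (j - i)"
    using assms(2,3)
  proof (induction j rule: dec_induct)
    case (step j)
    then have "(fst (\<gamma> ! Suc j) = fst (\<gamma> ! j) + 1 \<and> snd (\<gamma> ! Suc j) = snd (\<gamma> ! j)) \<or>
        (fst (\<gamma> ! Suc j) = fst (\<gamma> ! j) \<and> snd (\<gamma> ! Suc j) = snd (\<gamma> ! j) + 1)"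
      using assms(1) unfolding up_right_path_def by simp
    with step show ?case by (auto simp: Suc_diff_le)
  qed simp
  then show "fst (\<gamma> ! i) \<le> fst (\<gamma> ! j)" "snd (\<gamma> ! i) \<le> snd (\<gamma> ! j)"
    "fst (\<gamma> ! j) + snd (\<gamma> ! j) = fst (\<gamma> ! i) + snd (\<gamma> ! i) + int (j - i)"
    by auto
qed

lemma distinct_up_right_path:
  assumes "up_right_path \<gamma>"
  shows "distinct \<gamma>"
  unfolding distinct_conv_nth
proof (intro allI impI)
  fix i j assume ij: "i < length \<gamma>" "j < length \<gamma>" "i \<noteq> j"
  then show "\<gamma> ! i \<noteq> \<gamma> ! j"
    using up_right_path_nth(3)[OF assms, of i j] up_right_path_nth(3)[OF assms, of j i]
    by (cases "i < j") auto
qed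

lemma rect_eq_Times: "rect u v = {fst u..fst v} \<times> {snd u..snd v}"
  by (auto simp: rect_def)

lemma finite_rect [simp]: "finite (rect u v)"
  by (simp add: rect_eq_Times)

text \<open>In \<open>LPP\<close> the entries of a family beyond \<open>k\<close> are arbitrary, so
  its values are indexed by an infinite set. The extensional families are finitely many, as
  \<open>Max\<close> demands, and do not depend on the weights, which later gives
  measurability.\<close>

definition path_families :: "nat \<Rightarrow> int \<times> int \<Rightarrow> int \<times> int \<Rightarrow> (nat \<Rightarrow> (int \<times> int) list) set" where
  "path_families k u v = {\<gamma>s \<in> {..<k} \<rightarrow>\<^sub>E {\<gamma>. set \<gamma> \<subseteq> rect u v \<and> distinct \<gamma>}. feasible k u v \<gamma>s}"

lemma finite_path_families: "finite (path_families k u v)"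
  unfolding path_families_def
  by (intro finite_Collect_conjI disjI1 finite_subset[OF Collect_restrict] finite_PiE finite_subset_distinct) auto

lemma feasible_Nil: "feasible k u v (\<lambda>_. [])"
  by (simp add: feasible_def up_right_path_def)

lemma LPP_eq_Max:
  "LPP k w u v = Max ((\<lambda>\<gamma>s. \<Sum>i<k. passage_time w (\<gamma>s i)) ` path_families k u v)"
proof -
  have "{(\<Sum>i<k. passage_time w (\<gamma>s i)) | \<gamma>s. feasible k u v \<gamma>s} =
      (\<lambda>\<gamma>s. \<Sum>i<k. passage_time w (\<gamma>s i)) ` path_families k u v" (is "?A = ?B")
  proof
    show "?A \<subseteq> ?B"
    proof
      fix s assume "s \<in> ?A"
      then obtain \<gamma>s where s: "s = (\<Sum>i<k. passage_time w (\<gamma>s i))" and f: "feasible k u v \<gamma>s"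
        by blast
      have "restrict \<gamma>s {..<k} \<in> path_families k u v"
        using f unfolding path_families_def by (auto simp: feasible_def distinct_up_right_path)
      moreover have "s = (\<Sum>i<k. passage_time w (restrict \<gamma>s {..<k} i))"
        by (simp add: s)
      ultimately show "s \<in> ?B" by blast
    qed
  qed (auto simp: path_families_def)
  then show ?thesis by (simp add: LPP_def feasible_def)
qed

lemma path_families_nonempty: "path_families k u v \<noteq> {}"
proof -
  have "restrict (\<lambda>_. []) {..<k} \<in> path_families k u v"
    using feasible_Nil[of k u v] by (auto simp: path_families_def feasible_def)
  then show ?thesis by blast
qed

lemma le_LPP:
  assumes "feasible k u v \<gamma>s"
  shows "(\<Sum>i<k. passage_time w (\<gamma>s i)) \<le> LPP k w u v"
  unfolding LPP_eq_Max
proof (rule Max_ge)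
  have "restrict \<gamma>s {..<k} \<in> path_families k u v"
    using assms unfolding path_families_def by (auto simp: feasible_def distinct_up_right_path)
  moreover have "(\<Sum>i<k. passage_time w (\<gamma>s i)) = (\<Sum>i<k. passage_time w (restrict \<gamma>s {..<k} i))"
    by simp
  ultimately show "(\<Sum>i<k. passage_time w (\<gamma>s i)) \<in> (\<lambda>\<gamma>s. \<Sum>i<k. passage_time w (\<gamma>s i)) ` path_families k u v"
    by blast
qed (simp add: finite_path_families)

lemma LPP_le:
  assumes "\<And>\<gamma>s. feasible k u v \<gamma>s \<Longrightarrow> (\<Sum>i<k. passage_time w (\<gamma>s i)) \<le> B"
  shows "LPP k w u v \<le> B"
  unfolding LPP_eq_Max using assms
  by (intro Max.boundedI) (auto simp: finite_path_families path_families_nonempty, auto simp: path_families_def)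

lemma sum_passage_time:
  assumes "feasible k u v \<gamma>s"
  shows "(\<Sum>i<k. passage_time w (\<gamma>s i)) = sum w (\<Union>i<k. set (\<gamma>s i))"
proof -
  have "sum w (\<Union>i<k. set (\<gamma>s i)) = (\<Sum>i<k. sum w (set (\<gamma>s i)))"
    using assms by (intro sum.UNION_disjoint) (auto simp: feasible_def)
  also have "\<dots> = (\<Sum>i<k. passage_time w (\<gamma>s i))"
    using assms unfolding passage_time_def
    by (intro sum.cong refl sum.distinct_set_conv_list) (auto simp: feasible_def distinct_up_right_path)
  finally show ?thesis by simp
qed

lemma LPP_0 [simp]: "LPP 0 w u v = 0"
  using le_LPP[OF feasible_Nil[of 0 u v], of w] LPP_le[where k = 0 and B = 0 and u = u and v = v and w = w]
  by simp

text \<open>The rows, or the columns if these are fewer, are at most \<open>k\<close> disjoint paths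
  covering the rectangle, and with nonnegative weights nothing beats a full cover.\<close>

lemma LPP_total:
  assumes w: "\<And>z. 0 \<le> w z" and k: "1 + min a b \<le> k"
  shows "LPP k w (0, 0) (int a, int b) = sum w (rect (0, 0) (int a, int b))"
proof (rule antisym)
  show "LPP k w (0, 0) (int a, int b) \<le> sum w (rect (0, 0) (int a, int b))"
  proof (rule LPP_le)
    fix \<gamma>s assume f: "feasible k (0, 0) (int a, int b) \<gamma>s"
    show "(\<Sum>i<k. passage_time w (\<gamma>s i)) \<le> sum w (rect (0, 0) (int a, int b))"
      unfolding sum_passage_time[OF f] using f w by (intro sum_mono2) (auto simp: feasible_def)
  qed
  define \<gamma>s where "\<gamma>s i = (if b \<le> a then if i \<le> b then map (\<lambda>x. (int x, int i)) [0..<Suc a] else []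
      else if i \<le> a then map (\<lambda>y. (int i, int y)) [0..<Suc b] else [])" for i
  have f: "feasible k (0, 0) (int a, int b) \<gamma>s"
    by (auto simp: feasible_def \<gamma>s_def up_right_path_def rect_def nth_append simp del: upt_Suc)
  have cover: "\<exists>i<k. z \<in> set (\<gamma>s i)" if z: "z \<in> rect (0, 0) (int a, int b)" for z
  proof (cases "b \<le> a")
    case True
    have "z = (int (nat (fst z)), int (nat (snd z)))" "nat (fst z) < Suc a"
      using z by (auto simp: rect_def)
    then have "z \<in> (\<lambda>x. (int x, int (nat (snd z)))) ` {0..<Suc a}" by (intro image_eqI) auto
    then show ?thesis using True z k
      by (intro exI[of _ "nat (snd z)"]) (auto simp: \<gamma>s_def rect_def simp del: upt_Suc)
  next
    case False
    have "z = (int (nat (fst z)), int (nat (snd z)))" "nat (snd z) < Suc b"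
      using z by (auto simp: rect_def)
    then have "z \<in> (\<lambda>y. (int (nat (fst z)), int y)) ` {0..<Suc b}" by (intro image_eqI) auto
    then show ?thesis using False z k
      by (intro exI[of _ "nat (fst z)"]) (auto simp: \<gamma>s_def rect_def simp del: upt_Suc)
  qed
  have "sum w (rect (0, 0) (int a, int b)) \<le> sum w (\<Union>i<k. set (\<gamma>s i))"
  proof (rule sum_mono2)
    show "rect (0, 0) (int a, int b) \<subseteq> (\<Union>i<k. set (\<gamma>s i))" using cover by blast
  qed (use w in auto)
  also have "\<dots> \<le> LPP k w (0, 0) (int a, int b)"
    using le_LPP[OF f, of w] by (simp add: sum_passage_time[OF f])
  finally show "sum w (rect (0, 0) (int a, int b)) \<le> LPP k w (0, 0) (int a, int b)" .
qed

text \<open>Beyond time \<open>a + b + 1 - k\<close>, the \<open>k\<close> paths packed at the corner \<open>(a, b)\<close> fill a triangle, one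
  row each.\<close>
definition corner :: "(int \<times> int \<Rightarrow> real) \<Rightarrow> nat \<Rightarrow> int \<Rightarrow> int \<Rightarrow> real" where
  "corner w k a b = (\<Sum>i<k. \<Sum>d<i. w (a - int d, b + int i + 1 - int k))"

lemma walkers_mono:
  assumes "walkers k C X" "i < k" "c \<le> c'" "c' \<le> C"
  shows "X c i \<le> X c' i" "X c' i \<le> X c i + int (c' - c)"
proof -
  have "X c i \<le> X c' i \<and> X c' i \<le> X c i + int (c' - c)"
    using assms(3,4)
  proof (induction c' rule: dec_induct)
    case (step c')
    then have "X (Suc c') i = X c' i \<or> X (Suc c') i = X c' i + 1"
      using assms(1,2) by (simp add: walkers_def)
    with step show ?case by (auto simp: Suc_diff_le)
  qed simp
  then show "X c i \<le> X c' i" "X c' i \<le> X c i + int (c' - c)" by auto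
qed

text \<open>Discard the part of each walker at negative abscissae, which has weight 0, and after
  time \<open>C\<close> let the walker go right along its row to abscissa \<open>a\<close>. The
  added pieces of rows form the triangle weighed by \<open>corner\<close>.\<close>

lemma walk_weight_le_LPP:
  assumes k: "k \<le> 1 + min a b" and C: "C = a + b + 1 - k"
    and X: "walkers k C X" and fin: "\<And>i. i < k \<Longrightarrow> X C i = int a - int i"
  shows "corner w k (int a) (int b) + walk_weight w k C X \<le> LPP k w (0, 0) (int a, int b)"
proof -
  \<comment> \<open>After time \<open>C\<close> walker \<open>i\<close> stays at ordinate
    \<open>int b + int i + 1 - int k\<close>, and it reaches abscissa \<open>a\<close> at time
    \<open>C + i\<close>, where its list in \<open>\<gamma>s\<close> ends.\<close>
  define X' where "X' c i = (if c \<le> C then X c i else int a - int i + int (c - C))" for c i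
  define pt where "pt c i = (X' c i, int c - X' c i)" for c i
  define lo where "lo i = (LEAST c. 0 \<le> X c i)" for i
  define \<gamma>s where "\<gamma>s i = map (\<lambda>c. pt c i) [lo i..<Suc (C + i)]" for i
  have intC: "int C = int a + int b + 1 - int k" using C k by auto
  have lo: "lo i \<le> C" "0 \<le> X (lo i) i" "\<And>c. c < lo i \<Longrightarrow> X c i < 0" if "i < k" for i
  proof -
    have "0 \<le> X C i" using fin[OF that] that k by auto
    then show "lo i \<le> C" "0 \<le> X (lo i) i" unfolding lo_def by (auto intro: Least_le LeastI)
    show "X c i < 0" if "c < lo i" for c
      using not_less_Least[of c "\<lambda>c. 0 \<le> X c i"] that unfolding lo_def by simp
  qed
  have step: "X' (Suc c) i = X' c i \<or> X' (Suc c) i = X' c i + 1" if "i < k" for c i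
    using that X fin[OF that] by (auto simp: X'_def walkers_def Suc_diff_le not_less_eq_eq le_Suc_eq)
  have inside: "pt c i \<in> rect (0, 0) (int a, int b)" if "i < k" "lo i \<le> c" "c \<le> C + i" for c i
  proof (cases "c \<le> C")
    case True
    have "X (lo i) i \<le> X c i" "X c i \<le> X C i" "X C i \<le> X c i + int (C - c)" "X c i \<le> X 0 i + int c"
      using walkers_mono[OF X that(1), of "lo i" c] walkers_mono[OF X that(1), of c C]
        walkers_mono[OF X that(1), of 0 c] True that by auto
    moreover have "X 0 i = - int i" using X that(1) by (simp add: walkers_def)
    moreover note lo(2)[OF that(1)] fin[OF that(1)]
    ultimately show ?thesis using True that(1) k intC
      by (auto simp: rect_def pt_def X'_def)
  next
    case False
    then show ?thesis using that k intC by (auto simp: rect_def pt_def X'_def)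
  qed
  have f: "feasible k (0, 0) (int a, int b) \<gamma>s"
    unfolding feasible_def
  proof (intro conjI allI impI)
    fix i assume i: "i < k"
    show "up_right_path (\<gamma>s i)"
      unfolding up_right_path_def
    proof (intro allI impI)
      fix j assume "Suc j < length (\<gamma>s i)"
      then have "\<gamma>s i ! j = pt (lo i + j) i" "\<gamma>s i ! Suc j = pt (Suc (lo i + j)) i"
        by (auto simp: \<gamma>s_def simp del: upt_Suc)
      then show "fst (\<gamma>s i ! Suc j) = fst (\<gamma>s i ! j) + 1 \<and> snd (\<gamma>s i ! Suc j) = snd (\<gamma>s i ! j) \<or>
          fst (\<gamma>s i ! Suc j) = fst (\<gamma>s i ! j) \<and> snd (\<gamma>s i ! Suc j) = snd (\<gamma>s i ! j) + 1"
        using step[OF i, of "lo i + j"] by (auto simp: pt_def)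
    qed
    show "set (\<gamma>s i) \<subseteq> rect (0, 0) (int a, int b)"
      using inside[OF i] by (auto simp: \<gamma>s_def simp del: upt_Suc)
  next
    have *: "pt c i \<noteq> pt c' j" if "i < j" "j < k" for i j c c'
    proof
      assume "pt c i = pt c' j"
      then have eq: "c = c'" "X' c i = X' c j" by (auto simp: pt_def)
      show False
      proof (cases "c \<le> C")
        case True
        then have "decr k (X c)" using X by (simp add: walkers_def)
        then show False using decr_le[of k "X c" i j] that eq True by (simp add: X'_def)
      qed (use eq that in \<open>auto simp: X'_def\<close>)
    qed
    fix i j assume "i < k" "j < k" "i \<noteq> j"
    show "set (\<gamma>s i) \<inter> set (\<gamma>s j) = {}"
    proof (rule equals0I)
      fix z assume "z \<in> set (\<gamma>s i) \<inter> set (\<gamma>s j)"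
      then obtain c c' where "z = pt c i" "z = pt c' j"
        unfolding \<gamma>s_def set_map by blast
      then show False
        using *[of i j c c'] *[of j i c' c] \<open>i < k\<close> \<open>j < k\<close> \<open>i \<noteq> j\<close> by (cases "i < j") auto
    qed
  qed
  have passage: "passage_time w (\<gamma>s i) =
      (\<Sum>c\<le>C. site w c (X c i)) + (\<Sum>d<i. w (int a - int d, int b + int i + 1 - int k))" if i: "i < k" for i
  proof -
    have "passage_time w (\<gamma>s i) = (\<Sum>c\<in>{lo i..<Suc (C + i)}. w (pt c i))"
      by (simp add: passage_time_def \<gamma>s_def comp_def interv_sum_list_conv_sum_set_nat del: upt_Suc)
    also have "{lo i..<Suc (C + i)} = {lo i..C} \<union> {Suc C..<Suc (C + i)}"
      using lo(1)[OF i] by auto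
    also have "(\<Sum>c\<in>\<dots>. w (pt c i)) = (\<Sum>c\<in>{lo i..C}. w (pt c i)) + (\<Sum>c\<in>{Suc C..<Suc (C + i)}. w (pt c i))"
      by (rule sum.union_disjoint) auto
    also have "(\<Sum>c\<in>{lo i..C}. w (pt c i)) = (\<Sum>c\<le>C. site w c (X c i))"
    proof (rule sum.mono_neutral_cong_left)
      show "\<forall>c\<in>{..C} - {lo i..C}. site w c (X c i) = 0"
      proof
        fix c assume "c \<in> {..C} - {lo i..C}"
        then have "X c i < 0" using lo(3)[OF i, of c] by (cases "lo i \<le> c") auto
        then show "site w c (X c i) = 0" by (simp add: site_def)
      qed
      fix c assume "c \<in> {lo i..C}"
      then show "w (pt c i) = site w c (X c i)"
        using inside[OF i, of c] by (auto simp: site_def pt_def X'_def rect_def)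
    qed auto
    also have "(\<Sum>c\<in>{Suc C..<Suc (C + i)}. w (pt c i)) =
        (\<Sum>d<i. w (int a - int d, int b + int i + 1 - int k))"
    proof (rule sum.reindex_bij_witness[of _ "\<lambda>d. C + i - d" "\<lambda>c. C + i - c"])
      fix c assume c: "c \<in> {Suc C..<Suc (C + i)}"
      then have "pt c i = (int a - int (C + i - c), int b + int i + 1 - int k)"
        using intC by (simp add: pt_def X'_def of_nat_diff)
      then show "w (int a - int (C + i - c), int b + int i + 1 - int k) = w (pt c i)" by simp
    qed auto
    finally show ?thesis .
  qed
  have "corner w k (int a) (int b) + walk_weight w k C X = (\<Sum>i<k. passage_time w (\<gamma>s i))"
    unfolding walk_weight_def corner_def
    by (subst sum.swap) (simp add: passage sum.distrib)
  also have "\<dots> \<le> LPP k w (0, 0) (int a, int b)" by (rule le_LPP[OF f])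
  finally show ?thesis .
qed

section \<open>Antichains in the plane and the height function\<close>

definition strict_se :: "int \<times> int \<Rightarrow> int \<times> int \<Rightarrow> bool" where
  "strict_se p q \<longleftrightarrow> fst p < fst q \<and> snd q < snd p"

text \<open>These are the antichains of the coordinatewise order: two distinct points are
  incomparable exactly when one is strictly south-east of the other, and then no up-right path
  contains both.\<close>

definition antichain :: "(int \<times> int) set \<Rightarrow> bool" where
  "antichain A \<longleftrightarrow> (\<forall>p\<in>A. \<forall>q\<in>A. p = q \<or> strict_se p q \<or> strict_se q p)"

definition height :: "(int \<times> int) set \<Rightarrow> int \<times> int \<Rightarrow> nat" where
  "height U z = Max (card ` {A. A \<subseteq> U \<and> antichain A \<and> (\<forall>p\<in>A. fst p \<le> fst z \<and> snd z \<le> snd p)})"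

lemma antichain_subset: "antichain A \<Longrightarrow> B \<subseteq> A \<Longrightarrow> antichain B"
  unfolding antichain_def by blast

lemma height_ge:
  assumes "finite U" "A \<subseteq> U" "antichain A" "\<And>p. p \<in> A \<Longrightarrow> fst p \<le> fst z \<and> snd z \<le> snd p"
  shows "card A \<le> height U z"
  unfolding height_def
  by (rule Max_ge) (use assms in \<open>auto intro: finite_subset[of _ "Pow U"]\<close>)

lemma height_attained:
  assumes "finite U"
  obtains A where "A \<subseteq> U" "antichain A" "\<forall>p\<in>A. fst p \<le> fst z \<and> snd z \<le> snd p"
    "card A = height U z"
proof -
  let ?S = "{A. A \<subseteq> U \<and> antichain A \<and> (\<forall>p\<in>A. fst p \<le> fst z \<and> snd z \<le> snd p)}"
  have "{} \<in> ?S" by (simp add: antichain_def)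
  then have "Max (card ` ?S) \<in> card ` ?S"
    using assms by (intro Max_in) (auto intro: finite_subset[of _ "Pow U"])
  then obtain A where "A \<in> ?S" "card A = height U z" unfolding height_def by auto
  then show ?thesis using that by blast
qed

lemma height_le:
  assumes "finite U" "\<And>A. A \<subseteq> U \<Longrightarrow> antichain A \<Longrightarrow> card A \<le> k"
  shows "height U z \<le> k"
proof -
  obtain A where A: "A \<subseteq> U" "antichain A" "\<forall>p\<in>A. fst p \<le> fst z \<and> snd z \<le> snd p"
    "card A = height U z" by (rule height_attained[OF assms(1), of z])
  show ?thesis using assms(2)[OF A(1,2)] A(4) by simp
qed

lemma height_eq_0:
  assumes "finite U" "\<And>p. p \<in> U \<Longrightarrow> fst z < fst p"
  shows "height U z = 0"
proof -
  obtain A where A: "A \<subseteq> U" "antichain A" "\<forall>p\<in>A. fst p \<le> fst z \<and> snd z \<le> snd p"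
    "card A = height U z" by (rule height_attained[OF assms(1), of z])
  have "A = {}"
  proof (rule equals0I)
    fix p assume "p \<in> A"
    then have "p \<in> U" "fst p \<le> fst z" using A(1,3) by auto
    then show False using assms(2)[of p] by simp
  qed
  then show ?thesis using A(4) by simp
qed

lemma height_mono:
  assumes "finite U" "fst z \<le> fst z'" "snd z' \<le> snd z"
  shows "height U z \<le> height U z'"
proof -
  obtain A where "A \<subseteq> U" "antichain A" "\<forall>p\<in>A. fst p \<le> fst z \<and> snd z \<le> snd p"
    "card A = height U z" by (rule height_attained[OF assms(1), of z])
  moreover from this have "card A \<le> height U z'"
    using assms by (intro height_ge) (auto dest!: bspec intro: order_trans)
  ultimately show ?thesis by simp
qed

text \<open>Remove the rightmost point from an optimal antichain at \<open>z\<close>: the others lie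
  strictly north-west of it, hence are counted at the north-west neighbour of
  \<open>z\<close>.\<close>

lemma height_diag:
  assumes "finite U"
  shows "height U z \<le> Suc (height U (fst z - 1, snd z + 1))"
proof -
  obtain A where A: "A \<subseteq> U" "antichain A" "\<forall>p\<in>A. fst p \<le> fst z \<and> snd z \<le> snd p"
    "card A = height U z" by (rule height_attained[OF assms(1), of z])
  have fin: "finite A" using A(1) assms finite_subset by blast
  show ?thesis
  proof (cases "A = {}")
    case True
    then show ?thesis using A(4) by simp
  next
    case False
    have "Max (fst ` A) \<in> fst ` A" using fin False by simp
    then obtain m where m: "m \<in> A" "fst m = Max (fst ` A)" by auto
    then have m: "m \<in> A" "\<And>p. p \<in> A \<Longrightarrow> fst p \<le> fst m" using fin by auto
    have "card (A - {m}) \<le> height U (fst z - 1, snd z + 1)"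
    proof (rule height_ge[OF assms])
      fix p assume p: "p \<in> A - {m}"
      then have "strict_se p m"
        using A(2) m(1) m(2)[of p] unfolding antichain_def strict_se_def
        by (metis DiffD1 DiffD2 insertI1 leD)
      then show "fst p \<le> fst (fst z - 1, snd z + 1) \<and> snd (fst z - 1, snd z + 1) \<le> snd p"
        using A(3)[rule_format, OF m(1)] by (auto simp: strict_se_def)
    qed (use A antichain_subset in auto)
    then show ?thesis using A(4) m(1) fin by simp
  qed
qed

text \<open>A point of \<open>U\<close> extends every antichain counted at its north-west neighbour.
  So the height jumps at each point of \<open>U\<close>, which is why the level lines lose none of
  them.\<close>

lemma height_diag_mem:
  assumes "finite U" "z \<in> U"
  shows "height U z = Suc (height U (fst z - 1, snd z + 1))"
proof (rule antisym[OF height_diag[OF assms(1)]])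
  obtain A where A: "A \<subseteq> U" "antichain A"
    "\<forall>p\<in>A. fst p \<le> fst (fst z - 1, snd z + 1) \<and> snd (fst z - 1, snd z + 1) \<le> snd p"
    "card A = height U (fst z - 1, snd z + 1)" by (rule height_attained[OF assms(1)])
  have se: "strict_se p z" if "p \<in> A" for p
    using A(3)[rule_format, OF that] by (auto simp: strict_se_def)
  then have "z \<notin> A" using se[of z] by (auto simp: strict_se_def)
  moreover have "finite A" using A(1) assms(1) finite_subset by blast
  moreover have "card (insert z A) \<le> height U z"
  proof (rule height_ge[OF assms(1)])
    show "antichain (insert z A)" using A(2) se by (simp add: antichain_def)
    fix p assume "p \<in> insert z A"
    then show "fst p \<le> fst z \<and> snd z \<le> snd p"
      using se[of p] by (cases "p = z") (auto simp: strict_se_def)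
  qed (use A(1) assms(2) in simp)
  ultimately show "Suc (height U (fst z - 1, snd z + 1)) \<le> height U z" using A(4) by simp
qed

lemma antichain_card_le_fst:
  assumes "antichain A" "\<And>p. p \<in> A \<Longrightarrow> l \<le> fst p \<and> fst p < u"
  shows "card A \<le> nat (u - l)"
proof -
  have "inj_on fst A"
    using assms(1) by (force simp: inj_on_def antichain_def strict_se_def)
  then have "card A = card (fst ` A)" by (simp add: card_image)
  also have "\<dots> \<le> card {l..<u}" by (rule card_mono) (use assms(2) in auto)
  finally show ?thesis by simp
qed

lemma antichain_card_le_snd:
  assumes "antichain A" "\<And>p. p \<in> A \<Longrightarrow> l \<le> snd p \<and> snd p < u"
  shows "card A \<le> nat (u - l)"
proof -
  have "inj_on snd A"
    using assms(1) by (force simp: inj_on_def antichain_def strict_se_def)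
  then have "card A = card (snd ` A)" by (simp add: card_image)
  also have "\<dots> \<le> card {l..<u}" by (rule card_mono) (use assms(2) in auto)
  finally show ?thesis by simp
qed

text \<open>Count the points up to the abscissa of \<open>p\<close> by their abscissae; the others
  lie below \<open>p\<close> and are counted by their ordinates.\<close>

lemma antichain_split:
  assumes A: "antichain A" "finite A" and p: "p \<in> A"
    and l: "\<And>q. q \<in> A \<Longrightarrow> fst q \<le> fst p \<Longrightarrow> x \<le> fst q"
    and u: "\<And>q. q \<in> A \<Longrightarrow> fst p < fst q \<Longrightarrow> y \<le> snd q"
  shows "card A \<le> nat (fst p + 1 - x) + nat (snd p - y)"
proof -
  have "card {q \<in> A. fst q \<le> fst p} \<le> nat (fst p + 1 - x)"
    using A l by (intro antichain_card_le_fst) (auto intro: antichain_subset)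
  moreover have "card {q \<in> A. fst p < fst q} \<le> nat (snd p - y)"
  proof (rule antichain_card_le_snd)
    fix q assume q: "q \<in> {q \<in> A. fst p < fst q}"
    then have "strict_se p q" using A(1) p by (force simp: antichain_def strict_se_def)
    then show "y \<le> snd q \<and> snd q < snd p" using q u by (auto simp: strict_se_def)
  qed (use A in \<open>auto intro: antichain_subset\<close>)
  moreover have eq: "{q \<in> A. fst q \<le> fst p} \<union> {q \<in> A. fst p < fst q} = A" by auto
  have "card A \<le> card {q \<in> A. fst q \<le> fst p} + card {q \<in> A. fst p < fst q}"
    using card_Un_le[of "{q \<in> A. fst q \<le> fst p}" "{q \<in> A. fst p < fst q}"] unfolding eq .
  ultimately show ?thesis by linarith
qed

lemma antichain_path:
  assumes "up_right_path \<gamma>" "p \<in> set \<gamma>" "q \<in> set \<gamma>"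
  shows "\<not> strict_se p q"
proof -
  obtain i j where "p = \<gamma> ! i" "q = \<gamma> ! j" "i < length \<gamma>" "j < length \<gamma>"
    using assms by (auto simp: in_set_conv_nth)
  then show ?thesis
    using up_right_path_nth[OF assms(1), of i j] up_right_path_nth[OF assms(1), of j i]
    by (cases "i \<le> j") (auto simp: strict_se_def)
qed

text \<open>The easy half of Dilworth's theorem: distinct points of an antichain lie on distinct
  paths.\<close>

lemma antichain_feasible_card:
  assumes f: "feasible k u v \<gamma>s" and A: "antichain A" "A \<subseteq> (\<Union>i<k. set (\<gamma>s i))"
  shows "card A \<le> k"
proof -
  have "\<forall>p\<in>A. \<exists>i<k. p \<in> set (\<gamma>s i)" using A(2) by blast
  then obtain g where g: "\<And>p. p \<in> A \<Longrightarrow> g p < k \<and> p \<in> set (\<gamma>s (g p))" by metis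
  have "inj_on g A"
  proof (rule inj_onI)
    fix p q assume pq: "p \<in> A" "q \<in> A" "g p = g q"
    then have "\<not> strict_se p q" "\<not> strict_se q p"
      using antichain_path[of "\<gamma>s (g p)"] g f unfolding feasible_def by metis+
    then show "p = q" using A(1) pq unfolding antichain_def by blast
  qed
  then have "card A \<le> card {..<k}" using g by (intro card_inj_on_le) auto
  then show ?thesis by simp
qed

section \<open>Level lines of a function on the lattice\<close>

locale level_lines =
  fixes h :: "int \<times> int \<Rightarrow> nat" and k :: nat
  assumes mono: "\<And>z z'. fst z \<le> fst z' \<Longrightarrow> snd z' \<le> snd z \<Longrightarrow> h z \<le> h z'"
    and diag: "\<And>z. h z \<le> Suc (h (fst z - 1, snd z + 1))"
    and zero: "\<And>z. fst z \<le> - int k \<Longrightarrow> h z = 0"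
    and start: "\<And>s. s < k \<Longrightarrow> h (- int s, int s) = k - s"
begin

text \<open>By \<open>mono\<close>, \<open>h\<close> is nondecreasing in \<open>x\<close> along the
  antidiagonal at time \<open>c\<close>. Walkers are numbered from the right, so walker
  \<open>i\<close> follows the step up to level \<open>k - i\<close>.\<close>

definition jump :: "nat \<Rightarrow> nat \<Rightarrow> int \<Rightarrow> bool" where
  "jump c i x \<longleftrightarrow> h (x, int c - x) = k - i \<and> h (x - 1, int c - x + 1) = k - Suc i"

lemma jump_unique:
  assumes "jump c i x" "jump c i x'" "i < k"
  shows "x = x'"
proof -
  have "\<not> x < x'" if "jump c i x" "jump c i x'" for x x'
  proof
    assume "x < x'"
    then have "h (x, int c - x) \<le> h (x' - 1, int c - x' + 1)" by (intro mono) auto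
    then show False using that \<open>i < k\<close> by (simp add: jump_def)
  qed
  then show ?thesis using assms by (metis linorder_neqE)
qed

text \<open>A discrete intermediate value argument: along the antidiagonal \<open>h\<close> starts
  at 0, reaches \<open>k\<close>, and climbs by at most one at a time according to
  \<open>diag\<close>.\<close>

lemma jump_ex:
  assumes "i < k"
  shows "\<exists>x. jump c i x"
proof -
  \<comment> \<open>The abscissae from \<open>- int k\<close> on are indexed by \<open>n\<close>, so
    that \<open>LEAST\<close> over the naturals finds the first one of height at least
    \<open>k - i\<close>; \<open>n = 0\<close> is excluded by \<open>zero\<close>.\<close>
  define P where "P n \<longleftrightarrow> k - i \<le> h (int n - int k, int c + int k - int n)" for n
  have "h (0, 0) = k" using start[of 0] assms by simp
  then have "k \<le> h (int c, 0)" using mono[of "(0, 0)" "(int c, 0)"] by simp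
  then have "P (c + k)" by (simp add: P_def)
  define n where "n = (LEAST n. P n)"
  have Pn: "P n" unfolding n_def by (rule LeastI[of P, OF \<open>P (c + k)\<close>])
  have "n \<noteq> 0" using Pn zero assms by (intro notI) (auto simp: P_def)
  then obtain m where m: "n = Suc m" by (cases n) auto
  have "\<not> P m" using not_less_Least[of m P] m unfolding n_def by simp
  moreover have "h (int n - int k, int c + int k - int n) \<le> Suc (h (int m - int k, int c + int k - int m))"
    using diag[of "(int n - int k, int c + int k - int n)"] by (simp add: m algebra_simps)
  ultimately have "h (int n - int k, int c + int k - int n) = k - i"
    "h (int m - int k, int c + int k - int m) = k - Suc i"
    using Pn by (auto simp: P_def)
  then have "jump c i (int n - int k)" by (simp add: jump_def m algebra_simps)
  then show ?thesis ..
qed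

definition pos :: "nat \<Rightarrow> nat \<Rightarrow> int" where
  "pos c i = (SOME x. jump c i x)"

lemma pos: "i < k \<Longrightarrow> jump c i (pos c i)"
  unfolding pos_def by (rule someI_ex) (rule jump_ex)

lemma pos_eq: "i < k \<Longrightarrow> jump c i x \<Longrightarrow> pos c i = x"
  using pos jump_unique by blast

text \<open>If one of the inequalities failed, an end of one jump would lie weakly north-west of an
  end of another jump with smaller height, against \<open>mono\<close>.\<close>

lemma walkers_pos: "walkers k C pos"
  unfolding walkers_def decr_def
proof (intro conjI allI impI)
  fix i assume i: "i < k"
  have "h (- int i - 1, int i + 1) = k - Suc i"
  proof (cases "Suc i < k")
    case True
    moreover have "(- int i - 1, int i + 1) = (- int (Suc i), int (Suc i))" by simp
    ultimately show ?thesis by (simp only: start)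
  next
    case False
    then show ?thesis using i zero[of "(- int i - 1, int i + 1)"] by simp
  qed
  then show "pos 0 i = - int i" using i start[OF i] by (intro pos_eq) (auto simp: jump_def)
next
  fix c i assume i: "Suc i < k"
  show "pos c (Suc i) < pos c i"
  proof (rule ccontr)
    assume "\<not> ?thesis"
    then have "h (pos c i - 1, int c - pos c i + 1) \<le> h (pos c (Suc i) - 1, int c - pos c (Suc i) + 1)"
      by (intro mono) auto
    then show False using pos[of i c] pos[of "Suc i" c] i by (simp add: jump_def)
  qed
next
  fix c i assume i: "i < k"
  let ?x = "pos c i" and ?x' = "pos (Suc c) i"
  have "?x' \<le> ?x + 1"
  proof (rule ccontr)
    assume "\<not> ?thesis"
    then have "h (?x, int c - ?x) \<le> h (?x' - 1, int (Suc c) - ?x' + 1)" by (intro mono) auto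
    then show False using pos[OF i, of c] pos[OF i, of "Suc c"] i by (simp add: jump_def)
  qed
  moreover have "?x \<le> ?x'"
  proof (rule ccontr)
    assume "\<not> ?thesis"
    then have "h (?x', int (Suc c) - ?x') \<le> h (?x - 1, int c - ?x + 1)" by (intro mono) auto
    then show False using pos[OF i, of c] pos[OF i, of "Suc c"] i by (simp add: jump_def)
  qed
  ultimately show "?x' = ?x \<or> ?x' = ?x + 1" by linarith
qed

end

text \<open>The visited vertices are enlarged by the packed start points \<open>St\<close> and end
  points \<open>En\<close>. The enlarged set \<open>V\<close> still has no antichain of more than
  \<open>k\<close> points, and its height function sends the level lines through \<open>St\<close>
  at time 0, through \<open>En\<close> at time \<open>C\<close> and through every visited vertex in
  between. Vertices after time \<open>C\<close> lie in the triangle weighed by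
  \<open>corner\<close>, whatever the paths do there.\<close>

lemma ex_walkers_of_feasible:
  assumes w: "\<And>z. 0 \<le> w z" and k: "k \<le> 1 + min a b" and C: "C = a + b + 1 - k"
    and f: "feasible k (0, 0) (int a, int b) \<gamma>s"
  shows "\<exists>X. walkers k C X \<and> (\<forall>i<k. X C i = int a - int i) \<and>
    (\<Sum>i<k. passage_time w (\<gamma>s i)) \<le> corner w k (int a) (int b) + walk_weight w k C X"
proof -
  define U where "U = (\<Union>i<k. set (\<gamma>s i))"
  define St where "St = (\<lambda>s. (- int s, int s)) ` {..<k}"
  define En where "En = (\<lambda>d. (int a - int d, int b + 1 - int k + int d)) ` {..<k}"
  define V where "V = U \<union> St \<union> En"
  have intC: "int C = int a + int b + 1 - int k" using C k by auto
  have U: "0 \<le> fst p \<and> fst p \<le> int a \<and> 0 \<le> snd p \<and> snd p \<le> int b \<and> 0 < k" if "p \<in> U" for p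
  proof -
    obtain i where "i < k" "p \<in> set (\<gamma>s i)" using \<open>p \<in> U\<close> by (auto simp: U_def)
    then have "p \<in> rect (0, 0) (int a, int b)" "0 < k" using f unfolding feasible_def by auto
    then show ?thesis by (simp add: rect_def)
  qed
  have V: "- int k < fst p \<and> fst p \<le> int a \<and> 0 \<le> snd p \<and> snd p \<le> int b \<and> 0 \<le> fst p + snd p" if pV: "p \<in> V" for p
  proof -
    have ab: "int k \<le> 1 + int a" "int k \<le> 1 + int b" using k by simp_all
    from pV have "p \<in> U \<or> p \<in> St \<or> p \<in> En" by (simp add: V_def)
    then show ?thesis
    proof (elim disjE)
      assume "p \<in> U"
      then show ?thesis using U[of p] by linarith
    next
      assume "p \<in> St"
      then obtain s where "s < k" "p = (- int s, int s)" by (auto simp: St_def)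
      then show ?thesis using ab by simp
    next
      assume "p \<in> En"
      then obtain d where "d < k" "p = (int a - int d, int b + 1 - int k + int d)"
        by (auto simp: En_def)
      then show ?thesis using ab by simp
    qed
  qed
  have finV: "finite V" by (simp add: V_def U_def St_def En_def)
  have card: "card A \<le> k" if A: "A \<subseteq> V" "antichain A" for A
  proof -
    have finA: "finite A" by (rule finite_subset[OF A(1) finV])
    consider "A \<subseteq> U" | p where "p \<in> A" "p \<in> St" | p where "p \<in> A" "p \<in> En"
      using subsetD[OF A(1)] unfolding V_def Un_iff subset_iff by metis
    then show ?thesis
    proof cases
      \<comment> \<open>Through a start point: at most \<open>k - s\<close> points have abscissa up
        to \<open>- int s\<close>, since all abscissae exceed \<open>- int k\<close>, and at most
        \<open>s\<close> points lie below.\<close>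
      case (2 p)
      then obtain s where 1: "s < k" "(- int s, int s) \<in> A" by (auto simp: St_def)
      have "card A \<le> nat (fst (- int s, int s) + 1 - (- int k + 1)) + nat (snd (- int s, int s) - 0)"
      proof (rule antichain_split[OF A(2) finA 1(2)])
        fix q assume "q \<in> A"
        then have "q \<in> V" using A(1) by blast
        then show "- int k + 1 \<le> fst q" "0 \<le> snd q" using V[of q] by simp_all
      qed
      with 1 show ?thesis by simp
    next
      \<comment> \<open>Through an end point: at most \<open>d\<close> points lie to the right,
        within abscissa \<open>a\<close>, and at most \<open>k - d\<close> weakly to the left, hence
        weakly above, within ordinate \<open>b\<close>.\<close>
      case (3 p)
      then obtain d where 2: "d < k" "(int a - int d, int b + 1 - int k + int d) \<in> A"
        by (auto simp: En_def)
      let ?e = "(int a - int d, int b + 1 - int k + int d)"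
      have se: "strict_se p ?e \<or> strict_se ?e p" if "p \<in> A" "p \<noteq> ?e" for p
        using A(2) 2(2) that unfolding antichain_def by blast
      let ?L = "{p \<in> A. fst p \<le> int a - int d}" and ?R = "{p \<in> A. int a - int d < fst p}"
      have "card ?R \<le> nat ((int a + 1) - (int a - int d + 1))"
      proof (rule antichain_card_le_fst)
        show "antichain ?R" using A(2) by (rule antichain_subset) auto
        fix p assume p: "p \<in> ?R"
        then have "p \<in> V" using A(1) by blast
        then show "int a - int d + 1 \<le> fst p \<and> fst p < int a + 1" using p V[of p] by simp
      qed
      moreover have "card ?L \<le> nat ((int b + 1) - (int b + 1 - int k + int d))"
      proof (rule antichain_card_le_snd)
        fix p assume "p \<in> ?L"
        then show "int b + 1 - int k + int d \<le> snd p \<and> snd p < int b + 1"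
          using se[of p] V[of p] A(1) by (cases "p = ?e") (auto simp: strict_se_def)
      qed (use A in \<open>auto intro: antichain_subset\<close>)
      moreover have eq: "?L \<union> ?R = A" by auto
      have "card A \<le> card ?L + card ?R" using card_Un_le[of ?L ?R] unfolding eq .
      ultimately show ?thesis using 2(1) by simp
    next
      case 1
      then show ?thesis using antichain_feasible_card[OF f A(2)] by (simp add: U_def)
    qed
  qed
  define h where "h = height V"
  have hk: "h z \<le> k" for z
    unfolding h_def by (rule height_le[OF finV card])
  have hmono: "h z \<le> h z'" if "fst z \<le> fst z'" "snd z' \<le> snd z" for z z'
    unfolding h_def by (rule height_mono[OF finV that])
  have hdiag: "h z \<le> Suc (h (fst z - 1, snd z + 1))" for z
    unfolding h_def by (rule height_diag[OF finV])
  have hmem: "h z = Suc (h (fst z - 1, snd z + 1))" if "z \<in> V" for z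
    unfolding h_def by (rule height_diag_mem[OF finV that])
  have hzero: "h z = 0" if "fst z \<le> - int k" for z
    unfolding h_def
  proof (rule height_eq_0[OF finV])
    fix p assume "p \<in> V"
    then show "fst z < fst p" using V[of p] that by linarith
  qed
  \<comment> \<open>a full diagonal of \<open>k\<close> points of \<open>V\<close> forces the heights along it\<close>
  have line: "h (x - int i, y + int i) = k - i" if i: "i < k" and D: "\<And>j. j < k \<Longrightarrow> (x - int j, y + int j) \<in> V" for x y i
  proof (rule antisym)
    have down: "h (x, y) = h (x - int j, y + int j) + j" if "j < k" for j
      using that
    proof (induction j)
      case (Suc j)
      then have "h (x - int j, y + int j) = Suc (h (x - int (Suc j), y + int (Suc j)))"
        using hmem[OF D[of j]] by (simp add: algebra_simps)
      with Suc show ?case by simp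
    qed simp
    show "h (x - int i, y + int i) \<le> k - i" using down[OF i] hk[of "(x, y)"] by simp
    have "1 \<le> h (x - int (k - 1), y + int (k - 1))"
      using hmem[OF D[of "k - 1"]] i by simp
    then have "k \<le> h (x, y)" using down[of "k - 1"] i by simp
    then show "k - i \<le> h (x - int i, y + int i)" using down[OF i] by simp
  qed
  interpret level_lines h k
  proof
    show "h (- int s, int s) = k - s" if "s < k" for s
      using line[of s 0 0] that by (auto simp: V_def St_def)
  qed (use hmono hdiag hzero in auto)
  \<comment> \<open>By \<open>hmem\<close> each point \<open>z\<close> of \<open>V\<close> is a
    jump, so it is the position of walker \<open>k - h z\<close> at its own time.\<close>
  have jumpV: "jump (nat (fst z + snd z)) (k - h z) (fst z)" "k - h z < k" if "z \<in> V" for z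
    using hmem[OF that] hk[of z] V[OF that] by (auto simp: jump_def algebra_simps)
  have posV: "pos (nat (fst z + snd z)) (k - h z) = fst z" if "z \<in> V" for z
    using jumpV[OF that] pos_eq by blast
  have fin: "pos C i = int a - int i" if i: "i < k" for i
  proof -
    let ?e = "(int a - int i, int b + 1 - int k + int i)"
    have e: "?e \<in> V" using i by (auto simp: V_def En_def)
    have "h ?e = k - i" using line[of i "int a" "int b + 1 - int k"] i by (auto simp: V_def En_def)
    moreover have "nat (fst ?e + snd ?e) = C" using intC by simp
    ultimately show ?thesis using posV[OF e] i by simp
  qed
  define U1 where "U1 = {z \<in> U. fst z + snd z \<le> int C}"
  define U2 where "U2 = {z \<in> U. int C < fst z + snd z}"
  have finU: "finite U" by (simp add: U_def)
  have site0: "0 \<le> site w c x" for c x using w by (simp add: site_def)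
  have "sum w U1 \<le> walk_weight w k C pos"
  proof -
    \<comment> \<open>Time and walker of a vertex: distinct vertices occupy distinct slots, and the
      slots left over have nonnegative weight.\<close>
    let ?g = "\<lambda>z. (nat (fst z + snd z), k - h z)"
    have inj: "inj_on ?g U1"
    proof (rule inj_onI)
      fix z z' assume z: "z \<in> U1" "z' \<in> U1" "?g z = ?g z'"
      then have "z \<in> V" "z' \<in> V" by (auto simp: U1_def V_def)
      then have "fst z = fst z'" "fst z + snd z = fst z' + snd z'"
        using posV[of z] posV[of z'] z V[of z] V[of z'] by auto
      then show "z = z'" by (simp add: prod_eq_iff)
    qed
    have "sum w U1 = (\<Sum>z\<in>U1. (\<lambda>(c, i). site w c (pos c i)) (?g z))"
    proof (rule sum.cong[OF refl])
      fix z assume "z \<in> U1"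
      then have "z \<in> V" "0 \<le> fst z" "0 \<le> snd z" using U by (auto simp: U1_def V_def)
      then show "w z = (\<lambda>(c, i). site w c (pos c i)) (?g z)" by (simp add: posV site_def)
    qed
    also have "\<dots> = (\<Sum>(c, i)\<in>?g ` U1. site w c (pos c i))"
      by (rule sum.reindex[OF inj, symmetric, unfolded comp_def])
    also have "\<dots> \<le> (\<Sum>(c, i)\<in>{..C} \<times> {..<k}. site w c (pos c i))"
      using jumpV(2) by (intro sum_mono2) (auto simp: site0 U1_def V_def)
    also have "\<dots> = walk_weight w k C pos" by (simp add: walk_weight_def sum.cartesian_product)
    finally show ?thesis .
  qed
  moreover have "sum w U2 \<le> corner w k (int a) (int b)"
  proof -
    let ?S = "SIGMA i:{..<k}. {..<i}" and ?g = "\<lambda>(i, d). (int a - int d, int b + int i + 1 - int k)"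
    have "inj_on ?g ?S" by (auto simp: inj_on_def)
    then have "sum w (?g ` ?S) = (\<Sum>(i, d)\<in>?S. w (int a - int d, int b + int i + 1 - int k))"
      by (simp add: sum.reindex case_prod_unfold)
    also have "\<dots> = corner w k (int a) (int b)" by (simp add: corner_def sum.Sigma)
    finally have *: "sum w (?g ` ?S) = corner w k (int a) (int b)" .
    have "U2 \<subseteq> ?g ` ?S"
    proof
      \<comment> \<open>Row index and column offset are the distances from the bottom of the
        triangle and from abscissa \<open>a\<close>; being past time \<open>C\<close> makes the
        offset smaller than the row index.\<close>
      fix z assume z: "z \<in> U2"
      then have "z = ?g (nat (int k - 1 - (int b - snd z)), nat (int a - fst z))"
        "(nat (int k - 1 - (int b - snd z)), nat (int a - fst z)) \<in> ?S"
        using U[of z] intC by (auto simp: U2_def prod_eq_iff)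
      then show "z \<in> ?g ` ?S" by (rule image_eqI)
    qed
    then have "sum w U2 \<le> sum w (?g ` ?S)" using w by (intro sum_mono2) auto
    with * show ?thesis by simp
  qed
  moreover have "sum w U = sum w U1 + sum w U2"
    using finU by (subst sum.union_disjoint[symmetric]) (auto simp: U1_def U2_def intro!: sum.cong)
  ultimately have "(\<Sum>i<k. passage_time w (\<gamma>s i)) \<le> corner w k (int a) (int b) + walk_weight w k C pos"
    using sum_passage_time[OF f, of w] by (simp add: U_def)
  then show ?thesis using walkers_pos fin by blast
qed

section \<open>The local rule\<close>

lemma LPP_attained:
  obtains \<gamma>s where "feasible k u v \<gamma>s" "LPP k w u v = (\<Sum>i<k. passage_time w (\<gamma>s i))"
proof -
  have "LPP k w u v \<in> (\<lambda>\<gamma>s. \<Sum>i<k. passage_time w (\<gamma>s i)) ` path_families k u v"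
    unfolding LPP_eq_Max by (rule Max_in) (simp_all add: finite_path_families path_families_nonempty)
  then show ?thesis using that by (auto simp: path_families_def)
qed

lemma LPP_le_Suc: "LPP k w u v \<le> LPP (Suc k) w u v"
proof (rule LPP_le)
  fix \<gamma>s assume "feasible k u v \<gamma>s"
  then have f: "feasible (Suc k) u v (\<gamma>s(k := []))"
    by (auto simp: feasible_def up_right_path_def less_Suc_eq)
  show "(\<Sum>i<k. passage_time w (\<gamma>s i)) \<le> LPP (Suc k) w u v"
    using le_LPP[OF f, of w] by (simp add: passage_time_def)
qed

text \<open>The partition function of \<open>k\<close> disjoint paths at inverse temperature \<open>t\<close>: the vertices near
  the corner \<open>(a, b)\<close> are visited by every packed family, whence the factor in front.\<close>
definition partition_fun :: "(int \<times> int \<Rightarrow> real) \<Rightarrow> real \<Rightarrow> nat \<Rightarrow> nat \<Rightarrow> nat \<Rightarrow> real" where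
  "partition_fun w t k a b = exp (t * corner w k (int a) (int b)) *
     walk_det (\<lambda>c x. exp (t * site w c x)) k (a + b + 1 - k) (\<lambda>i. int a - int i)"

text \<open>Up to a factor independent of \<open>t\<close>, the partition function is its largest
  term. The lower bound reroutes an optimal family into packed walkers; the upper bound turns packed
  walkers back into disjoint paths.\<close>

lemma partition_fun_bounds:
  assumes w: "\<And>z. 0 \<le> w z" and k: "k \<le> 1 + min a b" and t: "0 \<le> t"
  shows "exp (t * LPP k w (0, 0) (int a, int b)) \<le> partition_fun w t k a b"
    "partition_fun w t k a b \<le> (2 ^ k) ^ (a + b + 1 - k) * exp (t * LPP k w (0, 0) (int a, int b))"
proof -
  let ?L = "LPP k w (0, 0) (int a, int b)" and ?c = "corner w k (int a) (int b)"
  let ?C = "a + b + 1 - k" and ?y = "\<lambda>c x. exp (t * site w c x)"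
  obtain \<gamma>s where f: "feasible k (0, 0) (int a, int b) \<gamma>s"
    and L: "?L = (\<Sum>i<k. passage_time w (\<gamma>s i))" by (rule LPP_attained)
  obtain X where X: "walkers k ?C X" "\<forall>i<k. X ?C i = int a - int i"
    and le: "?L \<le> ?c + walk_weight w k ?C X"
    using ex_walkers_of_feasible[where w = w, OF w k refl f] L by auto
  have "walk_det ?y k ?C (X ?C) = walk_det ?y k ?C (\<lambda>i. int a - int i)"
    by (rule walk_det_cong) (use X in simp)
  then have "exp (t * walk_weight w k ?C X) \<le> walk_det ?y k ?C (\<lambda>i. int a - int i)"
    using exp_walk_weight_le_walk_det[OF X(1), of t w] by simp
  then have "exp (t * ?c) * exp (t * walk_weight w k ?C X) \<le> partition_fun w t k a b"
    unfolding partition_fun_def by (intro mult_left_mono) auto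
  moreover have "exp (t * ?L) \<le> exp (t * ?c) * exp (t * walk_weight w k ?C X)"
    using mult_left_mono[OF le t] by (simp add: mult_exp_exp algebra_simps)
  ultimately show "exp (t * ?L) \<le> partition_fun w t k a b" by simp
  have "walk_det ?y k ?C (\<lambda>i. int a - int i) \<le> (2 ^ k) ^ ?C * exp (t * (?L - ?c))"
  proof (rule walk_det_le_exp[OF t])
    fix X assume "walkers k ?C X" "\<And>i. i < k \<Longrightarrow> X ?C i = int a - int i"
    then have "?c + walk_weight w k ?C X \<le> ?L"
      using walk_weight_le_LPP[OF k refl] by blast
    then show "walk_weight w k ?C X \<le> ?L - ?c" by simp
  qed (simp add: decr_def)
  then have "partition_fun w t k a b \<le> exp (t * ?c) * ((2 ^ k) ^ ?C * exp (t * (?L - ?c)))"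
    unfolding partition_fun_def by (intro mult_left_mono) auto
  also have "\<dots> = (2 ^ k) ^ ?C * exp (t * ?L)"
    by (simp add: mult_exp_exp algebra_simps)
  finally show "partition_fun w t k a b \<le> (2 ^ k) ^ ?C * exp (t * ?L)" .
qed

lemma corner_split_row:
  "corner w (Suc m) a b = corner w m a (b - 1) + (\<Sum>d<m. w (a - int d, b))"
  by (simp add: corner_def algebra_simps)

lemma corner_split_column:
  "corner w (Suc m) a b = corner w m (a - 1) b + (\<Sum>i<m. w (a, b + int i + 1 - int m))"
proof -
  have "corner w (Suc m) a b = (\<Sum>i<m. \<Sum>d<Suc i. w (a - int d, b + int (Suc i) + 1 - int (Suc m)))"
    unfolding corner_def by (subst sum.lessThan_Suc_shift) simp
  also have "\<dots> = (\<Sum>i<m. w (a, b + int i + 1 - int m) + (\<Sum>d<i. w (a - 1 - int d, b + int i + 1 - int m)))"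
    by (intro sum.cong refl, subst sum.lessThan_Suc_shift) (simp add: algebra_simps)
  finally show ?thesis by (simp add: corner_def sum.distrib)
qed

lemma sum_shift: "(\<Sum>i<m. g (Suc i)) + g 0 = g m + (\<Sum>i<m. g i)" for g :: "nat \<Rightarrow> real"
  by (induction m) simp_all

text \<open>The step to time \<open>Suc c\<close> in \<open>walk_det_consecutive\<close> brings in
  the weights of the two extreme sites. The corner factors exchange each of them for the weight at
  the corner \<open>(a, b)\<close>: here the site \<open>(a, b - int m)\<close>, in
  \<open>corner_row\<close> the site \<open>(a - int m, b)\<close>.\<close>

lemma corner_column:
  "corner w (Suc m) a b + corner w m (a - 1) (b - 1) + w (a, b - int m) =
    w (a, b) + corner w (Suc m) a (b - 1) + corner w m (a - 1) b"
  using sum_shift[of "\<lambda>i. w (a, b + int i - int m)" m]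
  by (simp add: corner_split_column algebra_simps)

lemma corner_row:
  "corner w (Suc m) a b + corner w m (a - 1) (b - 1) + w (a - int m, b) =
    w (a, b) + corner w (Suc m) (a - 1) b + corner w m a (b - 1)"
  using sum_shift[of "\<lambda>i. w (a - int i, b)" m]
  by (simp add: corner_split_row algebra_simps)

text \<open>All six packed end positions begin at abscissa \<open>Suc a\<close> or \<open>a\<close>,
  and all six times are \<open>c\<close> or \<open>Suc c\<close>, so this is
  \<open>walk_det_consecutive\<close> dressed with the corner factors.\<close>

lemma partition_fun_rec:
  assumes "m \<le> min a b"
  shows "partition_fun w t (Suc m) (Suc a) (Suc b) * partition_fun w t m a b =
    exp (t * w (int (Suc a), int (Suc b))) *
      (partition_fun w t (Suc m) (Suc a) b * partition_fun w t m a (Suc b) +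
       partition_fun w t (Suc m) a (Suc b) * partition_fun w t m (Suc a) b)"
proof -
  define c where "c = a + b + 1 - m"
  let ?y = "\<lambda>c x. exp (t * site w c x)"
  let ?p = "\<lambda>(x :: int) i. x - int i"
  have c: "Suc a + Suc b + 1 - Suc m = Suc c" "a + b + 1 - m = c" "Suc a + b + 1 - Suc m = c"
    "a + Suc b + 1 - m = Suc c" "a + Suc b + 1 - Suc m = c" "Suc a + b + 1 - m = Suc c"
    using assms by (auto simp: c_def)
  have intc: "int c = int a + int b + 1 - int m" using assms by (auto simp: c_def)
  have a: "int (Suc a) - 1 = int a" "int (Suc b) - 1 = int b" by simp_all
  \<comment> \<open>The bound on \<open>m\<close> keeps both extreme sites at nonnegative abscissae,
    where \<open>site\<close> reads a genuine weight.\<close>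
  have y: "?y (Suc c) (int (Suc a)) = exp (t * w (int (Suc a), int (Suc b) - int m))"
    "?y (Suc c) (int (Suc a) - int m) = exp (t * w (int (Suc a) - int m, int (Suc b)))"
    using assms by (simp_all add: site_def intc algebra_simps)
  note D = walk_det_consecutive[of ?y m c "int (Suc a)", unfolded y a]
  have 1: "corner w (Suc m) (int (Suc a)) (int (Suc b)) + corner w m (int a) (int b) +
      w (int (Suc a), int (Suc b) - int m) = w (int (Suc a), int (Suc b)) +
      corner w (Suc m) (int (Suc a)) (int b) + corner w m (int a) (int (Suc b))"
    using corner_column[of w m "int (Suc a)" "int (Suc b)"] unfolding a .
  have 2: "corner w (Suc m) (int (Suc a)) (int (Suc b)) + corner w m (int a) (int b) +
      w (int (Suc a) - int m, int (Suc b)) = w (int (Suc a), int (Suc b)) +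
      corner w (Suc m) (int a) (int (Suc b)) + corner w m (int (Suc a)) (int b)"
    using corner_row[of w m "int (Suc a)" "int (Suc b)"] unfolding a .
  have e1: "exp (t * corner w (Suc m) (int (Suc a)) (int (Suc b))) * exp (t * corner w m (int a) (int b)) *
      exp (t * w (int (Suc a), int (Suc b) - int m)) = exp (t * w (int (Suc a), int (Suc b))) *
      exp (t * corner w (Suc m) (int (Suc a)) (int b)) * exp (t * corner w m (int a) (int (Suc b)))"
    unfolding mult_exp_exp using arg_cong[OF 1, of "\<lambda>s. exp (t * s)"] by (simp only: distrib_left)
  have e2: "exp (t * corner w (Suc m) (int (Suc a)) (int (Suc b))) * exp (t * corner w m (int a) (int b)) *
      exp (t * w (int (Suc a) - int m, int (Suc b))) = exp (t * w (int (Suc a), int (Suc b))) *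
      exp (t * corner w (Suc m) (int a) (int (Suc b))) * exp (t * corner w m (int (Suc a)) (int b))"
    unfolding mult_exp_exp using arg_cong[OF 2, of "\<lambda>s. exp (t * s)"] by (simp only: distrib_left)
  have alg: "E1 * D1 * (E2 * D2) = x * (E3 * D3 * (E4 * D4) + E5 * D5 * (E6 * D6))"
    if "D1 * D2 = y1 * D3 * D4 + y2 * D5 * D6" "E1 * E2 * y1 = x * E3 * E4" "E1 * E2 * y2 = x * E5 * E6"
    for E1 E2 E3 E4 E5 E6 D1 D2 D3 D4 D5 D6 x y1 y2 :: real
  proof -
    have "E1 * D1 * (E2 * D2) = E1 * E2 * (D1 * D2)" by (simp add: mult_ac)
    also have "\<dots> = (E1 * E2 * y1) * (D3 * D4) + (E1 * E2 * y2) * (D5 * D6)"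
      unfolding that(1) by (simp add: algebra_simps)
    also have "\<dots> = x * (E3 * D3 * (E4 * D4) + E5 * D5 * (E6 * D6))"
      unfolding that(2,3) by (simp add: algebra_simps)
    finally show ?thesis .
  qed
  show ?thesis unfolding partition_fun_def c by (rule alg[OF D e1 e2])
qed

text \<open>The zero-temperature limit: a constant factor cannot compensate a difference of
  exponential rates.\<close>

lemma le_of_exp_le:
  fixes A B C :: real
  assumes "\<And>t. 0 \<le> t \<Longrightarrow> exp (t * A) \<le> C * exp (t * B)"
  shows "A \<le> B"
proof (rule ccontr)
  assume "\<not> A \<le> B"
  then have AB: "0 < A - B" by simp
  have C: "0 < C" using assms[of 0] by simp
  \<comment> \<open>Chosen so that \<open>t * (A - B)\<close> exceeds \<open>ln C\<close> by at
    least one.\<close>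
  define t where "t = (\<bar>ln C\<bar> + 1) / (A - B)"
  have "0 \<le> t" using AB by (simp add: t_def)
  then have "exp (t * A) \<le> exp (ln C) * exp (t * B)" using assms[of t] C by simp
  then have "t * A \<le> ln C + t * B" by (simp add: mult_exp_exp)
  then have "t * (A - B) \<le> ln C" by (simp add: algebra_simps)
  moreover have "t * (A - B) = \<bar>ln C\<bar> + 1" using AB by (simp add: t_def)
  ultimately show False by linarith
qed

text \<open>Each product of two partition functions is comparable to one exponential, and a sum of
  two exponentials is at least the larger one and at most a constant multiple of it. This is how the
  sum in \<open>partition_fun_rec\<close> becomes a maximum.\<close>

lemma LPP_rec_inner:
  assumes w: "\<And>z. 0 \<le> w z" and m: "m \<le> min a b"
  defines "L \<equiv> \<lambda>k a b. LPP k w (0, 0) (int a, int b)"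
  shows "L (Suc m) (Suc a) (Suc b) + L m a b = w (int (Suc a), int (Suc b)) +
    max (L (Suc m) a (Suc b) + L m (Suc a) b) (L (Suc m) (Suc a) b + L m a (Suc b))"
proof -
  let ?w = "w (int (Suc a), int (Suc b))"
  define K where "K k a b = ((2 :: real) ^ k) ^ (a + b + 1 - k)" for k a b :: nat
  have K: "0 < K k a b" for k a b by (simp add: K_def)
  have lo: "exp (t * L k a b) \<le> partition_fun w t k a b"
    and up: "partition_fun w t k a b \<le> K k a b * exp (t * L k a b)"
    if "0 \<le> t" "k \<le> 1 + min a b" for t k a b
    using partition_fun_bounds[of w k a b t] that w by (simp_all add: L_def K_def)
  have pos: "0 \<le> partition_fun w t k a b" if "0 \<le> t" "k \<le> 1 + min a b" for t k a b
    using lo[OF that] exp_ge_zero order_trans by blast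
  have ks: "Suc m \<le> 1 + min (Suc a) (Suc b)" "m \<le> 1 + min a b" "Suc m \<le> 1 + min (Suc a) b"
    "m \<le> 1 + min a (Suc b)" "Suc m \<le> 1 + min a (Suc b)" "m \<le> 1 + min (Suc a) b"
    using m by auto
  have prod_lo: "exp (t * (L k a b + L k' a' b')) \<le> partition_fun w t k a b * partition_fun w t k' a' b'"
    if "0 \<le> t" "k \<le> 1 + min a b" "k' \<le> 1 + min a' b'" for t k a b k' a' b'
  proof -
    have "exp (t * L k a b) * exp (t * L k' a' b') \<le>
        partition_fun w t k a b * partition_fun w t k' a' b'"
      using that by (intro mult_mono lo pos) auto
    then show ?thesis by (simp add: mult_exp_exp distrib_left)
  qed
  have prod_up: "partition_fun w t k a b * partition_fun w t k' a' b' \<le>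
      K k a b * K k' a' b' * exp (t * (L k a b + L k' a' b'))"
    if "0 \<le> t" "k \<le> 1 + min a b" "k' \<le> 1 + min a' b'" for t k a b k' a' b'
  proof -
    have "partition_fun w t k a b * partition_fun w t k' a' b' \<le>
        (K k a b * exp (t * L k a b)) * (K k' a' b' * exp (t * L k' a' b'))"
      using that K[of k a b] by (intro mult_mono up pos) auto
    then show ?thesis by (simp add: exp_add distrib_left mult_ac)
  qed
  have upper: "?w + S \<le> L (Suc m) (Suc a) (Suc b) + L m a b"
    if S: "\<And>t. 0 \<le> t \<Longrightarrow> exp (t * S) \<le> partition_fun w t (Suc m) (Suc a) b * partition_fun w t m a (Suc b) +
       partition_fun w t (Suc m) a (Suc b) * partition_fun w t m (Suc a) b" for S
  proof (rule le_of_exp_le)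
    fix t :: real assume t: "0 \<le> t"
    have "exp (t * (?w + S)) = exp (t * ?w) * exp (t * S)" by (simp add: mult_exp_exp distrib_left)
    also have "\<dots> \<le> partition_fun w t (Suc m) (Suc a) (Suc b) * partition_fun w t m a b"
      unfolding partition_fun_rec[OF m] by (intro mult_left_mono S t) simp
    also have "\<dots> \<le> K (Suc m) (Suc a) (Suc b) * K m a b * exp (t * (L (Suc m) (Suc a) (Suc b) + L m a b))"
      using ks t by (intro prod_up)
    finally show "exp (t * (?w + S)) \<le> \<dots>" .
  qed
  have "L (Suc m) (Suc a) (Suc b) + L m a b \<le> ?w +
    max (L (Suc m) a (Suc b) + L m (Suc a) b) (L (Suc m) (Suc a) b + L m a (Suc b))" (is "_ \<le> ?w + ?M")
  proof (rule le_of_exp_le)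
    fix t :: real assume t: "0 \<le> t"
    let ?K1 = "K (Suc m) (Suc a) b * K m a (Suc b)" and ?K2 = "K (Suc m) a (Suc b) * K m (Suc a) b"
    have M: "exp (t * (L (Suc m) (Suc a) b + L m a (Suc b))) \<le> exp (t * ?M)"
      "exp (t * (L (Suc m) a (Suc b) + L m (Suc a) b)) \<le> exp (t * ?M)"
      using t by (auto intro!: mult_left_mono)
    have "exp (t * (L (Suc m) (Suc a) (Suc b) + L m a b)) \<le>
        partition_fun w t (Suc m) (Suc a) (Suc b) * partition_fun w t m a b"
      using ks t by (intro prod_lo)
    also have "\<dots> \<le> exp (t * ?w) * (?K1 * exp (t * ?M) + ?K2 * exp (t * ?M))"
      unfolding partition_fun_rec[OF m]
    proof (intro mult_left_mono add_mono)
      show "partition_fun w t (Suc m) (Suc a) b * partition_fun w t m a (Suc b) \<le> ?K1 * exp (t * ?M)"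
        by (rule order_trans[OF prod_up[OF t ks(3,4)] mult_left_mono[OF M(1)]])
           (simp add: K less_imp_le)
      show "partition_fun w t (Suc m) a (Suc b) * partition_fun w t m (Suc a) b \<le> ?K2 * exp (t * ?M)"
        by (rule order_trans[OF prod_up[OF t ks(5,6)] mult_left_mono[OF M(2)]])
           (simp add: K less_imp_le)
    qed simp
    also have "\<dots> = (?K1 + ?K2) * exp (t * (?w + ?M))"
      by (simp add: exp_add algebra_simps)
    finally show "exp (t * (L (Suc m) (Suc a) (Suc b) + L m a b)) \<le> (?K1 + ?K2) * exp (t * (?w + ?M))" .
  qed
  moreover have "?w + (L (Suc m) (Suc a) b + L m a (Suc b)) \<le> L (Suc m) (Suc a) (Suc b) + L m a b"
    using prod_lo[OF _ ks(3,4)] pos ks by (intro upper) (smt (verit) mult_nonneg_nonneg)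
  moreover have "?w + (L (Suc m) a (Suc b) + L m (Suc a) b) \<le> L (Suc m) (Suc a) (Suc b) + L m a b"
    using prod_lo[OF _ ks(5,6)] pos ks by (intro upper) (smt (verit) mult_nonneg_nonneg)
  ultimately show ?thesis by linarith
qed

lemma sum_rect_Suc:
  "sum w (rect (0, 0) (int (Suc a), int (Suc b))) + sum w (rect (0, 0) (int a, int b)) =
    w (int (Suc a), int (Suc b)) + sum w (rect (0, 0) (int a, int (Suc b))) +
      sum w (rect (0, 0) (int (Suc a), int b))" for w :: "int \<times> int \<Rightarrow> real"
proof -
  let ?R = "\<lambda>a b. rect (0, 0) (int a, int b)"
  have "?R (Suc a) (Suc b) = insert (int (Suc a), int (Suc b)) (?R a (Suc b) \<union> ?R (Suc a) b)"
    by (auto simp: rect_def)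
  then have "sum w (?R (Suc a) (Suc b)) = w (int (Suc a), int (Suc b)) + sum w (?R a (Suc b) \<union> ?R (Suc a) b)"
    by (simp only:) (rule sum.insert, simp, simp add: rect_def)
  moreover have "?R a b = ?R a (Suc b) \<inter> ?R (Suc a) b" by (auto simp: rect_def)
  ultimately show ?thesis
    using sum.union_inter[of "?R a (Suc b)" "?R (Suc a) b" w] by simp
qed

text \<open>The zero-temperature limit of the three-term identity for partition functions.\<close>
lemma LPP_rec:
  assumes w: "\<And>z. 0 \<le> w z" and m: "m \<le> Suc (min a b)"
  defines "L \<equiv> \<lambda>k a b. LPP k w (0, 0) (int a, int b)"
  shows "L (Suc m) (Suc a) (Suc b) + L m a b = w (int (Suc a), int (Suc b)) +
    max (L (Suc m) a (Suc b) + L m (Suc a) b) (L (Suc m) (Suc a) b + L m a (Suc b))"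
proof (cases "m \<le> min a b")
  case True
  then show ?thesis unfolding L_def by (intro LPP_rec_inner w)
next
  case False
  \<comment> \<open>In the saturated case the values with \<open>Suc m\<close> paths and
    \<open>L m a b\<close> are total weights, as is one of the two remaining values; the claim is
    then inclusion-exclusion for rectangles.\<close>
  with m have m: "m = Suc (min a b)" by (metis le_antisym not_less_eq_eq)
  let ?S = "\<lambda>a b. sum w (rect (0, 0) (int a, int b))"
  have tot: "L k a b = ?S a b" if "1 + min a b \<le> k" for k a b
    unfolding L_def by (rule LPP_total[OF w that])
  have le: "L m a b \<le> L (Suc m) a b" for a b
    unfolding L_def by (rule LPP_le_Suc)
  have "L (Suc m) (Suc a) (Suc b) = ?S (Suc a) (Suc b)" "L m a b = ?S a b"
    "L (Suc m) a (Suc b) = ?S a (Suc b)" "L (Suc m) (Suc a) b = ?S (Suc a) b"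
    by (rule tot, simp add: m)+
  moreover have "L m a (Suc b) = ?S a (Suc b) \<or> L m (Suc a) b = ?S (Suc a) b"
    using m tot[of a "Suc b" m] tot[of "Suc a" b m] by (cases "a \<le> b") auto
  moreover note le[of a "Suc b"] le[of "Suc a" b] sum_rect_Suc[of w a b]
  ultimately show ?thesis by linarith
qed

section \<open>The local rule for the increments \<open>W\<close>\<close>

lemma W_eq_0:
  assumes "\<And>z. 0 \<le> w z" "Suc (min a b) < k"
  shows "W k w (int a, int b) = 0"
  using assms by (simp add: W_def Wuv_def LPP_total)

lemma W_first_corner:
  assumes "\<And>z. 0 \<le> w z"
  shows "W (Suc 0) w (int (Suc a), int (Suc b)) = w (int (Suc a), int (Suc b)) +
    max (W (Suc 0) w (int a, int (Suc b))) (W (Suc 0) w (int (Suc a), int b))"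
  using LPP_rec[of w 0 a b] assms by (simp add: W_def Wuv_def)

text \<open>Subtract \<open>LPP_rec\<close> for \<open>k\<close> from \<open>LPP_rec\<close> for
  \<open>Suc k\<close>; the weight cancels. With the sum of the two neighbouring values for
  \<open>Suc k\<close> paths as reference, the first maximum is this sum plus a maximum of
  increments, the second is this sum minus a minimum of increments.\<close>

lemma W_Suc_corner:
  assumes w: "\<And>z. 0 \<le> w z" and k: "k \<le> min a b"
  shows "W (Suc (Suc k)) w (int (Suc a), int (Suc b)) =
    max (W (Suc (Suc k)) w (int a, int (Suc b))) (W (Suc (Suc k)) w (int (Suc a), int b)) +
    min (W (Suc k) w (int a, int (Suc b))) (W (Suc k) w (int (Suc a), int b)) -
    W (Suc k) w (int a, int b)"
proof -
  have *: "R2 - R1 = max (m2 - m1) (n2 - n1) + min (m1 - m0) (n1 - n0) - (l1 - l0)"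
    if "R2 + l1 = x + max (m2 + n1) (n2 + m1)" "R1 + l0 = x + max (m1 + n0) (n1 + m0)"
    for R1 R2 l0 l1 m0 m1 m2 n0 n1 n2 x :: real
    using that by (auto simp: max_def min_def)
  have k': "Suc k \<le> Suc (min a b)" "k \<le> Suc (min a b)" using k by auto
  show ?thesis
    unfolding W_def Wuv_def diff_Suc_1
    by (rule *[OF LPP_rec[where w = w, OF w k'(1)] LPP_rec[where w = w, OF w k'(2)]])
qed

lemma W_first_axis:
  assumes w: "\<And>z. 0 \<le> w z"
  shows "W (Suc 0) w (0, 0) = w (0, 0)"
    "W (Suc 0) w (int (Suc a), 0) = w (int (Suc a), 0) + W (Suc 0) w (int a, 0)"
    "W (Suc 0) w (0, int (Suc b)) = w (0, int (Suc b)) + W (Suc 0) w (0, int b)"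
    "0 \<le> W (Suc 0) w (int a, 0)" "0 \<le> W (Suc 0) w (0, int b)"
proof -
  have tot: "W (Suc 0) w (int a, 0) = sum w (rect (0, 0) (int a, 0))" for a
    using LPP_total[of w a 0 "Suc 0"] w by (simp add: W_def Wuv_def)
  have tot': "W (Suc 0) w (0, int b) = sum w (rect (0, 0) (0, int b))" for b
    using LPP_total[of w 0 b "Suc 0"] w by (simp add: W_def Wuv_def)
  have "rect (0, 0) (0, 0) = {(0, 0)}" by (auto simp: rect_def)
  then show "W (Suc 0) w (0, 0) = w (0, 0)" using tot[of 0] by simp
  have "rect (0, 0) (int (Suc a), 0) = insert (int (Suc a), 0) (rect (0, 0) (int a, 0))"
    by (auto simp: rect_def)
  moreover have "(int (Suc a), 0) \<notin> rect (0, 0) (int a, 0)" by (simp add: rect_def)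
  ultimately show "W (Suc 0) w (int (Suc a), 0) = w (int (Suc a), 0) + W (Suc 0) w (int a, 0)"
    unfolding tot by (simp only: sum.insert finite_rect if_False simp_thms)
  have "rect (0, 0) (0, int (Suc b)) = insert (0, int (Suc b)) (rect (0, 0) (0, int b))"
    by (auto simp: rect_def)
  moreover have "(0, int (Suc b)) \<notin> rect (0, 0) (0, int b)" by (simp add: rect_def)
  ultimately show "W (Suc 0) w (0, int (Suc b)) = w (0, int (Suc b)) + W (Suc 0) w (0, int b)"
    unfolding tot' by (simp only: sum.insert finite_rect if_False simp_thms)
  show "0 \<le> W (Suc 0) w (int a, 0)" "0 \<le> W (Suc 0) w (0, int b)"
    unfolding tot tot' using w by (auto intro: sum_nonneg)
qed

section \<open>Interlacing arrays\<close>

text \<open>Level \<open>m\<close> lives on the antidiagonal \<open>a + b = m - 1\<close>; the shift (and \<open>0 - 1 = 0\<close>) makes levels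
  \<open>m - 1\<close> and \<open>m\<close> both empty for \<open>m = 0\<close>, where the induction starts.\<close>
definition level :: "nat \<Rightarrow> (nat \<times> nat \<times> nat) set" where
  "level m = {(a, b, k). a + b + 1 = m \<and> 1 \<le> k \<and> k \<le> 1 + min a b}"

definition diag :: "nat \<Rightarrow> (nat \<times> nat) set" where
  "diag m = {(a, b). a + b = m}"

text \<open>Entries outside the quadrant or with \<open>k > 1 + min a b\<close> count as \<open>0\<close>, in accordance with \<open>W_eq_0\<close>.\<close>
definition left_nb :: "(nat \<times> nat \<times> nat \<Rightarrow> real) \<Rightarrow> nat \<Rightarrow> nat \<Rightarrow> nat \<Rightarrow> real" where
  "left_nb q a b k = (case a of 0 \<Rightarrow> 0 | Suc a' \<Rightarrow> if k \<le> 1 + min a' b then q (a', b, k) else 0)"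

definition down_nb :: "(nat \<times> nat \<times> nat \<Rightarrow> real) \<Rightarrow> nat \<Rightarrow> nat \<Rightarrow> nat \<Rightarrow> real" where
  "down_nb q a b k = (case b of 0 \<Rightarrow> 0 | Suc b' \<Rightarrow> if k \<le> 1 + min a b' then q (a, b', k) else 0)"

definition max_nb :: "(nat \<times> nat \<times> nat \<Rightarrow> real) \<Rightarrow> nat \<Rightarrow> nat \<Rightarrow> nat \<Rightarrow> real" where
  "max_nb q a b k = max (left_nb q a b k) (down_nb q a b k)"

definition min_nb :: "(nat \<times> nat \<times> nat \<Rightarrow> real) \<Rightarrow> nat \<Rightarrow> nat \<Rightarrow> nat \<Rightarrow> real" where
  "min_nb q a b k = min (left_nb q a b k) (down_nb q a b k)"

text \<open>It takes levels \<open>m - 1\<close> and \<open>m\<close> to levels \<open>m\<close> and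
  \<open>Suc m\<close>: level \<open>m\<close> is copied, each entry of level \<open>m - 1\<close>
  is used up in one reflection, each weight in one translation.\<close>

definition local_rule ::
    "nat \<Rightarrow> (nat \<times> nat \<times> nat \<Rightarrow> real) \<Rightarrow> (nat \<times> nat \<Rightarrow> real) \<Rightarrow> nat \<times> nat \<times> nat \<Rightarrow> real" where
  "local_rule m p x = (\<lambda>(a, b, k). if a + b + 1 = m then p (a, b, k)
     else if k = 1 then x (a, b) + max_nb p a b 1
     else max_nb p a b k + min_nb p a b (k - 1) - p (a - 1, b - 1, k - 1))"

text \<open>The inequalities are sorted by the entries of the lower level. Nonnegativity is asked
  for on the upper level and follows on the lower one, because \<open>max_nb\<close> is then
  nonnegative.\<close>

definition interlaced :: "nat \<Rightarrow> (nat \<times> nat \<times> nat \<Rightarrow> real) \<Rightarrow> bool" where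
  "interlaced m p \<longleftrightarrow> (\<forall>j\<in>level m. 0 \<le> p j) \<and>
     (\<forall>(a, b, k)\<in>level (m - 1). max_nb p (Suc a) (Suc b) (Suc k) \<le> p (a, b, k) \<and>
        p (a, b, k) \<le> min_nb p (Suc a) (Suc b) k)"

definition energy :: "nat \<Rightarrow> (nat \<times> nat \<times> nat \<Rightarrow> real) \<Rightarrow> real" where
  "energy m p = (\<Sum>j\<in>level m. p j) - (\<Sum>j\<in>level (m - 1). p j)"

lemma level_0 [simp]: "level 0 = {}" by (simp add: level_def)

lemma level_Suc: "level (Suc n) = Iset n" by (simp add: level_def Iset_def)

lemma finite_level [simp]: "finite (level m)"
proof (rule finite_subset)
  show "level m \<subseteq> {..m} \<times> {..m} \<times> {..Suc m}" by (auto simp: level_def)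
qed simp

lemma finite_diag [simp]: "finite (diag m)"
proof (rule finite_subset)
  show "diag m \<subseteq> {..m} \<times> {..m}" by (auto simp: diag_def)
qed simp

lemma level_disjoint: "m \<noteq> m' \<Longrightarrow> level m \<inter> level m' = {}"
  by (auto simp: level_def)

lemma level_pred_disjoint: "level (m - 1) \<inter> level m = {}"
  by (cases m) (auto simp: level_def)

lemma level_pred_iff: "(a, b, k) \<in> level (m - Suc 0) \<longleftrightarrow> a + b + 2 = m \<and> 1 \<le> k \<and> k \<le> 1 + min a b"
  by (auto simp: level_def)

text \<open>The entries obtained by translation, one for each weight, and those obtained by
  reflection, one for each entry of level \<open>m - 1\<close>.\<close>

lemma level_Suc_split:
  "level (Suc m) = (\<lambda>(a, b). (a, b, 1)) ` diag m \<union> (\<lambda>(a, b, k). (Suc a, Suc b, Suc k)) ` level (m - 1)"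
proof (intro Set.set_eqI iffI)
  fix j assume j: "j \<in> level (Suc m)"
  obtain a b k where abk: "j = (a, b, k)" by (cases j)
  show "j \<in> (\<lambda>(a, b). (a, b, 1)) ` diag m \<union> (\<lambda>(a, b, k). (Suc a, Suc b, Suc k)) ` level (m - 1)"
  proof (cases "k = 1")
    case True
    then show ?thesis using j abk by (auto simp: level_def diag_def)
  next
    case False
    with j abk obtain a' b' k' where "a = Suc a'" "b = Suc b'" "k = Suc k'" "1 \<le> k'"
      by (cases a; cases b; cases k) (auto simp: level_def)
    moreover from this have "(a', b', k') \<in> level (m - 1)"
      using j abk by (auto simp: level_def)
    ultimately show ?thesis using abk by force
  qed
qed (auto simp: level_def diag_def)

lemma level_Suc_split_disjoint:
  "(\<lambda>(a, b). (a, b, 1)) ` diag m \<inter> (\<lambda>(a, b, k). (Suc a, Suc b, Suc k)) ` level (m - 1) = {}"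
  by (auto simp: level_def)

lemma sum_level_Suc:
  "(\<Sum>j\<in>level (Suc m). g j) = (\<Sum>(a, b)\<in>diag m. g (a, b, 1)) +
     (\<Sum>(a, b, k)\<in>level (m - 1). g (Suc a, Suc b, Suc k))"
  unfolding level_Suc_split
proof (subst sum.union_disjoint[OF _ _ level_Suc_split_disjoint])
  have "inj_on (\<lambda>(a, b). (a, b, 1 :: nat)) (diag m)"
    "inj_on (\<lambda>(a, b, k). (Suc a, Suc b, Suc k)) (level (m - 1))"
    by (auto simp: inj_on_def)
  then show "sum g ((\<lambda>(a, b). (a, b, 1)) ` diag m) + sum g ((\<lambda>(a, b, k). (Suc a, Suc b, Suc k)) ` level (m - 1)) =
      (\<Sum>(a, b)\<in>diag m. g (a, b, 1)) + (\<Sum>(a, b, k)\<in>level (m - 1). g (Suc a, Suc b, Suc k))"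
    by (simp only: sum.reindex comp_def case_prod_unfold)
qed simp_all

lemma prod_level_Suc:
  "(\<Prod>j\<in>level (Suc m). g j) = (\<Prod>(a, b)\<in>diag m. g (a, b, 1)) *
     (\<Prod>(a, b, k)\<in>level (m - 1). g (Suc a, Suc b, Suc k))"
  unfolding level_Suc_split
proof (subst prod.union_disjoint[OF _ _ level_Suc_split_disjoint])
  have "inj_on (\<lambda>(a, b). (a, b, 1 :: nat)) (diag m)"
    "inj_on (\<lambda>(a, b, k). (Suc a, Suc b, Suc k)) (level (m - 1))"
    by (auto simp: inj_on_def)
  then show "prod g ((\<lambda>(a, b). (a, b, 1)) ` diag m) * prod g ((\<lambda>(a, b, k). (Suc a, Suc b, Suc k)) ` level (m - 1)) =
      (\<Prod>(a, b)\<in>diag m. g (a, b, 1)) * (\<Prod>(a, b, k)\<in>level (m - 1). g (Suc a, Suc b, Suc k))"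
    by (simp only: prod.reindex comp_def case_prod_unfold)
qed simp_all

lemma nb_cong:
  assumes "\<And>j. j \<in> level m \<Longrightarrow> p j = q j" "a + b = m" "1 \<le> k"
  shows "max_nb p a b k = max_nb q a b k" "min_nb p a b k = min_nb q a b k"
  using assms unfolding max_nb_def min_nb_def left_nb_def down_nb_def
  by (auto split: nat.splits simp: level_def)

text \<open>The same inequalities sorted by the entries of the upper level, which is how the local
  rule meets them after a step. Nonnegativity is now asked for on the lower level and follows on the
  upper one.\<close>

lemma interlaced_iff:
  "interlaced m p \<longleftrightarrow> (\<forall>j\<in>level (m - 1). 0 \<le> p j) \<and>
     (\<forall>(a, b, k)\<in>level m. max_nb p a b k \<le> p (a, b, k) \<and>
        (2 \<le> k \<longrightarrow> p (a, b, k) \<le> min_nb p a b (k - 1)))" (is "_ \<longleftrightarrow> ?R")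
proof
  assume L: "interlaced m p"
  have q: "0 \<le> p j" if "j \<in> level m" for j using L that by (simp add: interlaced_def)
  have pq: "max_nb p (Suc a) (Suc b) (Suc k) \<le> p (a, b, k)" "p (a, b, k) \<le> min_nb p (Suc a) (Suc b) k"
    if "(a, b, k) \<in> level (m - 1)" for a b k
    using L that unfolding interlaced_def by blast+
  have "0 \<le> p j" if j: "j \<in> level (m - 1)" for j
  proof -
    obtain a b k where abk: "j = (a, b, k)" by (cases j)
    have "0 \<le> left_nb p (Suc a) (Suc b) (Suc k)"
      using q j abk by (auto simp: left_nb_def level_def)
    then show ?thesis using pq(1)[of a b k] j abk by (simp add: max_nb_def)
  qed
  moreover have "max_nb p a b k \<le> p (a, b, k)" if j: "(a, b, k) \<in> level m" for a b k
  proof -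
    have "left_nb p a b k \<le> p (a, b, k)"
    proof (cases "\<exists>a'. a = Suc a' \<and> k \<le> 1 + min a' b")
      case True
      then obtain a' where a': "a = Suc a'" "k \<le> 1 + min a' b" by blast
      then have "p (a', b, k) \<le> min_nb p (Suc a') (Suc b) k"
        using j by (intro pq) (auto simp: level_def)
      also have "\<dots> \<le> p (a, b, k)" using a' by (auto simp: min_nb_def down_nb_def)
      finally show ?thesis using a' by (simp add: left_nb_def)
    qed (use q[OF j] in \<open>auto simp: left_nb_def split: nat.splits\<close>)
    moreover have "down_nb p a b k \<le> p (a, b, k)"
    proof (cases "\<exists>b'. b = Suc b' \<and> k \<le> 1 + min a b'")
      case True
      then obtain b' where b': "b = Suc b'" "k \<le> 1 + min a b'" by blast
      then have "p (a, b', k) \<le> min_nb p (Suc a) (Suc b') k"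
        using j by (intro pq) (auto simp: level_def)
      also have "\<dots> \<le> p (a, b, k)" using b' by (auto simp: min_nb_def left_nb_def)
      finally show ?thesis using b' by (simp add: down_nb_def)
    qed (use q[OF j] in \<open>auto simp: down_nb_def split: nat.splits\<close>)
    ultimately show ?thesis by (simp add: max_nb_def)
  qed
  moreover have "p (a, b, k) \<le> min_nb p a b (k - 1)" if j: "(a, b, k) \<in> level m" "2 \<le> k" for a b k
  proof -
    obtain a' b' k' where s: "a = Suc a'" "b = Suc b'" "k = Suc k'"
      using j by (cases a; cases b; cases k) (auto simp: level_def)
    have "p (a, b, k) \<le> max_nb p (Suc a') (Suc b) (Suc k')"
      using j s by (auto simp: max_nb_def down_nb_def level_def)
    also have "\<dots> \<le> p (a', b, k')"
      using j s by (intro pq) (auto simp: level_def)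
    finally have 1: "p (a, b, k) \<le> p (a', b, k')" .
    have "p (a, b, k) \<le> max_nb p (Suc a) (Suc b') (Suc k')"
      using j s by (auto simp: max_nb_def left_nb_def level_def)
    also have "\<dots> \<le> p (a, b', k')"
      using j s by (intro pq) (auto simp: level_def)
    finally have 2: "p (a, b, k) \<le> p (a, b', k')" .
    show ?thesis using 1 2 j s by (auto simp: min_nb_def left_nb_def down_nb_def level_def)
  qed
  ultimately show ?R by blast
next
  assume R: ?R
  have p: "0 \<le> p j" if "j \<in> level (m - 1)" for j using R that by blast
  have pq: "max_nb p a b k \<le> p (a, b, k)" "2 \<le> k \<Longrightarrow> p (a, b, k) \<le> min_nb p a b (k - 1)"
    if "(a, b, k) \<in> level m" for a b k
    using R that by blast+
  have q: "0 \<le> p j" if j: "j \<in> level m" for j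
  proof -
    obtain a b k where abk: "j = (a, b, k)" by (cases j)
    have "0 \<le> left_nb p a b k"
      using p j abk by (auto simp: left_nb_def level_def split: nat.splits)
    then show ?thesis using pq(1)[of a b k] j abk by (simp add: max_nb_def)
  qed
  have "max_nb p (Suc a) (Suc b) (Suc k) \<le> p (a, b, k)" if j: "(a, b, k) \<in> level (m - 1)" for a b k
  proof -
    have "left_nb p (Suc a) (Suc b) (Suc k) \<le> p (a, b, k)"
    proof (cases "Suc k \<le> 1 + min a (Suc b)")
      case True
      then have "p (a, Suc b, Suc k) \<le> min_nb p a (Suc b) (Suc k - 1)"
        using j by (intro pq) (auto simp: level_def)
      also have "\<dots> \<le> p (a, b, k)" using j by (auto simp: min_nb_def down_nb_def level_def)
      finally show ?thesis using True by (simp add: left_nb_def)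
    qed (use p[OF j] in \<open>auto simp: left_nb_def\<close>)
    moreover have "down_nb p (Suc a) (Suc b) (Suc k) \<le> p (a, b, k)"
    proof (cases "Suc k \<le> 1 + min (Suc a) b")
      case True
      then have "p (Suc a, b, Suc k) \<le> min_nb p (Suc a) b (Suc k - 1)"
        using j by (intro pq) (auto simp: level_def)
      also have "\<dots> \<le> p (a, b, k)" using j by (auto simp: min_nb_def left_nb_def level_def)
      finally show ?thesis using True by (simp add: down_nb_def)
    qed (use p[OF j] in \<open>auto simp: down_nb_def\<close>)
    ultimately show ?thesis by (simp add: max_nb_def)
  qed
  moreover have "p (a, b, k) \<le> min_nb p (Suc a) (Suc b) k" if j: "(a, b, k) \<in> level (m - 1)" for a b k
  proof -
    have "p (a, b, k) \<le> max_nb p a (Suc b) k"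
      using j by (auto simp: max_nb_def down_nb_def level_def)
    also have "\<dots> \<le> p (a, Suc b, k)"
      using j by (intro pq) (auto simp: level_def)
    finally have 1: "p (a, b, k) \<le> p (a, Suc b, k)" .
    have "p (a, b, k) \<le> max_nb p (Suc a) b k"
      using j by (auto simp: max_nb_def left_nb_def level_def)
    also have "\<dots> \<le> p (Suc a, b, k)"
      using j by (intro pq) (auto simp: level_def)
    finally have 2: "p (a, b, k) \<le> p (Suc a, b, k)" .
    show ?thesis using 1 2 j by (auto simp: min_nb_def left_nb_def down_nb_def level_def)
  qed
  ultimately show "interlaced m p" using q unfolding interlaced_def by blast
qed

text \<open>For \<open>k = 1\<close> the new entry exceeds its lower bound by exactly the weight.
  For larger \<open>k\<close> it is the reflection of an old entry in the midpoint between
  \<open>max_nb\<close> and \<open>min_nb\<close>, so it satisfies both bounds iff the old entry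
  does.\<close>

lemma interlaced_local_rule:
  "interlaced (Suc m) (local_rule m p x) \<longleftrightarrow> interlaced m p \<and> (\<forall>d\<in>diag m. 0 \<le> x d)"
proof -
  let ?r = "local_rule m p x"
  have same: "?r j = p j" if "j \<in> level m" for j
    using that by (auto simp: local_rule_def level_def)
  have nb: "max_nb ?r a b k = max_nb p a b k" "min_nb ?r a b k = min_nb p a b k"
    if "a + b = m" "1 \<le> k" for a b k
    using nb_cong[of m ?r p a b k] same that by auto
  have split: "(\<forall>j\<in>level (Suc m). P j) \<longleftrightarrow> (\<forall>(a, b)\<in>diag m. P (a, b, 1)) \<and>
      (\<forall>(a, b, k)\<in>level (m - 1). P (Suc a, Suc b, Suc k))" for P
    unfolding level_Suc_split by (simp add: ball_Un split_beta)
  have d: "(max_nb ?r a b 1 \<le> ?r (a, b, 1)) \<longleftrightarrow> 0 \<le> x (a, b)" if "(a, b) \<in> diag m" for a b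
    using that nb[of a b 1] by (simp add: local_rule_def diag_def)
  have e: "(max_nb ?r (Suc a) (Suc b) (Suc k) \<le> ?r (Suc a, Suc b, Suc k) \<and>
      ?r (Suc a, Suc b, Suc k) \<le> min_nb ?r (Suc a) (Suc b) k) \<longleftrightarrow>
      (max_nb p (Suc a) (Suc b) (Suc k) \<le> p (a, b, k) \<and> p (a, b, k) \<le> min_nb p (Suc a) (Suc b) k)"
    if "(a, b, k) \<in> level (m - 1)" for a b k
  proof -
    have "?r (Suc a, Suc b, Suc k) =
        max_nb p (Suc a) (Suc b) (Suc k) + min_nb p (Suc a) (Suc b) k - p (a, b, k)"
      using that by (auto simp: local_rule_def level_pred_iff)
    moreover have "max_nb ?r (Suc a) (Suc b) (Suc k) = max_nb p (Suc a) (Suc b) (Suc k)"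
      by (rule nb(1)) (use that in \<open>auto simp: level_pred_iff\<close>)
    moreover have "min_nb ?r (Suc a) (Suc b) k = min_nb p (Suc a) (Suc b) k"
      by (rule nb(2)) (use that in \<open>auto simp: level_pred_iff\<close>)
    ultimately show ?thesis by auto
  qed
  have "interlaced (Suc m) ?r \<longleftrightarrow> (\<forall>j\<in>level m. 0 \<le> p j) \<and>
     (\<forall>j\<in>level (Suc m). case j of (a, b, k) \<Rightarrow> max_nb ?r a b k \<le> ?r (a, b, k) \<and>
        (2 \<le> k \<longrightarrow> ?r (a, b, k) \<le> min_nb ?r a b (k - 1)))"
    unfolding interlaced_iff diff_Suc_1 using same by auto
  also have "\<dots> \<longleftrightarrow> (\<forall>j\<in>level m. 0 \<le> p j) \<and> (\<forall>(a, b)\<in>diag m. 0 \<le> x (a, b)) \<and>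
     (\<forall>(a, b, k)\<in>level (m - 1). max_nb p (Suc a) (Suc b) (Suc k) \<le> p (a, b, k) \<and>
        p (a, b, k) \<le> min_nb p (Suc a) (Suc b) k)"
  proof -
    have "(\<forall>(a, b)\<in>diag m. max_nb ?r a b 1 \<le> ?r (a, b, 1) \<and>
          (2 \<le> (1::nat) \<longrightarrow> ?r (a, b, 1) \<le> min_nb ?r a b (1 - 1))) \<longleftrightarrow>
        (\<forall>(a, b)\<in>diag m. 0 \<le> x (a, b))"
      using d by auto
    moreover have "(\<forall>(a, b, k)\<in>level (m - 1).
          max_nb ?r (Suc a) (Suc b) (Suc k) \<le> ?r (Suc a, Suc b, Suc k) \<and>
          (2 \<le> Suc k \<longrightarrow> ?r (Suc a, Suc b, Suc k) \<le> min_nb ?r (Suc a) (Suc b) (Suc k - 1))) \<longleftrightarrow>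
        (\<forall>(a, b, k)\<in>level (m - 1). max_nb p (Suc a) (Suc b) (Suc k) \<le> p (a, b, k) \<and>
          p (a, b, k) \<le> min_nb p (Suc a) (Suc b) k)"
    proof (rule ball_cong[OF refl])
      fix j assume "j \<in> level (m - 1)"
      then show "(case j of (a, b, k) \<Rightarrow> max_nb ?r (Suc a) (Suc b) (Suc k) \<le> ?r (Suc a, Suc b, Suc k) \<and>
          (2 \<le> Suc k \<longrightarrow> ?r (Suc a, Suc b, Suc k) \<le> min_nb ?r (Suc a) (Suc b) (Suc k - 1))) \<longleftrightarrow>
        (case j of (a, b, k) \<Rightarrow> max_nb p (Suc a) (Suc b) (Suc k) \<le> p (a, b, k) \<and>
          p (a, b, k) \<le> min_nb p (Suc a) (Suc b) k)"
        using e by (cases j) (auto simp: level_def)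
    qed
    ultimately show ?thesis unfolding split by (simp only: prod.case)
  qed
  finally show ?thesis unfolding interlaced_def by auto
qed

text \<open>The maximum and the minimum of two neighbours add up to their sum, and each entry of
  level \<open>m\<close> is once a left and once a lower neighbour. Summing the rule over the new
  level thus gives twice the sum over level \<open>m\<close>, less the reflected entries, plus the
  weights.\<close>

lemma energy_local_rule:
  assumes q: "\<And>j. j \<in> level m \<Longrightarrow> 0 \<le> p j"
  shows "energy (Suc m) (local_rule m p x) = energy m p + (\<Sum>d\<in>diag m. x d)"
proof -
  let ?r = "local_rule m p x"
  have 1: "(\<Sum>j\<in>level m. ?r j) = (\<Sum>j\<in>level m. p j)"
    by (rule sum.cong) (auto simp: local_rule_def level_def)
  have left: "(\<Sum>(a, b, k)\<in>level (Suc m). left_nb p a b k) = (\<Sum>j\<in>level m. p j)"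
  proof -
    have "(\<Sum>(a, b, k)\<in>level (Suc m). left_nb p a b k) =
        (\<Sum>(a, b, k)\<in>(\<lambda>(a, b, k). (Suc a, b, k)) ` level m. left_nb p a b k)"
    proof (rule sum.mono_neutral_right)
      have "left_nb p a b k = 0"
        if j: "(a, b, k) \<in> level (Suc m)" and n: "(a, b, k) \<notin> (\<lambda>(a, b, k). (Suc a, b, k)) ` level m" for a b k
      proof (cases a)
        case (Suc a')
        have "(a', b, k) \<notin> level m" using n Suc by force
        then show ?thesis using j Suc by (auto simp: left_nb_def level_def)
      qed (simp add: left_nb_def)
      then show "\<forall>j\<in>level (Suc m) - (\<lambda>(a, b, k). (Suc a, b, k)) ` level m. (case j of (a, b, k) \<Rightarrow> left_nb p a b k) = 0"
        by auto
    qed (rule finite_level, auto simp: level_def)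
    also have "\<dots> = (\<Sum>j\<in>level m. p j)"
      by (subst sum.reindex) (auto simp: inj_on_def left_nb_def level_def intro!: sum.cong)
    finally show ?thesis .
  qed
  have down: "(\<Sum>(a, b, k)\<in>level (Suc m). down_nb p a b k) = (\<Sum>j\<in>level m. p j)"
  proof -
    have "(\<Sum>(a, b, k)\<in>level (Suc m). down_nb p a b k) =
        (\<Sum>(a, b, k)\<in>(\<lambda>(a, b, k). (a, Suc b, k)) ` level m. down_nb p a b k)"
    proof (rule sum.mono_neutral_right)
      have "down_nb p a b k = 0"
        if j: "(a, b, k) \<in> level (Suc m)" and n: "(a, b, k) \<notin> (\<lambda>(a, b, k). (a, Suc b, k)) ` level m" for a b k
      proof (cases b)
        case (Suc b')
        have "(a, b', k) \<notin> level m" using n Suc by force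
        then show ?thesis using j Suc by (auto simp: down_nb_def level_def)
      qed (simp add: down_nb_def)
      then show "\<forall>j\<in>level (Suc m) - (\<lambda>(a, b, k). (a, Suc b, k)) ` level m. (case j of (a, b, k) \<Rightarrow> down_nb p a b k) = 0"
        by auto
    qed (rule finite_level, auto simp: level_def)
    also have "\<dots> = (\<Sum>j\<in>level m. p j)"
      by (subst sum.reindex) (auto simp: inj_on_def down_nb_def level_def intro!: sum.cong)
    finally show ?thesis .
  qed
  \<comment> \<open>The rule at \<open>k\<close> uses the minimum at \<open>k - 1\<close>. Nothing
    is lost in this shift: the other minima compare an absent neighbour, counted as 0, with a
    nonnegative value.\<close>
  have min: "(\<Sum>(a, b, k)\<in>level (Suc m). min_nb p a b k) =
      (\<Sum>(a, b, k)\<in>level (m - 1). min_nb p (Suc a) (Suc b) k)"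
  proof -
    have zero: "min_nb p a b k = 0"
      if j: "(a, b, k) \<in> level (Suc m)" and n: "(a, b, k) \<notin> (\<lambda>(a, b, k). (Suc a, Suc b, k)) ` level (m - 1)" for a b k
    proof -
      have nonneg: "0 \<le> left_nb p a b k" "0 \<le> down_nb p a b k"
        using q j by (auto simp: left_nb_def down_nb_def level_def split: nat.splits)
      have "left_nb p a b k = 0 \<or> down_nb p a b k = 0"
      proof (cases "\<exists>a' b'. a = Suc a' \<and> b = Suc b'")
        case True
        then obtain a' b' where s: "a = Suc a'" "b = Suc b'" by blast
        have "(a', b', k) \<notin> level (m - 1)" using n s by force
        then have "1 + min a' b' < k" using j s by (auto simp: level_def)
        then show ?thesis using s by (auto simp: left_nb_def down_nb_def)
      next
        case False
        then show ?thesis by (auto simp: left_nb_def down_nb_def split: nat.splits)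
      qed
      with nonneg show ?thesis by (auto simp: min_nb_def)
    qed
    have "(\<Sum>(a, b, k)\<in>level (Suc m). min_nb p a b k) =
        (\<Sum>(a, b, k)\<in>(\<lambda>(a, b, k). (Suc a, Suc b, k)) ` level (m - 1). min_nb p a b k)"
    proof (rule sum.mono_neutral_right)
      show "\<forall>j\<in>level (Suc m) - (\<lambda>(a, b, k). (Suc a, Suc b, k)) ` level (m - 1).
          (case j of (a, b, k) \<Rightarrow> min_nb p a b k) = 0"
        using zero by auto
    qed (rule finite_level, auto simp: level_def)
    also have "\<dots> = (\<Sum>(a, b, k)\<in>level (m - 1). min_nb p (Suc a) (Suc b) k)"
      by (subst sum.reindex) (auto simp: inj_on_def intro!: sum.cong)
    finally show ?thesis .
  qed
  have "(\<Sum>j\<in>level (Suc m). ?r j) = (\<Sum>(a, b)\<in>diag m. ?r (a, b, 1)) +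
      (\<Sum>(a, b, k)\<in>level (m - 1). ?r (Suc a, Suc b, Suc k))"
    by (rule sum_level_Suc)
  also have "(\<Sum>(a, b)\<in>diag m. ?r (a, b, 1)) =
      (\<Sum>d\<in>diag m. x d) + (\<Sum>(a, b)\<in>diag m. max_nb p a b 1)"
    unfolding sum.distrib[symmetric]
    by (rule sum.cong) (auto simp: local_rule_def diag_def)
  also have "(\<Sum>(a, b, k)\<in>level (m - 1). ?r (Suc a, Suc b, Suc k)) =
      (\<Sum>(a, b, k)\<in>level (m - 1). max_nb p (Suc a) (Suc b) (Suc k)) +
      (\<Sum>(a, b, k)\<in>level (m - 1). min_nb p (Suc a) (Suc b) k) - (\<Sum>j\<in>level (m - 1). p j)"
    unfolding sum.distrib[symmetric] sum_subtractf[symmetric]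
    by (rule sum.cong) (auto simp: local_rule_def level_pred_iff)
  also have "(\<Sum>d\<in>diag m. x d) + (\<Sum>(a, b)\<in>diag m. max_nb p a b 1) + \<dots> =
      (\<Sum>d\<in>diag m. x d) + ((\<Sum>(a, b, k)\<in>level (Suc m). max_nb p a b k) +
      (\<Sum>(a, b, k)\<in>level (Suc m). min_nb p a b k)) - (\<Sum>j\<in>level (m - 1). p j)"
    unfolding min using sum_level_Suc[of "\<lambda>(a, b, k). max_nb p a b k" m] by simp
  also have "(\<Sum>(a, b, k)\<in>level (Suc m). max_nb p a b k) +
      (\<Sum>(a, b, k)\<in>level (Suc m). min_nb p a b k) =
      (\<Sum>(a, b, k)\<in>level (Suc m). left_nb p a b k) + (\<Sum>(a, b, k)\<in>level (Suc m). down_nb p a b k)"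
    unfolding sum.distrib[symmetric]
    by (rule sum.cong) (auto simp: max_nb_def min_nb_def)
  finally show ?thesis unfolding energy_def diff_Suc_1 1 left down by simp
qed

lemma nb_corner:
  assumes "(a, b, k) \<in> Iset n"
  shows "min_nb p (Suc a) (Suc b) k = min (p (a, Suc b, k)) (p (Suc a, b, k))"
    "max_nb p (Suc a) (Suc b) (Suc k) =
      max (if (a, Suc b, Suc k) \<in> Iset (Suc n) then p (a, Suc b, Suc k) else 0)
        (if (Suc a, b, Suc k) \<in> Iset (Suc n) then p (Suc a, b, Suc k) else 0)"
    "(a, Suc b, k) \<in> Iset (Suc n)" "(Suc a, b, k) \<in> Iset (Suc n)"
proof -
  have j: "a + b = n" "1 \<le> k" "k \<le> 1 + min a b" using assms by (auto simp: Iset_def)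
  then have "k \<le> 1 + min a (Suc b)" "k \<le> 1 + min (Suc a) b" by auto
  then show "min_nb p (Suc a) (Suc b) k = min (p (a, Suc b, k)) (p (Suc a, b, k))"
    "(a, Suc b, k) \<in> Iset (Suc n)" "(Suc a, b, k) \<in> Iset (Suc n)"
    using j by (simp_all add: min_nb_def left_nb_def down_nb_def Iset_def)
  show "max_nb p (Suc a) (Suc b) (Suc k) =
      max (if (a, Suc b, Suc k) \<in> Iset (Suc n) then p (a, Suc b, Suc k) else 0)
        (if (Suc a, b, Suc k) \<in> Iset (Suc n) then p (Suc a, b, Suc k) else 0)"
    using j by (simp add: max_nb_def left_nb_def down_nb_def Iset_def)
qed

text \<open>An index absent from \<open>Iset (Suc n)\<close> contributes 0 to \<open>max_nb\<close>,
  where \<open>interlacing\<close> asks for nothing; the difference is absorbed by nonnegativity on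
  the lower level.\<close>

lemma interlacing_iff: "interlacing n p \<longleftrightarrow> interlaced (Suc (Suc n)) p"
proof
  assume I: "interlacing n p"
  have nonneg: "0 \<le> p j" if "j \<in> Iset n \<union> Iset (Suc n)" for j
    using I that by (simp add: interlacing_def)
  have "max_nb p (Suc a) (Suc b) (Suc k) \<le> p (a, b, k) \<and> p (a, b, k) \<le> min_nb p (Suc a) (Suc b) k"
    if j: "(a, b, k) \<in> Iset n" for a b k
  proof -
    have "p (a, b, k) \<le> p (Suc a, b, k)" "p (a, b, k) \<le> p (a, Suc b, k)"
      "(Suc a, b, Suc k) \<in> Iset (Suc n) \<longrightarrow> p (Suc a, b, Suc k) \<le> p (a, b, k)"
      "(a, Suc b, Suc k) \<in> Iset (Suc n) \<longrightarrow> p (a, Suc b, Suc k) \<le> p (a, b, k)"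
      using I j nb_corner(3,4)[OF j] unfolding interlacing_def Suc_eq_plus1 by blast+
    then show ?thesis using nonneg[of "(a, b, k)"] j by (simp add: nb_corner[OF j])
  qed
  then show "interlaced (Suc (Suc n)) p"
    using nonneg unfolding interlaced_def diff_Suc_1 level_Suc by blast
next
  assume L: "interlaced (Suc (Suc n)) p"
  have nonneg: "0 \<le> p j" if "j \<in> Iset n \<union> Iset (Suc n)" for j
  proof -
    have "\<forall>j\<in>Iset n. 0 \<le> p j"
      using L unfolding interlaced_iff diff_Suc_1 level_Suc by blast
    moreover have "\<forall>j\<in>Iset (Suc n). 0 \<le> p j"
      using L unfolding interlaced_def level_Suc by blast
    ultimately show ?thesis using that by blast
  qed
  have "p (a, b, k) \<le> p (Suc a, b, k) \<and> p (a, b, k) \<le> p (a, Suc b, k) \<and>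
      ((Suc a, b, Suc k) \<in> Iset (Suc n) \<longrightarrow> p (Suc a, b, Suc k) \<le> p (a, b, k)) \<and>
      ((a, Suc b, Suc k) \<in> Iset (Suc n) \<longrightarrow> p (a, Suc b, Suc k) \<le> p (a, b, k))"
    if j: "(a, b, k) \<in> Iset n" for a b k
  proof -
    have "max_nb p (Suc a) (Suc b) (Suc k) \<le> p (a, b, k)" "p (a, b, k) \<le> min_nb p (Suc a) (Suc b) k"
      using L j unfolding interlaced_def diff_Suc_1 level_Suc by blast+
    then show ?thesis by (simp add: nb_corner[OF j] split: if_splits)
  qed
  then show "interlacing n p"
    unfolding interlacing_def Suc_eq_plus1[symmetric] using nonneg by blast
qed

section \<open>The joint density\<close>

definition W_array :: "(int \<times> int \<Rightarrow> real) \<Rightarrow> nat \<times> nat \<times> nat \<Rightarrow> real" where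
  "W_array w = (\<lambda>(a, b, k). W k w (int a, int b))"

lemma W_array_nb:
  assumes "\<And>z. 0 \<le> w z"
  shows "left_nb (W_array w) (Suc a) b k = W k w (int a, int b)"
    "down_nb (W_array w) a (Suc b) k = W k w (int a, int b)"
  using W_eq_0[OF assms, of a b k] by (auto simp: left_nb_def down_nb_def W_array_def not_le)

text \<open>Agreement is assumed on two levels and one antidiagonal only, because \<open>p\<close>
  and \<open>x\<close> will be restricted functions.\<close>

lemma W_array_local_rule:
  assumes w: "\<And>z. 0 \<le> w z"
    and p: "\<And>j. j \<in> level (m - 1) \<union> level m \<Longrightarrow> p j = W_array w j"
    and x: "\<And>a b. (a, b) \<in> diag m \<Longrightarrow> x (a, b) = w (int a, int b)"
    and j: "j \<in> level m \<union> level (Suc m)"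
  shows "W_array w j = local_rule m p x j"
proof -
  obtain a b k where abk: "j = (a, b, k)" by (cases j)
  show ?thesis
  proof (cases "a + b + 1 = m")
    case True
    then have "j \<in> level m" using j abk by (auto simp: level_def)
    then show ?thesis using p[of j] True abk by (simp add: local_rule_def)
  next
    case False
    then have ab: "a + b = m" and k: "1 \<le> k" "k \<le> 1 + min a b" using j abk by (auto simp: level_def)
    have xab: "x (a, b) = w (int a, int b)" using ab by (intro x) (simp add: diag_def)
    have nb: "max_nb p a b l = max_nb (W_array w) a b l" "min_nb p a b l = min_nb (W_array w) a b l"
      if "1 \<le> l" for l
      using nb_cong[of m p "W_array w" a b l] p ab that by auto
    note [simp] = W_array_nb[of w, OF w]
    show ?thesis
    proof (cases "k = 1")
      case True
      \<comment> \<open>On an axis an absent neighbour counts as 0 and the other is nonnegative, so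
        the maximum is the genuine value; at the origin both are absent.\<close>
      have "W (Suc 0) w (int a, int b) = w (int a, int b) + max_nb (W_array w) a b 1"
      proof (cases a)
        case [simp]: 0
        show ?thesis
        proof (cases b)
          case 0
          then show ?thesis using W_first_axis(1)[of w] w by (simp add: max_nb_def left_nb_def down_nb_def)
        next
          case (Suc b')
          then show ?thesis using W_first_axis(3,5)[of w b'] w by (simp add: max_nb_def left_nb_def)
        qed
      next
        case [simp]: (Suc a')
        show ?thesis
        proof (cases b)
          case 0
          then show ?thesis using W_first_axis(2,4)[of w a'] w by (simp add: max_nb_def down_nb_def)
        next
          case (Suc b')
          then show ?thesis using W_first_corner[of w a' b'] w by (simp add: max_nb_def)
        qed
      qed
      then show ?thesis using True ab abk nb[of 1] xab
        by (simp add: local_rule_def W_array_def)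
    next
      case False
      with k obtain a' b' k' where s: "a = Suc a'" "b = Suc b'" "k = Suc (Suc k')"
        by (cases a; cases b; cases k; cases "k - 1") auto
      have "(a', b', Suc k') \<in> level (m - 1)" using s k ab by (auto simp: level_def)
      then have "p (a', b', Suc k') = W (Suc k') w (int a', int b')"
        using p by (simp add: W_array_def)
      moreover have "k' \<le> min a' b'" using s k by auto
      moreover have "W_array w j = W (Suc (Suc k')) w (int (Suc a'), int (Suc b'))"
        by (simp add: abk s W_array_def)
      moreover have "max_nb p a b k = max (W k w (int a', int (Suc b'))) (W k w (int (Suc a'), int b'))"
        using nb(1)[of k] k s by (simp add: max_nb_def)
      moreover have "min_nb p a b (Suc k') =
          min (W (Suc k') w (int a', int (Suc b'))) (W (Suc k') w (int (Suc a'), int b'))"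
        using nb(2)[of "Suc k'"] s by (simp add: min_nb_def)
      moreover have "local_rule m p x j = max_nb p a b k + min_nb p a b (Suc k') - p (a', b', Suc k')"
        using ab abk s by (auto simp: local_rule_def)
      ultimately show ?thesis using W_Suc_corner[where w = w, OF w, of k' a' b'] s by simp
    qed
  qed
qed

section \<open>Invariance of Lebesgue measure under the local rule\<close>

abbreviation (input) lebesgue_on_index :: "'i set \<Rightarrow> ('i \<Rightarrow> real) measure" ("\<Lambda>") where
  "\<Lambda> I \<equiv> PiM I (\<lambda>_. lborel)"

lemma indicator_PiE:
  assumes "finite I" "f \<in> extensional I"
  shows "indicator (PiE I E) f = (\<Prod>i\<in>I. indicator (E i) (f i) :: ennreal)"
proof (cases "f \<in> PiE I E")
  case True
  then have "(\<Prod>i\<in>I. indicator (E i) (f i) :: ennreal) = 1"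
    by (intro prod.neutral) (auto simp: PiE_iff)
  with True show ?thesis by simp
next
  case False
  then obtain i where "i \<in> I" "f i \<notin> E i" using assms(2) by (auto simp: PiE_iff)
  then have "(\<Prod>i\<in>I. indicator (E i) (f i) :: ennreal) = 0"
    using assms(1) by (intro prod_zero bexI[of _ i]) auto
  with False show ?thesis by simp
qed

lemma nn_integral_indicator_shift:
  assumes [measurable]: "A \<in> sets borel"
  shows "(\<integral>\<^sup>+t. indicator A (t + c) \<partial>lborel) = emeasure lborel A"
    "(\<integral>\<^sup>+t. indicator A (c - t) \<partial>lborel) = emeasure lborel (A :: real set)"
proof -
  have "(\<integral>\<^sup>+t. indicator A t \<partial>lborel) = ennreal \<bar>1\<bar> * (\<integral>\<^sup>+t. indicator A (c + 1 * t) \<partial>lborel)"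
    by (rule nn_integral_real_affine) auto
  then show "(\<integral>\<^sup>+t. indicator A (t + c) \<partial>lborel) = emeasure lborel A" by (simp add: add.commute)
  have "(\<integral>\<^sup>+t. indicator A t \<partial>lborel) = ennreal \<bar>- 1\<bar> * (\<integral>\<^sup>+t. indicator A (c + -1 * t) \<partial>lborel)"
    by (rule nn_integral_real_affine) auto
  then show "(\<integral>\<^sup>+t. indicator A (c - t) \<partial>lborel) = emeasure lborel A" by simp
qed

lemma product_sigma_finite_lborel: "product_sigma_finite (\<lambda>_. lborel :: real measure)" ..

lemma measurable_component: "j \<in> I \<Longrightarrow> (\<lambda>p. p j) \<in> borel_measurable (\<Lambda> I)"
  using measurable_component_singleton[of j I "\<lambda>_. lborel"] by simp

lemma measurable_indicator_comp:
  assumes "f \<in> borel_measurable N" "A \<in> sets borel"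
  shows "(\<lambda>x. indicator A (f x) :: ennreal) \<in> borel_measurable N"
  using assms by measurable

lemma measurable_nb:
  assumes "level m \<subseteq> I" "a + b = m" "1 \<le> k"
  shows "(\<lambda>p. max_nb p a b k) \<in> borel_measurable (\<Lambda> I)"
    "(\<lambda>p. min_nb p a b k) \<in> borel_measurable (\<Lambda> I)"
proof -
  have "(\<lambda>p. left_nb p a b k) \<in> borel_measurable (\<Lambda> I)"
  proof (cases "\<exists>a'. a = Suc a' \<and> k \<le> 1 + min a' b")
    case True
    then obtain a' where a': "a = Suc a'" "k \<le> 1 + min a' b" by blast
    then have "(a', b, k) \<in> I" using assms by (auto simp: level_def)
    then show ?thesis using a' by (simp add: left_nb_def measurable_component)
  next
    case False
    then have "(\<lambda>p. left_nb p a b k) = (\<lambda>_. 0)" by (auto simp: left_nb_def split: nat.splits)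
    then show ?thesis by simp
  qed
  moreover have "(\<lambda>p. down_nb p a b k) \<in> borel_measurable (\<Lambda> I)"
  proof (cases "\<exists>b'. b = Suc b' \<and> k \<le> 1 + min a b'")
    case True
    then obtain b' where b': "b = Suc b'" "k \<le> 1 + min a b'" by blast
    then have "(a, b', k) \<in> I" using assms by (auto simp: level_def)
    then show ?thesis using b' by (simp add: down_nb_def measurable_component)
  next
    case False
    then have "(\<lambda>p. down_nb p a b k) = (\<lambda>_. 0)" by (auto simp: down_nb_def split: nat.splits)
    then show ?thesis by simp
  qed
  ultimately show "(\<lambda>p. max_nb p a b k) \<in> borel_measurable (\<Lambda> I)"
    "(\<lambda>p. min_nb p a b k) \<in> borel_measurable (\<Lambda> I)"
    unfolding max_nb_def min_nb_def by (auto intro: borel_measurable_max borel_measurable_min)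
qed

definition update_levels ::
    "nat \<Rightarrow> (nat \<times> nat \<times> nat \<Rightarrow> real) \<times> (nat \<times> nat \<Rightarrow> real) \<Rightarrow> nat \<times> nat \<times> nat \<Rightarrow> real" where
  "update_levels m = (\<lambda>(p, x). restrict (local_rule m p x) (level m \<union> level (Suc m)))"

lemma measurable_update_levels:
  "update_levels m \<in> \<Lambda> (level (m - 1) \<union> level m) \<Otimes>\<^sub>M \<Lambda> (diag m) \<rightarrow>\<^sub>M \<Lambda> (level m \<union> level (Suc m))"
  unfolding update_levels_def case_prod_beta
proof (rule measurable_restrict)
  let ?N = "\<Lambda> (level (m - 1) \<union> level m) \<Otimes>\<^sub>M \<Lambda> (diag m)"
  fix j assume j: "j \<in> level m \<union> level (Suc m)"
  obtain a b k where abk: "j = (a, b, k)" by (cases j)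
  have comp: "(\<lambda>y. fst y i) \<in> borel_measurable ?N" if "i \<in> level (m - 1) \<union> level m" for i
    using measurable_compose[OF measurable_fst measurable_component[OF that]] .
  have "(\<lambda>y. local_rule m (fst y) (snd y) j) \<in> borel_measurable ?N"
  proof (cases "a + b + 1 = m")
    case True
    then have "j \<in> level m" using j abk by (auto simp: level_def)
    then show ?thesis using comp[of j] True abk by (simp add: local_rule_def)
  next
    case False
    then have ab: "a + b = m" and k: "1 \<le> k" "k \<le> 1 + min a b" using j abk by (auto simp: level_def)
    have nb: "(\<lambda>y. max_nb (fst y) a b l) \<in> borel_measurable ?N"
      "(\<lambda>y. min_nb (fst y) a b l) \<in> borel_measurable ?N" if "1 \<le> l" for l
      by (rule measurable_compose[OF measurable_fst measurable_nb(1)[OF _ ab that]], blast)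
         (rule measurable_compose[OF measurable_fst measurable_nb(2)[OF _ ab that]], blast)
    show ?thesis
    proof (cases "k = 1")
      case True
      have "(\<lambda>y. snd y (a, b)) \<in> borel_measurable ?N"
        using ab by (intro measurable_compose[OF measurable_snd measurable_component]) (simp add: diag_def)
      then show ?thesis using True False nb(1)[of 1] abk
        by (simp add: local_rule_def)
    next
      case False
      then have "(a - 1, b - 1, k - 1) \<in> level (m - 1) \<union> level m"
        using ab k by (auto simp: level_def)
      from comp[OF this] show ?thesis using False \<open>a + b + 1 \<noteq> m\<close> nb(1)[of k] nb(2)[of "k - 1"] k abk
        by (simp add: local_rule_def)
    qed
  qed
  then show "(\<lambda>y. local_rule m (fst y) (snd y) j) \<in> ?N \<rightarrow>\<^sub>M lborel" by simp
qed

text \<open>For fixed values on level \<open>m\<close> the local rule is a translation or a reflection in every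
  coordinate, hence preserves Lebesgue measure.\<close>
lemma distr_update_levels:
  "distr (\<Lambda> (level (m - 1) \<union> level m) \<Otimes>\<^sub>M \<Lambda> (diag m)) (\<Lambda> (level m \<union> level (Suc m))) (update_levels m) =
    \<Lambda> (level m \<union> level (Suc m))"
proof (rule product_sigma_finite.PiM_eqI[OF product_sigma_finite_lborel])
  let ?A = "level (m - 1)" and ?B = "level m" and ?C = "level (Suc m)" and ?D = "diag m"
  let ?N = "\<Lambda> (?A \<union> ?B) \<Otimes>\<^sub>M \<Lambda> ?D"
  interpret P: product_sigma_finite "\<lambda>_ :: nat \<times> nat \<times> nat. lborel :: real measure" ..
  interpret Q: product_sigma_finite "\<lambda>_ :: nat \<times> nat. lborel :: real measure" ..
  interpret D: sigma_finite_measure "\<Lambda> ?D" by (rule Q.sigma_finite) simp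
  fix E :: "nat \<times> nat \<times> nat \<Rightarrow> real set"
  assume E: "\<And>j. j \<in> ?B \<union> ?C \<Longrightarrow> E j \<in> sets lborel"
  have E': "E j \<in> sets borel" if "j \<in> ?B \<union> ?C" for j using E[OF that] by simp
  let ?v = "\<lambda>j. emeasure lborel (E j)"
  \<comment> \<open>The indicator of a box factors by type of coordinate: \<beta> for the copied
    level, \<delta> for the translated entries, \<alpha> for the reflected ones. In \<alpha> the
    first argument supplies the neighbours on level \<open>m\<close>, the second the entries to be
    reflected.\<close>
  define s where "s q a b k = max_nb q (Suc a) (Suc b) (Suc k) + min_nb q (Suc a) (Suc b) k" for q a b k
  define \<beta> where "\<beta> q = (\<Prod>j\<in>?B. indicator (E j) (q j) :: ennreal)" for q :: "nat \<times> nat \<times> nat \<Rightarrow> real"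
  define \<alpha> where "\<alpha> q p = (\<Prod>(a, b, k)\<in>?A. indicator (E (Suc a, Suc b, Suc k)) (s q a b k - p (a, b, k)) :: ennreal)"
    for q p
  define \<delta> where "\<delta> q x = (\<Prod>(a, b)\<in>?D. indicator (E (a, b, 1)) (x (a, b) + max_nb q a b 1) :: ennreal)" for q x
  have PE: "PiE (?B \<union> ?C) E \<in> sets (\<Lambda> (?B \<union> ?C))" using E by (intro sets_PiM_I_finite) auto
  have CA: "(Suc a, Suc b, Suc k) \<in> ?C" if "(a, b, k) \<in> ?A" for a b k using that by (auto simp: level_def)
  have CD: "(a, b, 1) \<in> ?C" if "(a, b) \<in> ?D" for a b using that by (auto simp: level_def diag_def)
  have ind: "indicator (PiE (?B \<union> ?C) E) (update_levels m (p, x)) = \<beta> p * (\<delta> p x * \<alpha> p p)" for p x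
  proof -
    have "indicator (PiE (?B \<union> ?C) E) (update_levels m (p, x)) =
        (\<Prod>j\<in>?B \<union> ?C. indicator (E j) (local_rule m p x j) :: ennreal)"
      by (subst indicator_PiE) (auto simp: update_levels_def intro!: prod.cong)
    also have "\<dots> = (\<Prod>j\<in>?B. indicator (E j) (local_rule m p x j)) * (\<Prod>j\<in>?C. indicator (E j) (local_rule m p x j))"
      by (rule prod.union_disjoint) (simp_all add: level_disjoint)
    also have "(\<Prod>j\<in>?B. indicator (E j) (local_rule m p x j)) = \<beta> p"
      unfolding \<beta>_def by (rule prod.cong) (auto simp: local_rule_def level_def)
    also have "(\<Prod>j\<in>?C. indicator (E j) (local_rule m p x j)) = \<delta> p x * \<alpha> p p"
      unfolding prod_level_Suc \<delta>_def \<alpha>_def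
      by (intro arg_cong2[where f = "(*)"] prod.cong)
         (auto simp: local_rule_def diag_def s_def level_pred_iff)
    finally show ?thesis .
  qed
  have intD: "(\<integral>\<^sup>+x. \<delta> q x \<partial>\<Lambda> ?D) = (\<Prod>(a, b)\<in>?D. ?v (a, b, 1))" for q
  proof -
    have "(\<integral>\<^sup>+x. \<delta> q x \<partial>\<Lambda> ?D) =
        (\<integral>\<^sup>+x. (\<Prod>d\<in>?D. indicator (E (fst d, snd d, 1)) (x d + max_nb q (fst d) (snd d) 1)) \<partial>\<Lambda> ?D)"
      by (simp add: \<delta>_def case_prod_unfold)
    also have "\<dots> = (\<Prod>d\<in>?D. \<integral>\<^sup>+t. indicator (E (fst d, snd d, 1)) (t + max_nb q (fst d) (snd d) 1) \<partial>lborel)"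
      using E' CD by (intro Q.product_nn_integral_prod) auto
    also have "\<dots> = (\<Prod>(a, b)\<in>?D. ?v (a, b, 1))"
      using E' CD by (intro prod.cong) (auto intro!: nn_integral_indicator_shift)
    finally show ?thesis .
  qed
  have intA: "(\<integral>\<^sup>+p. \<alpha> q p \<partial>\<Lambda> ?A) = (\<Prod>(a, b, k)\<in>?A. ?v (Suc a, Suc b, Suc k))" for q
  proof -
    have "(\<integral>\<^sup>+p. \<alpha> q p \<partial>\<Lambda> ?A) =
        (\<integral>\<^sup>+p. (\<Prod>j\<in>?A. (\<lambda>t. case j of (a, b, k) \<Rightarrow> indicator (E (Suc a, Suc b, Suc k)) (s q a b k - t)) (p j)) \<partial>\<Lambda> ?A)"
      by (simp add: \<alpha>_def case_prod_unfold)
    also have "\<dots> = (\<Prod>j\<in>?A. \<integral>\<^sup>+t. (case j of (a, b, k) \<Rightarrow> indicator (E (Suc a, Suc b, Suc k)) (s q a b k - t)) \<partial>lborel)"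
      using E' CA by (intro P.product_nn_integral_prod) auto
    also have "\<dots> = (\<Prod>(a, b, k)\<in>?A. ?v (Suc a, Suc b, Suc k))"
      using E' CA by (intro prod.cong) (auto intro!: nn_integral_indicator_shift)
    finally show ?thesis .
  qed
  have intB: "(\<integral>\<^sup>+q. \<beta> q \<partial>\<Lambda> ?B) = (\<Prod>j\<in>?B. ?v j)"
    unfolding \<beta>_def using E' by (subst P.product_nn_integral_prod) auto
  \<comment> \<open>The weights are integrated out first: given the levels, the translated entries
    contribute a constant.\<close>
  let ?G = "\<lambda>p. \<beta> p * (\<Prod>(a, b)\<in>?D. ?v (a, b, 1)) * \<alpha> p p"
  have Gmeas: "?G \<in> borel_measurable (\<Lambda> (?B \<union> ?A))"
  proof -
    have "\<beta> \<in> borel_measurable (\<Lambda> (?B \<union> ?A))"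
      unfolding \<beta>_def using E' by (intro borel_measurable_prod_ennreal measurable_indicator_comp measurable_component) auto
    moreover have "(\<lambda>p. \<alpha> p p) \<in> borel_measurable (\<Lambda> (?B \<union> ?A))"
      unfolding \<alpha>_def case_prod_unfold
    proof (rule borel_measurable_prod_ennreal)
      fix j assume j: "j \<in> ?A"
      obtain a b k where abk: "j = (a, b, k)" by (cases j)
      have "(\<lambda>p. s p a b k - p (a, b, k)) \<in> borel_measurable (\<Lambda> (?B \<union> ?A))"
        unfolding s_def using j abk
        by (intro borel_measurable_diff borel_measurable_add measurable_nb[of m] measurable_component)
           (auto simp: level_pred_iff)
      then show "(\<lambda>p. indicator (E (Suc (fst j), Suc (fst (snd j)), Suc (snd (snd j))))
          (s p (fst j) (fst (snd j)) (snd (snd j)) - p (fst j, fst (snd j), snd (snd j))) :: ennreal)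
          \<in> borel_measurable (\<Lambda> (?B \<union> ?A))"
        using E'[of "(Suc a, Suc b, Suc k)"] CA[of a b k] j abk
        by (simp add: measurable_indicator_comp)
    qed
    ultimately show ?thesis by (intro borel_measurable_times_ennreal) auto
  qed
  have "emeasure (distr ?N (\<Lambda> (?B \<union> ?C)) (update_levels m)) (PiE (?B \<union> ?C) E) =
      (\<integral>\<^sup>+y. indicator (PiE (?B \<union> ?C) E) (update_levels m y) \<partial>?N)"
    using measurable_update_levels PE
    by (subst nn_integral_indicator[symmetric], simp, subst nn_integral_distr) auto
  also have "\<dots> = (\<integral>\<^sup>+p. \<integral>\<^sup>+x. indicator (PiE (?B \<union> ?C) E) (update_levels m (p, x)) \<partial>\<Lambda> ?D \<partial>\<Lambda> (?A \<union> ?B))"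
    using measurable_update_levels PE
    by (subst D.nn_integral_fst) (auto intro!: measurable_compose[OF measurable_update_levels])
  also have "\<dots> = (\<integral>\<^sup>+p. ?G p \<partial>\<Lambda> (?A \<union> ?B))"
  proof (rule nn_integral_cong)
    fix p
    have "(\<integral>\<^sup>+x. indicator (PiE (?B \<union> ?C) E) (update_levels m (p, x)) \<partial>\<Lambda> ?D) =
        (\<integral>\<^sup>+x. (\<beta> p * \<alpha> p p) * \<delta> p x \<partial>\<Lambda> ?D)"
      by (simp add: ind mult_ac)
    also have "\<dots> = (\<beta> p * \<alpha> p p) * (\<integral>\<^sup>+x. \<delta> p x \<partial>\<Lambda> ?D)"
    proof (rule nn_integral_cmult)
      show "\<delta> p \<in> borel_measurable (\<Lambda> ?D)"
        unfolding \<delta>_def case_prod_unfold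
      proof (rule borel_measurable_prod_ennreal)
        fix d assume d: "d \<in> ?D"
        have "(\<lambda>x. x (fst d, snd d) + max_nb p (fst d) (snd d) 1) \<in> borel_measurable (\<Lambda> ?D)"
          using d by (intro borel_measurable_add measurable_component) auto
        then show "(\<lambda>x. indicator (E (fst d, snd d, 1)) (x (fst d, snd d) + max_nb p (fst d) (snd d) 1) :: ennreal)
            \<in> borel_measurable (\<Lambda> ?D)"
          using E' CD[of "fst d" "snd d"] d by (intro measurable_indicator_comp) auto
      qed
    qed
    finally show "(\<integral>\<^sup>+x. indicator (PiE (?B \<union> ?C) E) (update_levels m (p, x)) \<partial>\<Lambda> ?D) = ?G p"
      by (simp add: intD mult_ac)
  qed
  \<comment> \<open>Level \<open>m\<close> becomes the outer variable: the centres of the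
    reflections depend on it, but not on level \<open>m - 1\<close>.\<close>
  also have "\<dots> = (\<integral>\<^sup>+q. \<integral>\<^sup>+p. ?G (merge ?B ?A (q, p)) \<partial>\<Lambda> ?A \<partial>\<Lambda> ?B)"
    using Gmeas level_pred_disjoint[of m]
    by (subst Un_commute, intro P.product_nn_integral_fold) auto
  also have "\<dots> = (\<integral>\<^sup>+q. \<beta> q * ((\<Prod>(a, b)\<in>?D. ?v (a, b, 1)) * (\<Prod>(a, b, k)\<in>?A. ?v (Suc a, Suc b, Suc k))) \<partial>\<Lambda> ?B)"
  proof (rule nn_integral_cong)
    fix q
    have "?G (merge ?B ?A (q, p)) = (\<beta> q * (\<Prod>(a, b)\<in>?D. ?v (a, b, 1))) * \<alpha> q p" for p
    proof -
      have B: "merge ?B ?A (q, p) j = q j" if "j \<in> ?B" for j using that by (simp add: merge_def)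
      have A: "merge ?B ?A (q, p) j = p j" if "j \<in> ?A" for j
        using that level_pred_disjoint[of m] by (auto simp: merge_def)
      have "\<beta> (merge ?B ?A (q, p)) = \<beta> q" unfolding \<beta>_def by (rule prod.cong[OF refl]) (simp only: B)
      moreover have "\<alpha> (merge ?B ?A (q, p)) (merge ?B ?A (q, p)) = \<alpha> q p"
        unfolding \<alpha>_def
      proof (intro prod.cong refl, clarify)
        fix a b k assume j: "(a, b, k) \<in> ?A"
        then have "Suc a + Suc b = m" "1 \<le> k" by (auto simp: level_pred_iff)
        then have "s (merge ?B ?A (q, p)) a b k = s q a b k"
          unfolding s_def using nb_cong[of m "merge ?B ?A (q, p)" q "Suc a" "Suc b"] B by simp
        then show "indicator (E (Suc a, Suc b, Suc k)) (s (merge ?B ?A (q, p)) a b k - merge ?B ?A (q, p) (a, b, k)) =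
            (indicator (E (Suc a, Suc b, Suc k)) (s q a b k - p (a, b, k)) :: ennreal)"
          using A[OF j] by simp
      qed
      ultimately show ?thesis by simp
    qed
    then have "(\<integral>\<^sup>+p. ?G (merge ?B ?A (q, p)) \<partial>\<Lambda> ?A) =
        (\<integral>\<^sup>+p. (\<beta> q * (\<Prod>(a, b)\<in>?D. ?v (a, b, 1))) * \<alpha> q p \<partial>\<Lambda> ?A)" by simp
    also have "\<dots> = (\<beta> q * (\<Prod>(a, b)\<in>?D. ?v (a, b, 1))) * (\<integral>\<^sup>+p. \<alpha> q p \<partial>\<Lambda> ?A)"
    proof (rule nn_integral_cmult)
      show "\<alpha> q \<in> borel_measurable (\<Lambda> ?A)"
        unfolding \<alpha>_def case_prod_unfold
      proof (rule borel_measurable_prod_ennreal)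
        fix j assume j: "j \<in> ?A"
        have "(\<lambda>p. s q (fst j) (fst (snd j)) (snd (snd j)) - p (fst j, fst (snd j), snd (snd j))) \<in> borel_measurable (\<Lambda> ?A)"
          using j by (intro borel_measurable_diff measurable_component) auto
        then show "(\<lambda>p. indicator (E (Suc (fst j), Suc (fst (snd j)), Suc (snd (snd j))))
          (s q (fst j) (fst (snd j)) (snd (snd j)) - p (fst j, fst (snd j), snd (snd j))) :: ennreal)
            \<in> borel_measurable (\<Lambda> ?A)"
          using E' CA[of "fst j" "fst (snd j)" "snd (snd j)"] j
          by (intro measurable_indicator_comp) auto
      qed
    qed
    also have "\<dots> = \<beta> q * ((\<Prod>(a, b)\<in>?D. ?v (a, b, 1)) * (\<Prod>(a, b, k)\<in>?A. ?v (Suc a, Suc b, Suc k)))"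
      by (simp only: intA mult.assoc)
    finally show "(\<integral>\<^sup>+p. ?G (merge ?B ?A (q, p)) \<partial>\<Lambda> ?A) = \<dots>" .
  qed
  also have "\<dots> = (\<integral>\<^sup>+q. \<beta> q \<partial>\<Lambda> ?B) * ((\<Prod>(a, b)\<in>?D. ?v (a, b, 1)) * (\<Prod>(a, b, k)\<in>?A. ?v (Suc a, Suc b, Suc k)))"
    unfolding \<beta>_def using E'
    by (intro nn_integral_multc borel_measurable_prod_ennreal measurable_indicator_comp measurable_component) auto
  also have "\<dots> = (\<Prod>j\<in>?B. ?v j) * (\<Prod>j\<in>?C. ?v j)"
    by (simp only: intB prod_level_Suc)
  also have "\<dots> = (\<Prod>j\<in>?B \<union> ?C. ?v j)"
    by (rule prod.union_disjoint[symmetric]) (simp_all add: level_disjoint)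
  finally show "emeasure (distr ?N (\<Lambda> (?B \<union> ?C)) (update_levels m)) (PiE (?B \<union> ?C) E) = (\<Prod>j\<in>?B \<union> ?C. ?v j)" .
qed simp_all

section \<open>Transport of the density\<close>

definition levels_density :: "nat \<Rightarrow> (nat \<times> nat \<times> nat \<Rightarrow> real) \<Rightarrow> ennreal" where
  "levels_density m p = (if interlaced m p then ennreal (exp (- energy m p)) else 0)"

lemma levels_density_cong:
  assumes "\<And>j. j \<in> level (m - 1) \<union> level m \<Longrightarrow> p j = q j"
  shows "levels_density m p = levels_density m q"
proof -
  have nb: "max_nb p (Suc a) (Suc b) (Suc k) = max_nb q (Suc a) (Suc b) (Suc k)"
    "min_nb p (Suc a) (Suc b) k = min_nb q (Suc a) (Suc b) k" if "(a, b, k) \<in> level (m - 1)" for a b k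
    using that assms nb_cong[of m p q "Suc a" "Suc b"] by (auto simp: level_pred_iff)
  have "(case j of (a, b, k) \<Rightarrow> max_nb p (Suc a) (Suc b) (Suc k) \<le> p (a, b, k) \<and>
        p (a, b, k) \<le> min_nb p (Suc a) (Suc b) k) \<longleftrightarrow>
      (case j of (a, b, k) \<Rightarrow> max_nb q (Suc a) (Suc b) (Suc k) \<le> q (a, b, k) \<and>
        q (a, b, k) \<le> min_nb q (Suc a) (Suc b) k)" if "j \<in> level (m - 1)" for j
    using that nb assms[of j] by (cases j) simp
  then have "interlaced m p \<longleftrightarrow> interlaced m q"
    unfolding interlaced_def using assms by (auto cong: ball_cong)
  moreover have "energy m p = energy m q"
    unfolding energy_def using assms by (auto intro!: arg_cong2[where f = minus] sum.cong)
  ultimately show ?thesis by (simp add: levels_density_def)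
qed

lemma measurable_levels_density:
  "levels_density m \<in> borel_measurable (\<Lambda> (level (m - 1) \<union> level m))" (is "_ \<in> borel_measurable ?L")
proof -
  have comp: "(\<lambda>p. p j) \<in> borel_measurable ?L" if "j \<in> level (m - 1) \<union> level m" for j
    using that by (rule measurable_component)
  have "{p \<in> space ?L. interlaced m p} \<in> sets ?L"
    unfolding interlaced_def
  proof (intro sets.sets_Collect_conj sets.sets_Collect_finite_All finite_level)
    show "{p \<in> space ?L. 0 \<le> p j} \<in> sets ?L" if "j \<in> level m" for j
      using that by (intro borel_measurable_le comp borel_measurable_const) auto
    fix j assume j: "j \<in> level (m - 1)"
    obtain a b k where abk: "j = (a, b, k)" by (cases j)
    have ab: "Suc a + Suc b = m" "1 \<le> Suc k" "1 \<le> k" using j abk by (auto simp: level_pred_iff)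
    have "(\<lambda>p. max_nb p (Suc a) (Suc b) (Suc k)) \<in> borel_measurable ?L"
      "(\<lambda>p. min_nb p (Suc a) (Suc b) k) \<in> borel_measurable ?L"
      by (rule measurable_nb[OF _ ab(1,2)], blast) (rule measurable_nb[OF _ ab(1,3)], blast)
    moreover have "(\<lambda>p. p (a, b, k)) \<in> borel_measurable ?L" using j abk by (intro comp) auto
    ultimately have "{p \<in> space ?L. max_nb p (Suc a) (Suc b) (Suc k) \<le> p (a, b, k) \<and>
        p (a, b, k) \<le> min_nb p (Suc a) (Suc b) k} \<in> sets ?L"
      by (intro sets.sets_Collect_conj borel_measurable_le)
    then show "{p \<in> space ?L. case j of (a, b, k) \<Rightarrow> max_nb p (Suc a) (Suc b) (Suc k) \<le> p (a, b, k) \<and>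
        p (a, b, k) \<le> min_nb p (Suc a) (Suc b) k} \<in> sets ?L"
      by (simp add: abk)
  qed
  moreover have "(\<lambda>p. ennreal (exp (- energy m p))) \<in> borel_measurable ?L"
    unfolding energy_def
    by (intro measurable_compose[OF _ measurable_ennreal] borel_measurable_exp borel_measurable_uminus
        borel_measurable_diff borel_measurable_sum comp) auto
  ultimately show ?thesis
    unfolding levels_density_def by (intro measurable_If) auto
qed

text \<open>Interlacing and energy are transported separately, and the sum of weights in the energy
  becomes the product of exponential densities. A negative weight makes both sides vanish, the left
  one by failure of interlacing.\<close>

lemma levels_density_update_levels:
  "levels_density (Suc m) (update_levels m (p, x)) =
    levels_density m p * (\<Prod>d\<in>diag m. ennreal (exponential_density 1 (x d)))"
proof -
  have "levels_density (Suc m) (update_levels m (p, x)) = levels_density (Suc m) (local_rule m p x)"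
    by (rule levels_density_cong) (simp add: update_levels_def)
  also have "\<dots> = levels_density m p * (\<Prod>d\<in>diag m. ennreal (exponential_density 1 (x d)))"
  proof (cases "\<forall>d\<in>diag m. 0 \<le> x d")
    case True
    then have "(\<Prod>d\<in>diag m. ennreal (exponential_density 1 (x d))) = (\<Prod>d\<in>diag m. ennreal (exp (- x d)))"
      by (intro prod.cong) (auto simp: exponential_density_def)
    also have "\<dots> = ennreal (\<Prod>d\<in>diag m. exp (- x d))" by (simp add: prod_ennreal)
    also have "(\<Prod>d\<in>diag m. exp (- x d)) = exp (- (\<Sum>d\<in>diag m. x d))"
      by (simp add: exp_sum sum_negf[symmetric])
    finally have "(\<Prod>d\<in>diag m. ennreal (exponential_density 1 (x d))) = ennreal (exp (- (\<Sum>d\<in>diag m. x d)))" .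
    moreover have "energy (Suc m) (local_rule m p x) = energy m p + (\<Sum>d\<in>diag m. x d)" if "interlaced m p"
      using that by (intro energy_local_rule) (simp add: interlaced_def)
    ultimately show ?thesis
      using True by (simp add: levels_density_def interlaced_local_rule mult_exp_exp flip: ennreal_mult)
  next
    case False
    then obtain d where "d \<in> diag m" "x d < 0" by auto
    then have "(\<Prod>d\<in>diag m. ennreal (exponential_density 1 (x d))) = 0"
      by (intro prod_zero finite_diag bexI[of _ d]) (auto simp: exponential_density_def)
    with False show ?thesis by (auto simp: levels_density_def interlaced_local_rule)
  qed
  finally show ?thesis .
qed

lemma measurable_LPP:
  assumes "\<And>z. z \<in> rect u v \<Longrightarrow> (\<lambda>\<omega>. F \<omega> z) \<in> borel_measurable N"
  shows "(\<lambda>\<omega>. LPP k (F \<omega>) u v) \<in> borel_measurable N"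
  unfolding LPP_eq_Max
proof (rule borel_measurable_Max[OF finite_path_families])
  fix \<gamma>s assume "\<gamma>s \<in> path_families k u v"
  then have f: "feasible k u v \<gamma>s" by (simp add: path_families_def)
  show "(\<lambda>\<omega>. \<Sum>i<k. passage_time (F \<omega>) (\<gamma>s i)) \<in> borel_measurable N"
    unfolding sum_passage_time[OF f]
    using f by (intro borel_measurable_sum assms) (auto simp: feasible_def)
qed

lemma measurable_W_array:
  assumes "\<And>a b. a + b < m \<Longrightarrow> (\<lambda>\<omega>. F \<omega> (int a, int b)) \<in> borel_measurable N"
  shows "(\<lambda>\<omega>. restrict (W_array (F \<omega>)) (level (m - 1) \<union> level m)) \<in> N \<rightarrow>\<^sub>M \<Lambda> (level (m - 1) \<union> level m)"
proof (rule measurable_restrict)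
  fix j assume j: "j \<in> level (m - 1) \<union> level m"
  obtain a b k where abk: "j = (a, b, k)" by (cases j)
  have "(\<lambda>\<omega>. F \<omega> z) \<in> borel_measurable N" if "z \<in> rect (0, 0) (int a, int b)" for z
  proof -
    have "nat (fst z) + nat (snd z) < m" using that j abk by (auto simp: rect_def level_def)
    from assms[OF this] that show ?thesis by (simp add: rect_def)
  qed
  then have "(\<lambda>\<omega>. W k (F \<omega>) (int a, int b)) \<in> borel_measurable N"
    unfolding W_def Wuv_def by (intro borel_measurable_diff measurable_LPP)
  then show "(\<lambda>\<omega>. W_array (F \<omega>) j) \<in> N \<rightarrow>\<^sub>M lborel" by (simp add: W_array_def abk)
qed

section \<open>The field of independent exponential weights\<close>

locale exponential_field = prob_space M for M :: "'a measure" +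
  fixes \<xi> :: "int \<times> int \<Rightarrow> 'a \<Rightarrow> real"
  assumes indep: "indep_vars (\<lambda>_. borel) \<xi> UNIV"
    and dist: "\<And>v. distributed M lborel (\<xi> v) (\<lambda>x. ennreal (exponential_density 1 x))"
begin

definition lattice_point :: "nat \<times> nat \<Rightarrow> int \<times> int" where
  "lattice_point = (\<lambda>(a, b). (int a, int b))"

definition diag_weights :: "nat \<Rightarrow> 'a \<Rightarrow> nat \<times> nat \<Rightarrow> real" where
  "diag_weights m \<omega> = restrict (\<lambda>d. \<xi> (lattice_point d) \<omega>) (diag m)"

definition level_values :: "nat \<Rightarrow> 'a \<Rightarrow> nat \<times> nat \<times> nat \<Rightarrow> real" where
  "level_values m \<omega> = restrict (W_array (\<lambda>z. \<xi> z \<omega>)) (level (m - 1) \<union> level m)"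

lemma measurable_field [measurable]: "\<xi> v \<in> borel_measurable M"
  using dist[of v] by (simp add: distributed_def)

lemma inj_lattice_point: "inj lattice_point"
  by (auto simp: inj_on_def lattice_point_def)

lemma indep_lattice: "indep_vars (\<lambda>_. borel) (\<lambda>d. \<xi> (lattice_point d)) I"
  unfolding indep_vars_def2
proof (intro conjI ballI)
  let ?F = "\<lambda>v. {\<xi> v -` A \<inter> space M | A. A \<in> sets borel}"
  show "random_variable borel (\<xi> (lattice_point i))" for i by simp
  have ind: "indep_sets ?F UNIV" using indep unfolding indep_vars_def2 by blast
  show "indep_sets (\<lambda>i. ?F (lattice_point i)) I"
  proof (rule indep_setsI)
    show "?F (lattice_point i) \<subseteq> events" for i by auto
    fix A J assume J: "J \<noteq> {}" "J \<subseteq> I" "finite J" and A: "\<forall>j\<in>J. A j \<in> ?F (lattice_point j)"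
    define A' where "A' v = A (inv_into UNIV lattice_point v)" for v
    have A': "A' (lattice_point j) = A j" for j
      by (simp add: A'_def inv_into_f_f[OF inj_lattice_point])
    have "prob (\<Inter>v\<in>lattice_point ` J. A' v) = (\<Prod>v\<in>lattice_point ` J. prob (A' v))"
      using J A A' by (intro indep_setsD[OF ind]) auto
    then show "prob (\<Inter>j\<in>J. A j) = (\<Prod>j\<in>J. prob (A j))"
      by (simp add: A' prod.reindex inj_on_subset[OF inj_lattice_point])
  qed
qed

lemma distributed_diag_weights:
  "distributed M (\<Lambda> (diag m)) (diag_weights m) (\<lambda>x. \<Prod>d\<in>diag m. ennreal (exponential_density 1 (x d)))"
proof -
  let ?D = "diag m" and ?e = "\<lambda>t. ennreal (exponential_density 1 t)"
  let ?X = "\<lambda>d. \<xi> (lattice_point d)"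
  have e: "?e \<in> borel_measurable lborel" using dist[of "(0, 0)"] by (simp add: distributed_def)
  have law: "distr M borel (?X d) = density lborel ?e" for d
    using dist[of "lattice_point d"] by (simp add: distributed_def cong: distr_cong)
  have prob: "prob_space (density lborel ?e)"
    using prob_space_distr[of "?X (0, 0)" borel] law[of "(0, 0)"] by simp
  interpret P: product_sigma_finite "\<lambda>_ :: nat \<times> nat. lborel :: real measure" ..
  interpret Q: product_prob_space "\<lambda>_ :: nat \<times> nat. density lborel ?e"
    by (intro product_prob_spaceI prob)
  have meas: "(\<lambda>x. \<Prod>d\<in>?D. ?e (x d)) \<in> borel_measurable (\<Lambda> ?D)"
    using e by (intro borel_measurable_prod_ennreal measurable_compose[OF measurable_component]) auto
  \<comment> \<open>Independence is turned into a product law over a nonempty index set.\<close>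
  have "(0, m) \<in> ?D" by (simp add: diag_def)
  then have "distr M (PiM ?D (\<lambda>_. borel)) (\<lambda>\<omega>. \<lambda>d\<in>?D. ?X d \<omega>) = PiM ?D (\<lambda>d. distr M borel (?X d))"
    using indep_lattice[of ?D] by (subst indep_vars_iff_distr_eq_PiM[symmetric]) auto
  also have "\<dots> = PiM ?D (\<lambda>_. density lborel ?e)" by (simp add: law)
  also have "\<dots> = density (\<Lambda> ?D) (\<lambda>x. \<Prod>d\<in>?D. ?e (x d))"
  proof (rule Q.PiM_eqI[symmetric])
    show "sets (density (\<Lambda> ?D) (\<lambda>x. \<Prod>d\<in>?D. ?e (x d))) = sets (PiM ?D (\<lambda>_. density lborel ?e))"
      by (simp cong: sets_PiM_cong)
    fix E assume E: "\<And>d. d \<in> ?D \<Longrightarrow> E d \<in> sets (density lborel ?e)"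
    have "emeasure (density (\<Lambda> ?D) (\<lambda>x. \<Prod>d\<in>?D. ?e (x d))) (PiE ?D E) =
        (\<integral>\<^sup>+x. (\<Prod>d\<in>?D. ?e (x d)) * indicator (PiE ?D E) x \<partial>\<Lambda> ?D)"
      using meas E by (intro emeasure_density sets_PiM_I_finite) auto
    also have "\<dots> = (\<integral>\<^sup>+x. (\<Prod>d\<in>?D. ?e (x d) * indicator (E d) (x d)) \<partial>\<Lambda> ?D)"
      by (rule nn_integral_cong) (auto simp: indicator_PiE space_PiM PiE_iff prod.distrib)
    also have "\<dots> = (\<Prod>d\<in>?D. \<integral>\<^sup>+t. ?e t * indicator (E d) t \<partial>lborel)"
      using e E by (intro P.product_nn_integral_prod) auto
    also have "\<dots> = (\<Prod>d\<in>?D. emeasure (density lborel ?e) (E d))"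
      using e E by (intro prod.cong refl emeasure_density[symmetric]) auto
    finally show "emeasure (density (\<Lambda> ?D) (\<lambda>x. \<Prod>d\<in>?D. ?e (x d))) (PiE ?D E) =
        (\<Prod>d\<in>?D. emeasure (density lborel ?e) (E d))" .
  qed simp
  finally have "distr M (PiM ?D (\<lambda>_. borel)) (\<lambda>\<omega>. \<lambda>d\<in>?D. ?X d \<omega>) = density (\<Lambda> ?D) (\<lambda>x. \<Prod>d\<in>?D. ?e (x d))" .
  moreover have "distr M (\<Lambda> ?D) (diag_weights m) = distr M (PiM ?D (\<lambda>_. borel)) (\<lambda>\<omega>. \<lambda>d\<in>?D. ?X d \<omega>)"
    by (rule distr_cong) (auto simp: diag_weights_def cong: sets_PiM_cong)
  moreover have "diag_weights m \<in> M \<rightarrow>\<^sub>M \<Lambda> ?D"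
    unfolding diag_weights_def by (rule measurable_restrict) simp
  ultimately show ?thesis using meas by (simp add: distributed_def)
qed

lemma measurable_level_values: "level_values m \<in> M \<rightarrow>\<^sub>M \<Lambda> (level (m - 1) \<union> level m)"
  unfolding level_values_def by (rule measurable_W_array) simp

lemma W_array_cong:
  assumes "\<And>z. z \<in> rect (0, 0) (int a, int b) \<Longrightarrow> w z = w' z"
  shows "W_array w (a, b, k) = W_array w' (a, b, k)"
proof -
  have "LPP l w (0, 0) (int a, int b) = LPP l w' (0, 0) (int a, int b)" for l
    unfolding LPP_eq_Max
  proof (intro arg_cong[where f = Max] image_cong refl)
    fix \<gamma>s assume "\<gamma>s \<in> path_families l (0, 0) (int a, int b)"
    then have f: "feasible l (0, 0) (int a, int b) \<gamma>s" by (simp add: path_families_def)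
    show "(\<Sum>i<l. passage_time w (\<gamma>s i)) = (\<Sum>i<l. passage_time w' (\<gamma>s i))"
      unfolding sum_passage_time[OF f] using f by (intro sum.cong refl assms) (auto simp: feasible_def)
  qed
  then show ?thesis by (simp add: W_array_def W_def Wuv_def)
qed

text \<open>The level values for \<open>m\<close> are a function of the weights with
  \<open>a + b < m\<close>, hence independent of those on antidiagonal \<open>m\<close>.\<close>

lemma distr_level_values_diag_weights:
  "distr M (\<Lambda> (level (m - 1) \<union> level m)) (level_values m) \<Otimes>\<^sub>M distr M (\<Lambda> (diag m)) (diag_weights m) =
    distr M (\<Lambda> (level (m - 1) \<union> level m) \<Otimes>\<^sub>M \<Lambda> (diag m)) (\<lambda>\<omega>. (level_values m \<omega>, diag_weights m \<omega>))"
proof -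
  let ?T = "{d :: nat \<times> nat. fst d + snd d < m}" and ?D = "diag m"
  let ?I = "level (m - 1) \<union> level m" and ?X = "\<lambda>d. \<xi> (lattice_point d)"
  let ?PT = "PiM ?T (\<lambda>_. borel :: real measure)" and ?PD = "PiM ?D (\<lambda>_. borel :: real measure)"
  define U where "U \<omega> = restrict (\<lambda>d. ?X d \<omega>) ?T" for \<omega>
  \<comment> \<open>Outside the quadrant \<open>nat\<close> gives spurious arguments, harmlessly:
    the entries depend only on weights in rectangles with a corner at the origin.\<close>
  define g where "g u = restrict (W_array (\<lambda>z. u (nat (fst z), nat (snd z)))) ?I" for u :: "nat \<times> nat \<Rightarrow> real"
  have "indep_var ?PT U ?PD (diag_weights m)"
    unfolding U_def diag_weights_def
    by (rule indep_var_restrict[OF indep_lattice[of UNIV]]) (auto simp: diag_def)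
  then have U: "U \<in> M \<rightarrow>\<^sub>M ?PT" and V: "diag_weights m \<in> M \<rightarrow>\<^sub>M ?PD"
    and UV: "distr M ?PT U \<Otimes>\<^sub>M distr M ?PD (diag_weights m) = distr M (?PT \<Otimes>\<^sub>M ?PD) (\<lambda>\<omega>. (U \<omega>, diag_weights m \<omega>))"
    by (simp_all add: indep_var_distribution_eq)
  have g: "g \<in> ?PT \<rightarrow>\<^sub>M \<Lambda> ?I"
    unfolding g_def
  proof (rule measurable_W_array)
    fix a b :: nat assume "a + b < m"
    then show "(\<lambda>u. u (nat (fst (int a, int b)), nat (snd (int a, int b)))) \<in> borel_measurable ?PT"
      by (simp add: measurable_component_singleton)
  qed
  \<comment> \<open>The identity passes from \<open>borel\<close> to \<open>lborel\<close> as
    factor, which have the same measurable sets.\<close>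
  have h: "(\<lambda>x. x) \<in> ?PD \<rightarrow>\<^sub>M \<Lambda> ?D"
    by (rule measurable_ident_sets) (simp cong: sets_PiM_cong)
  have gU: "level_values m \<omega> = g (U \<omega>)" for \<omega>
    unfolding g_def U_def level_values_def
  proof (rule restrict_ext)
    fix j assume j: "j \<in> ?I"
    obtain a b k where abk: "j = (a, b, k)" by (cases j)
    show "W_array (\<lambda>z. \<xi> z \<omega>) j = W_array (\<lambda>z. (\<lambda>d\<in>?T. ?X d \<omega>) (nat (fst z), nat (snd z))) j"
      unfolding abk
    proof (rule W_array_cong)
      fix z assume z: "z \<in> rect (0, 0) (int a, int b)"
      then have "nat (fst z) + nat (snd z) < m" using j abk by (auto simp: rect_def level_def)
      then show "\<xi> z \<omega> = (\<lambda>d\<in>?T. ?X d \<omega>) (nat (fst z), nat (snd z))"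
        using z by (simp add: lattice_point_def rect_def)
    qed
  qed
  have sfin: "sigma_finite_measure (distr (distr M ?PD (diag_weights m)) (\<Lambda> ?D) (\<lambda>x. x))"
    using prob_space.prob_space_distr[OF prob_space_distr[OF V], of "\<lambda>x. x" "\<Lambda> ?D"] h
    by (simp add: prob_space_imp_sigma_finite)
  have "distr M (\<Lambda> ?I) (level_values m) = distr (distr M ?PT U) (\<Lambda> ?I) g"
    by (simp only: distr_distr[OF g U] comp_def gU[symmetric])
  moreover have "distr M (\<Lambda> ?D) (diag_weights m) = distr (distr M ?PD (diag_weights m)) (\<Lambda> ?D) (\<lambda>x. x)"
    by (subst distr_distr[OF h V]) (simp add: comp_def)
  ultimately have "distr M (\<Lambda> ?I) (level_values m) \<Otimes>\<^sub>M distr M (\<Lambda> ?D) (diag_weights m) =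
      distr (distr M ?PT U \<Otimes>\<^sub>M distr M ?PD (diag_weights m)) (\<Lambda> ?I \<Otimes>\<^sub>M \<Lambda> ?D) (\<lambda>(x, y). (g x, y))"
    using g h sfin by (simp add: pair_measure_distr)
  also have "\<dots> = distr M (\<Lambda> ?I \<Otimes>\<^sub>M \<Lambda> ?D) (\<lambda>\<omega>. (level_values m \<omega>, diag_weights m \<omega>))"
    unfolding UV
  proof (subst distr_distr)
    show "(\<lambda>(x, y). (g x, y)) \<in> ?PT \<Otimes>\<^sub>M ?PD \<rightarrow>\<^sub>M \<Lambda> ?I \<Otimes>\<^sub>M \<Lambda> ?D"
      unfolding case_prod_beta
      by (intro measurable_Pair measurable_compose[OF measurable_fst g] measurable_compose[OF measurable_snd h])
    show "(\<lambda>\<omega>. (U \<omega>, diag_weights m \<omega>)) \<in> M \<rightarrow>\<^sub>M ?PT \<Otimes>\<^sub>M ?PD"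
      by (intro measurable_Pair U V)
  qed (simp add: comp_def gU)
  finally show ?thesis .
qed

lemma AE_field_nonneg: "AE \<omega> in M. \<forall>z. 0 \<le> \<xi> z \<omega>"
  unfolding AE_all_countable
proof
  fix z
  have "AE x in lborel. 0 < ennreal (exponential_density 1 x) \<longrightarrow> 0 \<le> x"
    by (rule AE_I2) (simp add: exponential_density_def)
  then show "AE \<omega> in M. 0 \<le> \<xi> z \<omega>"
    using distributed_AE2[OF dist[of z], of "\<lambda>x. 0 \<le> x"] by simp
qed

lemma level_values_Suc:
  assumes "\<And>z. 0 \<le> \<xi> z \<omega>"
  shows "level_values (Suc m) \<omega> = update_levels m (level_values m \<omega>, diag_weights m \<omega>)"
  unfolding update_levels_def prod.case level_values_def[of "Suc m"] diff_Suc_1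
proof (rule restrict_ext)
  fix j assume "j \<in> level m \<union> level (Suc m)"
  then show "W_array (\<lambda>z. \<xi> z \<omega>) j = local_rule m (level_values m \<omega>) (diag_weights m \<omega>) j"
    using assms
    by (intro W_array_local_rule) (auto simp: level_values_def diag_weights_def lattice_point_def)
qed

text \<open>By independence the pair of level values and new weights has a product density, and by
  \<open>levels_density_update_levels\<close> this density is a function of the image under
  \<open>update_levels\<close>. It can therefore be pushed forward through the measure-preserving
  map as it stands, without constructing an inverse.\<close>

lemma distributed_level_values:
  "distributed M (\<Lambda> (level (m - 1) \<union> level m)) (level_values m) (levels_density m)"
proof (induction m)
  case 0
  \<comment> \<open>Both levels are empty: the product space has the single point \<open>u\<close>,
    and the density there is \<open>exp 0\<close>.\<close>
  define u :: "nat \<times> nat \<times> nat \<Rightarrow> real" where "u = (\<lambda>_. undefined)"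
  have "level_values 0 = (\<lambda>_. u)" by (intro ext) (simp add: level_values_def u_def)
  moreover have "distr M (count_space {u}) (\<lambda>_. u) = density (count_space {u}) (levels_density 0)"
  proof (rule measure_eqI)
    fix A assume "A \<in> sets (distr M (count_space {u}) (\<lambda>_. u))"
    then have "A \<subseteq> {u}" by simp
    then consider "A = {}" | "A = {u}" by blast
    then show "emeasure (distr M (count_space {u}) (\<lambda>_. u)) A =
        emeasure (density (count_space {u}) (levels_density 0)) A"
      by cases (simp_all add: emeasure_distr emeasure_density nn_integral_count_space_finite
          levels_density_def interlaced_def energy_def emeasure_space_1)
  qed simp
  ultimately show ?case by (simp add: distributed_def PiM_empty u_def)
next
  case (Suc m)
  let ?I = "level (m - 1) \<union> level m" and ?K = "level m \<union> level (Suc m)"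
  let ?N = "\<Lambda> ?I \<Otimes>\<^sub>M \<Lambda> (diag m)"
  let ?Y = "\<lambda>\<omega>. (level_values m \<omega>, diag_weights m \<omega>)"
  have sf: "sigma_finite_measure (\<Lambda> I)" if "finite I" for I :: "'i set"
    using product_sigma_finite.sigma_finite[OF product_sigma_finite_lborel that] .
  have joint: "distributed M ?N ?Y (\<lambda>(p, x). levels_density m p * (\<Prod>d\<in>diag m. ennreal (exponential_density 1 (x d))))"
    by (rule distributed_joint_indep'[OF sf sf Suc distributed_diag_weights distr_level_values_diag_weights]) auto
  then have Y: "?Y \<in> M \<rightarrow>\<^sub>M ?N" by (simp add: distributed_def)
  have dens: "levels_density (Suc m) \<in> borel_measurable (\<Lambda> ?K)"
    using measurable_levels_density[of "Suc m"] by simp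
  have lv: "level_values (Suc m) \<in> M \<rightarrow>\<^sub>M \<Lambda> ?K" using measurable_level_values[of "Suc m"] by simp
  have "distr M (\<Lambda> ?K) (level_values (Suc m)) = distr M (\<Lambda> ?K) (update_levels m \<circ> ?Y)"
  proof (rule distr_cong_AE)
    \<comment> \<open>The local rule requires nonnegative weights, which are available almost
      surely.\<close>
    show "AE \<omega> in M. level_values (Suc m) \<omega> = (update_levels m \<circ> ?Y) \<omega>"
      using AE_field_nonneg by eventually_elim (auto intro!: level_values_Suc)
    show "update_levels m \<circ> ?Y \<in> M \<rightarrow>\<^sub>M \<Lambda> ?K"
      by (rule measurable_comp[OF Y measurable_update_levels])
  qed (simp_all add: lv)
  also have "\<dots> = distr (distr M ?N ?Y) (\<Lambda> ?K) (update_levels m)"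
    by (rule distr_distr[symmetric, OF measurable_update_levels Y])
  also have "distr M ?N ?Y = density ?N (\<lambda>y. levels_density (Suc m) (update_levels m y))"
  proof -
    have "(\<lambda>(p, x). levels_density m p * (\<Prod>d\<in>diag m. ennreal (exponential_density 1 (x d)))) =
        (\<lambda>y. levels_density (Suc m) (update_levels m y))"
      by (rule ext) (simp add: levels_density_update_levels split: prod.split)
    then show ?thesis using joint by (simp add: distributed_def)
  qed
  also have "distr \<dots> (\<Lambda> ?K) (update_levels m) =
      density (distr ?N (\<Lambda> ?K) (update_levels m)) (levels_density (Suc m))"
    by (rule density_distr[symmetric, OF dens measurable_update_levels])
  also have "\<dots> = density (\<Lambda> ?K) (levels_density (Suc m))"
    by (simp only: distr_update_levels)
  finally show ?case using lv dens by (simp add: distributed_def)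
qed

end

theorem theorem5p2:
  fixes M :: "'a measure" and \<xi> :: "int \<times> int \<Rightarrow> 'a \<Rightarrow> real" and n :: nat
  assumes "prob_space M"
    and "prob_space.indep_vars M (\<lambda>_. borel) \<xi> UNIV"
    and "\<And>v. distributed M lborel (\<xi> v) (\<lambda>x. ennreal (exponential_density 1 x))"
  shows "\<exists>Z>0. distributed M (PiM (Iset n \<union> Iset (Suc n)) (\<lambda>_. lborel))
           (\<lambda>\<omega>. restrict (\<lambda>(a, b, k). W k (\<lambda>z. \<xi> z \<omega>) (int a, int b))
                          (Iset n \<union> Iset (Suc n)))
           (\<lambda>p. if interlacing n p
                 then ennreal (exp (- (\<Sum>j\<in>Iset (Suc n). p j) + (\<Sum>j\<in>Iset n. p j)) / Z)
                 else 0)"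
proof -
  interpret prob_space M by (rule assms(1))
  interpret exponential_field M \<xi> by unfold_locales (use assms in auto)
  \<comment> \<open>Two successors, because \<open>level (Suc n)\<close> is \<open>Iset n\<close>
    and the upper of the two antidiagonals is \<open>Iset (Suc n)\<close>.\<close>
  have "level_values (Suc (Suc n)) =
      (\<lambda>\<omega>. restrict (\<lambda>(a, b, k). W k (\<lambda>z. \<xi> z \<omega>) (int a, int b)) (Iset n \<union> Iset (Suc n)))"
    by (intro ext) (simp add: level_values_def W_array_def level_Suc)
  moreover have "levels_density (Suc (Suc n)) =
      (\<lambda>p. if interlacing n p
        then ennreal (exp (- (\<Sum>j\<in>Iset (Suc n). p j) + (\<Sum>j\<in>Iset n. p j)) / 1) else 0)"
    by (rule ext) (simp add: levels_density_def interlacing_iff energy_def level_Suc)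
  ultimately show ?thesis
    using distributed_level_values[of "Suc (Suc n)"] by (intro exI[of _ 1]) (simp add: level_Suc)
qed

end
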